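(* Let $\psi:\mathbb{R}_+\to\mathbb{R}_+$ be a concave increasing function such that $$\liminf_{t\to\infty}\frac{\psi(2t)}{\psi(t)}=1.$$ Then the Marcinkiewicz ideal $\mathcal{M}_\psi$ admits a trace which is not fully symmetric.
   Context: $H$ is an infinite-dimensional separable Hilbert space and $B(H)$ is the algebra of all bounded linear operators on $H$. For a compact operator $A\in B(H)$, $\{s_k(A)\}_{k\ge1}$ is the sequence of its singular values (the eigenvalues of $|A|=(A^*A)^{1/2}$, counted with multiplicity) in decreasing order. The Marcinkiewicz ideal is $$\mathcal{M}_\psi=\Big\{A\in B(H)\text{ compact}:\ \sup_{n\in\mathbb{N}}\frac1{\psi(n)}\sum_{k=1}^ns_k(A)<\infty\Big\}.$$ A trace on $\mathcal{M}_\psi$ is a positive linear unitarily invariant functional $\varphi:\mathcal{M}_\psi\to\mathbb{C}$. It is called fully symmetric if $\varphi(B)\le\varphi(A)$ whenever $0\le A,B\in\mathcal{M}_\psi$ satisfy $\sum_{k=1}^ns_k(B)\le\sum_{k=1}^ns_k(A)$ for all $n\in\mathbb{N}$.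
   Formalization: The formal statement additionally assumes that ψ(t) tends to infinity; for bounded ψ, e.g. ψ(t)=t/(1+t), the ideal is the trace class, whose only traces are nonnegative multiples of the usual trace, all fully symmetric, so the claim fails. *)

theory Defs
  imports "HOL-Analysis.Analysis" "HOL-Library.Complex_Order"
begin

text \<open>
  Complex Hilbert spaces. The inner product is linear in its first argument. Positive
  definiteness is contained in \<open>cinner_self\<close>, completeness in the superclass \<^class>\<open>banach\<close>.
\<close>

class complex_hilbert = banach +
  fixes scaleC :: "complex \<Rightarrow> 'a \<Rightarrow> 'a"  (infixr \<open>*\<^sub>C\<close> 75)
    and cinner :: "'a \<Rightarrow> 'a \<Rightarrow> complex"
  assumes scaleC_of_real: "complex_of_real r *\<^sub>C x = r *\<^sub>R x"
    and scaleC_add_right: "a *\<^sub>C (x + y) = a *\<^sub>C x + a *\<^sub>C y"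
    and scaleC_add_left: "(a + b) *\<^sub>C x = a *\<^sub>C x + b *\<^sub>C x"
    and scaleC_scaleC: "a *\<^sub>C b *\<^sub>C x = (a * b) *\<^sub>C x"
    and cinner_commute: "cinner x y = cnj (cinner y x)"
    and cinner_add_left: "cinner (x + y) z = cinner x z + cinner y z"
    and cinner_scaleC_left: "cinner (a *\<^sub>C x) y = a * cinner x y"
    and cinner_self: "cinner x x = complex_of_real ((norm x)\<^sup>2)"

global_interpretation complex_vector:
  vector_space "scaleC :: complex \<Rightarrow> 'a \<Rightarrow> 'a::complex_hilbert"
  defines cspan_raw_def: cspan = complex_vector.span
    and cdim_raw_def: cdim = complex_vector.dim
proof
  fix a b :: complex and x y :: 'a
  show "a *\<^sub>C (x + y) = a *\<^sub>C x + a *\<^sub>C y" by (rule scaleC_add_right)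
  show "(a + b) *\<^sub>C x = a *\<^sub>C x + b *\<^sub>C x" by (rule scaleC_add_left)
  show "a *\<^sub>C b *\<^sub>C x = (a * b) *\<^sub>C x" by (rule scaleC_scaleC)
  show "1 *\<^sub>C x = x" using scaleC_of_real[of 1 x] by simp
qed

definition infinite_dimensional :: "'h::complex_hilbert itself \<Rightarrow> bool" where
  "infinite_dimensional _ \<longleftrightarrow> \<not> (\<exists>B :: 'h set. finite B \<and> cspan B = UNIV)"

definition separable :: "'h::complex_hilbert itself \<Rightarrow> bool" where
  "separable _ \<longleftrightarrow> (\<exists>D :: 'h set. countable D \<and> closure D = UNIV)"

definition bounded_operators :: "('h::complex_hilbert \<Rightarrow> 'h) set" where
  "bounded_operators = {A. bounded_linear A \<and> (\<forall>c x. A (c *\<^sub>C x) = c *\<^sub>C A x)}"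

definition compact_operator :: "('h::complex_hilbert \<Rightarrow> 'h) \<Rightarrow> bool" where
  "compact_operator A \<longleftrightarrow> A \<in> bounded_operators \<and> compact (closure (A ` cball 0 1))"

definition cadjoint :: "('h::complex_hilbert \<Rightarrow> 'h) \<Rightarrow> 'h \<Rightarrow> 'h" where
  "cadjoint A = (THE B. \<forall>x y. cinner (A x) y = cinner x (B y))"

definition unitary_operator :: "('h::complex_hilbert \<Rightarrow> 'h) \<Rightarrow> bool" where
  "unitary_operator U \<longleftrightarrow>
     U \<in> bounded_operators \<and> cadjoint U \<circ> U = id \<and> U \<circ> cadjoint U = id"

text \<open>
  The order on \<^typ>\<open>complex\<close> is \<open>z \<le> w \<longleftrightarrow> Re z \<le> Re w \<and> Im z = Im w\<close>;
  in particular \<open>0 \<le> z\<close> says that \<open>z\<close> is real and nonnegative.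
\<close>

definition positive_operator :: "('h::complex_hilbert \<Rightarrow> 'h) \<Rightarrow> bool" where
  "positive_operator A \<longleftrightarrow> A \<in> bounded_operators \<and> (\<forall>x. 0 \<le> cinner (A x) x)"

definition operator_abs :: "('h::complex_hilbert \<Rightarrow> 'h) \<Rightarrow> 'h \<Rightarrow> 'h" where
  "operator_abs A = (THE T. positive_operator T \<and> T \<circ> T = cadjoint A \<circ> A)"

definition eigenvalue_multiplicity :: "('h::complex_hilbert \<Rightarrow> 'h) \<Rightarrow> real \<Rightarrow> nat" where
  "eigenvalue_multiplicity T r = cdim {x. T x = complex_of_real r *\<^sub>C x}"

text \<open>
  The sequence is indexed from 0, so that \<open>singular_values A k\<close> is \<open>s\<^bsub>k+1\<^esub>(A)\<close>. It is the
  decreasing sequence in which each positive eigenvalue of \<open>|A|\<close> occurs exactly as often as its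
  multiplicity; it is padded with zeros if \<open>A\<close> has finite rank. Finiteness is
  required explicitly because \<^const>\<open>card\<close> is 0 on infinite sets.
\<close>

definition singular_values :: "('h::complex_hilbert \<Rightarrow> 'h) \<Rightarrow> nat \<Rightarrow> real" where
  "singular_values A = (THE s. antimono s \<and> (\<forall>k. 0 \<le> s k) \<and>
     (\<forall>r>0. finite {k. s k = r} \<and>
            card {k. s k = r} = eigenvalue_multiplicity (operator_abs A) r))"

definition marcinkiewicz_ideal :: "(real \<Rightarrow> real) \<Rightarrow> ('h::complex_hilbert \<Rightarrow> 'h) set" where
  "marcinkiewicz_ideal \<psi> = {A. compact_operator A \<and>
     bdd_above ((\<lambda>n::nat. 1 / \<psi> (real n) * (\<Sum>k<n. singular_values A k)) ` {1..})}"

definition trace_on ::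
    "('h::complex_hilbert \<Rightarrow> 'h) set \<Rightarrow> (('h \<Rightarrow> 'h) \<Rightarrow> complex) \<Rightarrow> bool" where
  "trace_on M \<phi> \<longleftrightarrow>
     (\<forall>A\<in>M. \<forall>B\<in>M. \<phi> (\<lambda>x. A x + B x) = \<phi> A + \<phi> B) \<and>
     (\<forall>c. \<forall>A\<in>M. \<phi> (\<lambda>x. c *\<^sub>C A x) = c * \<phi> A) \<and>
     (\<forall>A\<in>M. positive_operator A \<longrightarrow> 0 \<le> \<phi> A) \<and>
     (\<forall>A\<in>M. \<forall>U. unitary_operator U \<longrightarrow> \<phi> (U \<circ> A \<circ> cadjoint U) = \<phi> A)"

definition fully_symmetric_on ::
    "('h::complex_hilbert \<Rightarrow> 'h) set \<Rightarrow> (('h \<Rightarrow> 'h) \<Rightarrow> complex) \<Rightarrow> bool" where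
  "fully_symmetric_on M \<phi> \<longleftrightarrow>
     (\<forall>A\<in>M. \<forall>B\<in>M. positive_operator A \<longrightarrow> positive_operator B \<longrightarrow>
        (\<forall>n. (\<Sum>k<n. singular_values B k) \<le> (\<Sum>k<n. singular_values A k)) \<longrightarrow>
        \<phi> B \<le> \<phi> A)"

end

theory Submission
  imports Defs
begin

text \<open>
  For a positive compact operator \<open>P\<close> let \<open>a\<^sub>P(n)\<close> be the sum of its \<open>n\<close> largest eigenvalues. Ky
  Fan's maximum principle (\<open>ky_fan_upper\<close>) gives \<open>a\<^sub>P\<^sub>+\<^sub>Q(n) \<le> a\<^sub>P(n) + a\<^sub>Q(n) \<le> a\<^sub>P\<^sub>+\<^sub>Q(2n)\<close>
  (\<open>singular_sum_add_le\<close>, \<open>singular_sum_add_ge\<close>). Hence the average of \<open>a\<^sub>P(2\<^sup>jt)\<close> over \<open>m\<close>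
  consecutive values of \<open>j\<close> is additive in \<open>P\<close> up to a telescoping error, which is small when \<open>m\<close>
  is large (\<open>gap_almost_additive\<close>).

  Concavity turns the hypothesis on \<open>\<psi>(2t) / \<psi>(t)\<close> into the existence of arbitrarily long
  windows \<open>[t, 2\<^sup>3\<^sup>mt]\<close> on which \<open>\<psi>\<close> is almost constant (\<open>flat_scale\<close>). For the \<open>n\<close>-th of a
  sparse sequence of such windows let \<open>gap n a\<close> be the average growth of \<open>a\<close> from the lower to the
  upper third of the window, measured in units of \<open>\<psi>(t)\<close>. On partial sums \<open>a\<^sub>P\<close> of operators in the
  ideal these gaps are nonnegative, bounded and asymptotically additive, so every cluster point of them
  is an additive functional on the positive cone. Each operator of the ideal is a combination of four
  positive ones of the ideal (\<open>positive_decomposition\<close>), and the functional extends to a trace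
  (\<open>trace_extension\<close>, \<open>gap_trace\<close>).

  A gap is a difference of two averages that are each monotone under submajorization, and it is not
  monotone itself. For a diagonal operator \<open>A\<close> with \<open>a\<^sub>A(n) = \<psi>(n) - \<psi>(0)\<close> the gaps tend to 0,
  because \<open>\<psi>\<close> is flat on the windows. Let \<open>B\<close> arise from \<open>A\<close> by averaging the singular values over blocks that end where the
  upper thirds of the windows begin. Then \<open>a\<^sub>B \<le> a\<^sub>A\<close> by concavity, but \<open>a\<^sub>B\<close> is still negligible on
  the lower thirds and has caught up with \<open>a\<^sub>A\<close> on the upper thirds; the gaps tend to 1
  (\<open>gap_averaged_large\<close>).

  The operator theory behind this rests on diagonalising positive compact operators
  (\<open>spectral_theorem\<close>). It yields the positive square root of \<open>A\<^sup>*A\<close> and its uniqueness, hence a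
  description of \<open>operator_abs\<close> and \<open>singular_values\<close> on all compact operators
  (\<open>operator_abs_eigensystem\<close>).
\<close>

section \<open>Complex inner products\<close>

lemma cinner_add_right: "cinner x (y + z) = cinner x y + cinner x z"
  for x :: "'h::complex_hilbert"
  by (metis cinner_add_left cinner_commute complex_cnj_add)

lemma cinner_scaleC_right: "cinner x (a *\<^sub>C y) = cnj a * cinner x y"
  for x :: "'h::complex_hilbert"
  by (metis cinner_commute cinner_scaleC_left complex_cnj_mult)

lemma cinner_zero_left [simp]: "cinner 0 y = 0" for y :: "'h::complex_hilbert"
  using cinner_add_left[of 0 0 y] by simp

lemma cinner_zero_right [simp]: "cinner y 0 = 0" for y :: "'h::complex_hilbert"
  using cinner_add_right[of y 0 0] by simp

lemma cinner_minus_left [simp]: "cinner (- x) y = - cinner x y"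
  for y :: "'h::complex_hilbert"
  using cinner_add_left[of x "-x" y] by (simp add: eq_neg_iff_add_eq_0 add.commute)

lemma cinner_minus_right [simp]: "cinner x (- y) = - cinner x y"
  for y :: "'h::complex_hilbert"
  using cinner_add_right[of x y "-y"] by (simp add: eq_neg_iff_add_eq_0 add.commute)

lemma cinner_diff_left: "cinner (x - z) y = cinner x y - cinner z y"
  for y :: "'h::complex_hilbert"
  using cinner_add_left[of x "-z" y] by simp

lemma cinner_diff_right: "cinner x (y - z) = cinner x y - cinner x z"
  for y :: "'h::complex_hilbert"
  using cinner_add_right[of x y "-z"] by simp

lemma cinner_sum_left: "cinner (\<Sum>i\<in>I. f i) y = (\<Sum>i\<in>I. cinner (f i) y)"
  for y :: "'h::complex_hilbert"
  by (induction I rule: infinite_finite_induct) (auto simp: cinner_add_left)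

lemma cinner_sum_right: "cinner y (\<Sum>i\<in>I. f i) = (\<Sum>i\<in>I. cinner y (f i))"
  for y :: "'h::complex_hilbert"
  by (induction I rule: infinite_finite_induct) (auto simp: cinner_add_right)

lemmas cinner_linear = cinner_add_left cinner_add_right cinner_diff_left cinner_diff_right
  cinner_scaleC_left cinner_scaleC_right

lemma cinner_self_Re: "Re (cinner x x) = (norm x)\<^sup>2" for x :: "'h::complex_hilbert"
  by (simp add: cinner_self)

lemma cinner_eq_zero_iff [simp]: "cinner x x = 0 \<longleftrightarrow> x = 0" for x :: "'h::complex_hilbert"
  by (simp add: cinner_self)

lemma scaleR_scaleC: "r *\<^sub>R x = complex_of_real r *\<^sub>C x" for x :: "'h::complex_hilbert"
  by (simp add: scaleC_of_real)

lemma scaleC_minus1: "(-1) *\<^sub>C x = - x" for x :: "'h::complex_hilbert"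
  using scaleC_of_real[of "-1" x] by simp

lemma norm_scaleC: "norm (a *\<^sub>C x) = cmod a * norm x" for x :: "'h::complex_hilbert"
proof -
  have "complex_of_real ((norm (a *\<^sub>C x))\<^sup>2) = complex_of_real ((cmod a * norm x)\<^sup>2)"
    unfolding cinner_self[symmetric] cinner_linear
    by (simp add: cinner_self complex_norm_square[unfolded of_real_power] power_mult_distrib mult_ac)
  then have "(norm (a *\<^sub>C x))\<^sup>2 = (cmod a * norm x)\<^sup>2" using of_real_eq_iff by blast
  then show ?thesis by (simp add: power2_eq_iff_nonneg)
qed

lemma Re_cinner_commute: "Re (cinner x y) = Re (cinner y x)" for x :: "'h::complex_hilbert"
  by (subst cinner_commute) simp

lemma cmod_cinner_commute: "cmod (cinner x y) = cmod (cinner y x)" for x :: "'h::complex_hilbert"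
  by (subst cinner_commute) simp

lemma norm_add_square: "(norm (x + y))\<^sup>2 = (norm x)\<^sup>2 + 2 * Re (cinner x y) + (norm y)\<^sup>2"
  for x :: "'h::complex_hilbert"
  unfolding cinner_self_Re[symmetric] by (simp add: cinner_linear Re_cinner_commute)

lemma norm_diff_square: "(norm (x - y))\<^sup>2 = (norm x)\<^sup>2 - 2 * Re (cinner x y) + (norm y)\<^sup>2"
  for x :: "'h::complex_hilbert"
  unfolding cinner_self_Re[symmetric] by (simp add: cinner_linear Re_cinner_commute)

text \<open>
  Stated for semidefinite forms because it is needed for the inner product, for the forms
  \<open>\<lambda>x y. cinner (P x) y\<close> of positive operators, and for differences of such forms.
\<close>

lemma hermitian_cauchy_schwarz:
  fixes B :: "'h::complex_hilbert \<Rightarrow> 'h \<Rightarrow> complex"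
  assumes add: "\<And>x y z. B (x + y) z = B x z + B y z"
    and scale: "\<And>c x y. B (c *\<^sub>C x) y = c * B x y"
    and hermitian: "\<And>x y. B y x = cnj (B x y)"
    and nonneg: "\<And>x. 0 \<le> Re (B x x)"
  shows "(cmod (B x y))\<^sup>2 \<le> Re (B x x) * Re (B y y)"
proof -
  have addr: "B x (y + z) = B x y + B x z" for x y z
    by (metis add hermitian complex_cnj_add)
  have scaler: "B x (c *\<^sub>C y) = cnj c * B x y" for x y c
    by (metis scale hermitian complex_cnj_mult)
  define l where "l = B x y"
  have quad: "0 \<le> Re (B x x) - 2 * s * (cmod l)\<^sup>2 + s\<^sup>2 * (cmod l)\<^sup>2 * Re (B y y)" for s :: real
  proof -
    \<comment> \<open>The phase of c is opposite to that of B x y, so both cross terms equal - s * (cmod l)^2.\<close>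
    define c where "c = - complex_of_real s * l"
    have "B y y = complex_of_real (Re (B y y))"
      using hermitian[of y y] by (simp add: complex_eq_iff)
    then have yy: "Re (z * B y y) = Re z * Re (B y y)" for z
      by (metis Re_complex_of_real Im_complex_of_real
          mult_zero_right diff_zero times_complex.sel(1))
    have "B (x + c *\<^sub>C y) (x + c *\<^sub>C y) = B x x + cnj c * l + c * cnj l + (c * cnj c) * B y y"
      by (simp add: add addr scale scaler l_def hermitian[of x y] algebra_simps)
    then have "Re (B (x + c *\<^sub>C y) (x + c *\<^sub>C y)) =
        Re (B x x) + Re (cnj c * l) + Re (c * cnj l) + Re (c * cnj c) * Re (B y y)"
      by (simp add: yy)
    moreover have "Re (cnj c * l) = - s * (cmod l)\<^sup>2" "Re (c * cnj l) = - s * (cmod l)\<^sup>2"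
      "Re (c * cnj c) = s\<^sup>2 * (cmod l)\<^sup>2"
      unfolding c_def cmod_power2 by (simp_all add: power2_eq_square algebra_simps)
    ultimately have "Re (B (x + c *\<^sub>C y) (x + c *\<^sub>C y)) =
        Re (B x x) + - s * (cmod l)\<^sup>2 + - s * (cmod l)\<^sup>2 + s\<^sup>2 * (cmod l)\<^sup>2 * Re (B y y)"
      by metis
    then show ?thesis using nonneg[of "x + c *\<^sub>C y"] by simp
  qed
  show ?thesis
  proof (cases "Re (B y y) = 0")
    case True
    have "(cmod l)\<^sup>2 = 0"
    proof (rule ccontr)
      assume n: "(cmod l)\<^sup>2 \<noteq> 0"
      show False using quad[of "(Re (B x x) + 1) / (2 * (cmod l)\<^sup>2)"] n True by simp
    qed
    then show ?thesis using True l_def by simp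
  next
    case False
    then have "Re (B y y) > 0" using nonneg[of y] by simp
    then show ?thesis using quad[of "1 / Re (B y y)"]
      by (simp add: l_def field_simps power2_eq_square)
  qed
qed

lemma cinner_cauchy_schwarz: "cmod (cinner x y) \<le> norm x * norm y"
  for x :: "'h::complex_hilbert"
proof -
  have "(cmod (cinner x y))\<^sup>2 \<le> Re (cinner x x) * Re (cinner y y)"
    by (rule hermitian_cauchy_schwarz) (auto simp: cinner_linear cinner_self intro: cinner_commute)
  then have "(cmod (cinner x y))\<^sup>2 \<le> (norm x * norm y)\<^sup>2"
    by (simp add: cinner_self_Re power_mult_distrib)
  then show ?thesis by (simp add: power2_le_iff_abs_le abs_le_square_iff)
qed

lemma bounded_linear_cinner_left: "bounded_linear (\<lambda>x. cinner x y)"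
  for y :: "'h::complex_hilbert"
  by (rule bounded_linear_intro[where K = "norm y"])
    (auto simp: cinner_linear scaleR_scaleC scaleR_conv_of_real cinner_cauchy_schwarz)

lemma bounded_linear_scaleC: "bounded_linear (\<lambda>x. c *\<^sub>C x)"
  for x :: "'h::complex_hilbert"
  by (rule bounded_linear_intro[where K = "cmod c"])
    (auto simp: scaleC_add_right scaleR_scaleC scaleC_scaleC norm_scaleC mult.commute)

lemmas tendsto_cinner_left = bounded_linear.tendsto[OF bounded_linear_cinner_left]
lemma cinner_eqI: "x = y" if "\<And>z. cinner x z = cinner y z" for x y :: "'h::complex_hilbert"
proof -
  have "cinner (x - y) (x - y) = 0" using that by (simp add: cinner_diff_left)
  then show ?thesis by simp
qed

text \<open>
  The representing vector minimises \<open>\<parallel>x\<parallel>\<^sup>2 - 2 Re f(x)\<close>. By the parallelogram law minimising sequences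
  are Cauchy, so completeness provides a minimiser, and the vanishing of the first variation there is the
  representation formula.
\<close>

theorem riesz_representation:
  fixes f :: "'h::complex_hilbert \<Rightarrow> complex"
  assumes f: "bounded_linear f" and fC: "\<And>c x. f (c *\<^sub>C x) = c * f x"
  obtains z where "\<And>x. f x = cinner x z"
proof -
  interpret f: bounded_linear f by fact
  define J where "J x = (norm x)\<^sup>2 - 2 * Re (f x)" for x
  obtain K where K: "\<And>x. norm (f x) \<le> norm x * K" using f.bounded by blast
  have below: "- K\<^sup>2 \<le> J x" for x
  proof -
    have "Re (f x) \<le> norm x * K" using K[of x] complex_Re_le_cmod order_trans by blast
    moreover have "0 \<le> (norm x - K)\<^sup>2" by simp
    ultimately show ?thesis unfolding J_def by (simp add: power2_diff)
  qed
  define d where "d = Inf (range J)"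
  have bdd: "bdd_below (range J)" using below by (auto simp: bdd_below_def)
  have d: "d \<le> J x" for x unfolding d_def by (rule cInf_lower[OF _ bdd]) simp
  have "\<exists>x. J x < d + e" if "e > 0" for e
  proof -
    have "Inf (range J) < d + e" using that d_def by simp
    then show ?thesis using cInf_lessD[of "range J"] by auto
  qed
  then have "\<exists>x. J x < d + inverse (real (Suc n))" for n by simp
  then obtain X where X: "\<And>n. J (X n) < d + inverse (real (Suc n))" by metis
  have par: "(norm (x - y))\<^sup>2 \<le> 2 * (J x - d) + 2 * (J y - d)" for x y
  proof -
    have "J ((1/2) *\<^sub>R (x + y)) = (1/4) * (norm (x + y))\<^sup>2 - Re (f x) - Re (f y)"
      by (simp add: J_def f.scaleR f.add power_mult_distrib power2_eq_square add_divide_distrib)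
    then have "(norm (x - y))\<^sup>2 = 2 * J x + 2 * J y - 4 * J ((1/2) *\<^sub>R (x + y))"
      by (simp add: J_def norm_add_square norm_diff_square algebra_simps)
    then show ?thesis using d[of "(1/2) *\<^sub>R (x + y)"] by simp
  qed
  have "Cauchy X"
  proof (rule CauchyI)
    fix e :: real assume e: "e > 0"
    obtain N where N: "inverse (real (Suc N)) < e\<^sup>2 / 4"
      using reals_Archimedean[of "e\<^sup>2/4"] e by auto
    have small: "J (X n) - d < e\<^sup>2 / 4" if "n \<ge> N" for n
    proof -
      have "inverse (real (Suc n)) \<le> inverse (real (Suc N))" using that by (simp add: field_simps)
      then show ?thesis using X[of n] N by linarith
    qed
    show "\<exists>M. \<forall>m\<ge>M. \<forall>n\<ge>M. norm (X m - X n) < e"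
    proof (intro exI allI impI)
      fix m n assume "m \<ge> N" "n \<ge> N"
      then have "(norm (X m - X n))\<^sup>2 < e\<^sup>2" using par[of "X m" "X n"] small[of m] small[of n] by simp
      then show "norm (X m - X n) < e" using e by (simp add: power_less_imp_less_base)
    qed
  qed
  then obtain z where z: "X \<longlonglongrightarrow> z" using Cauchy_convergent_iff convergent_def by blast
  have "(\<lambda>n. J (X n)) \<longlonglongrightarrow> J z" unfolding J_def
    by (intro tendsto_intros z f.tendsto)
  moreover have "(\<lambda>n. d + inverse (real (Suc n))) \<longlonglongrightarrow> d"
    using tendsto_add[OF tendsto_const LIMSEQ_inverse_real_of_nat] by simp
  ultimately have "J z \<le> d" using X less_imp_le by (intro LIMSEQ_le) auto
  then have min: "J z \<le> J x" for x using d[of x] by simp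
  have re: "Re (f h) = Re (cinner h z)" for h
  proof (rule ccontr)
    define q where "q = Re (cinner h z) - Re (f h)"
    assume "Re (f h) \<noteq> Re (cinner h z)"
    then have q: "q \<noteq> 0" by (simp add: q_def)
    have var: "0 \<le> 2 * t * q + t\<^sup>2 * (norm h)\<^sup>2" for t
    proof -
      have "J (z + t *\<^sub>R h) = J z + 2 * t * q + t\<^sup>2 * (norm h)\<^sup>2"
        by (simp add: J_def norm_add_square f.add fC q_def scaleR_scaleC cinner_linear
            norm_scaleC power_mult_distrib Re_cinner_commute[of z] algebra_simps)
      then show ?thesis using min[of "z + t *\<^sub>R h"] by simp
    qed
    define w where "w = (norm h)\<^sup>2 + 1"
    have w: "w > 0" "(norm h)\<^sup>2 < w" unfolding w_def by (simp_all add: add_nonneg_pos)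
    have "2 * (- q / w) * q + (- q / w)\<^sup>2 * (norm h)\<^sup>2 < 2 * (- q / w) * q + (- q / w)\<^sup>2 * w"
      using q w by (intro add_strict_left_mono mult_strict_left_mono) auto
    also have "\<dots> = - (q\<^sup>2 / w)" using w by (simp add: field_simps power2_eq_square)
    also have "\<dots> < 0" using q w by simp
    finally show False using var[of "- q / w"] by simp
  qed
  have "f x = cinner x z" for x
    using re[of x] re[of "\<i> *\<^sub>C x"] by (simp add: fC cinner_linear complex_eq_iff)
  then show thesis by (rule that)
qed

section \<open>Bounded operators and adjoints\<close>

lemma bounded_operatorD:
  assumes "A \<in> bounded_operators"
  shows "bounded_linear A" "A (x + y) = A x + A y" "A (x - y) = A x - A y" "A (- x) = - A x"
    "A 0 = 0" "A (c *\<^sub>C x) = c *\<^sub>C A x" "A (r *\<^sub>R x) = r *\<^sub>R A x"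
    "A (sum f I) = (\<Sum>i\<in>I. A (f i))"
proof -
  show bl: "bounded_linear A" and "A (c *\<^sub>C x) = c *\<^sub>C A x"
    using assms by (auto simp: bounded_operators_def)
  interpret bounded_linear A by fact
  show "A (x + y) = A x + A y" "A (x - y) = A x - A y" "A (- x) = - A x"
    "A 0 = 0" "A (r *\<^sub>R x) = r *\<^sub>R A x" "A (sum f I) = (\<Sum>i\<in>I. A (f i))"
    by (auto simp: add diff neg zero scaleR sum)
qed

lemma bounded_operator_bound:
  assumes "A \<in> bounded_operators"
  obtains K where "K > 0" "\<And>x. norm (A x) \<le> K * norm x"
proof -
  obtain K where "K > 0" "\<And>x. norm (A x) \<le> norm x * K"
    using bounded_linear.pos_bounded[OF bounded_operatorD(1)[OF assms]] by auto
  then show thesis using that[of K] by (simp add: mult.commute)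
qed

lemma bounded_operatorI:
  assumes "\<And>x y. A (x + y) = A x + A y" "\<And>c x. A (c *\<^sub>C x) = c *\<^sub>C A x"
    and "\<And>x. norm (A x) \<le> K * norm x"
  shows "A \<in> bounded_operators"
  unfolding bounded_operators_def
  using assms by (auto intro!: bounded_linear_intro[where K = K] simp: scaleR_scaleC mult.commute[of _ K])

lemma bounded_operators_add:
  assumes "A \<in> bounded_operators" "B \<in> bounded_operators"
  shows "(\<lambda>x. A x + B x) \<in> bounded_operators"
  using assms by (auto simp: bounded_operators_def scaleC_add_right intro!: bounded_linear_add)

lemma bounded_operators_scaleC:
  assumes "A \<in> bounded_operators"
  shows "(\<lambda>x. c *\<^sub>C A x) \<in> bounded_operators"
  using assms bounded_linear_compose[OF bounded_linear_scaleC[of c], of A]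
  by (auto simp: bounded_operators_def scaleC_scaleC mult.commute[of c])

lemma bounded_operators_compose:
  assumes "A \<in> bounded_operators" "B \<in> bounded_operators"
  shows "A \<circ> B \<in> bounded_operators"
  using assms bounded_linear_compose[of A B] by (auto simp: bounded_operators_def comp_def)

lemma adjoint_exists:
  assumes "A \<in> bounded_operators"
  shows "\<exists>B. \<forall>x y. cinner (A x) y = cinner x (B y)"
proof -
  have "\<exists>z. \<forall>x. cinner (A x) y = cinner x z" for y
  proof -
    have "bounded_linear (\<lambda>x. cinner (A x) y)"
      using bounded_linear_compose[OF bounded_linear_cinner_left bounded_operatorD(1)[OF assms]] .
    moreover have "cinner (A (c *\<^sub>C x)) y = c * cinner (A x) y" for c x
      by (simp add: bounded_operatorD(6)[OF assms] cinner_linear)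
    ultimately show ?thesis by (rule riesz_representation) blast
  qed
  then show ?thesis by metis
qed

lemma cadjoint_eqI:
  assumes "\<And>x y. cinner (A x) y = cinner x (B y)"
  shows "cadjoint A = B"
  unfolding cadjoint_def
proof (rule the_equality)
  fix C assume "\<forall>x y. cinner (A x) y = cinner x (C y)"
  then have "cinner x (C y) = cinner x (B y)" for x y using assms by simp
  then have "cinner (C y) x = cinner (B y) x" for x y
    by (simp add: cinner_commute[of "C y"] cinner_commute[of "B y"])
  then show "C = B" by (auto intro: cinner_eqI)
qed (use assms in auto)

lemma cinner_cadjoint:
  assumes "A \<in> bounded_operators"
  shows "cinner (A x) y = cinner x (cadjoint A y)"
proof -
  obtain B where "\<forall>x y. cinner (A x) y = cinner x (B y)" using adjoint_exists[OF assms] ..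
  then show ?thesis using cadjoint_eqI[of A B] by simp
qed

lemma cinner_cadjoint':
  assumes "A \<in> bounded_operators"
  shows "cinner (cadjoint A x) y = cinner x (A y)"
  using cinner_cadjoint[OF assms, of y x] by (subst (1 2) cinner_commute) simp

lemma cadjoint_bounded:
  assumes "A \<in> bounded_operators"
  shows "cadjoint A \<in> bounded_operators"
proof -
  obtain K where K: "K > 0" "\<And>x. norm (A x) \<le> K * norm x" by (rule bounded_operator_bound[OF assms]) blast
  show ?thesis
  proof (rule bounded_operatorI)
    show "cadjoint A (x + y) = cadjoint A x + cadjoint A y" for x y
      by (rule cinner_eqI) (simp add: cinner_cadjoint'[OF assms] cinner_linear)
    show "cadjoint A (c *\<^sub>C x) = c *\<^sub>C cadjoint A x" for c x
      by (rule cinner_eqI) (simp add: cinner_cadjoint'[OF assms] cinner_linear)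
    show "norm (cadjoint A x) \<le> K * norm x" for x
    proof (cases "cadjoint A x = 0")
      case False
      have "(norm (cadjoint A x))\<^sup>2 = cmod (cinner x (A (cadjoint A x)))"
        using cinner_cadjoint'[OF assms, of x "cadjoint A x"] cinner_self[of "cadjoint A x"]
        by (metis norm_of_real abs_of_nonneg zero_le_power2)
      also have "\<dots> \<le> norm x * (K * norm (cadjoint A x))"
        using cinner_cauchy_schwarz[of x] K(2)
        by (meson mult_left_mono norm_ge_zero order_trans)
      finally show ?thesis using False by (simp add: power2_eq_square mult_ac)
    qed (use K in simp)
  qed
qed

lemma cadjoint_cadjoint: "A \<in> bounded_operators \<Longrightarrow> cadjoint (cadjoint A) = A"
  by (rule cadjoint_eqI) (rule cinner_cadjoint')

section \<open>Positive operators\<close>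

lemma positive_operator_bounded: "positive_operator P \<Longrightarrow> P \<in> bounded_operators"
  by (simp add: positive_operator_def)

lemma positive_operator_Re: "positive_operator P \<Longrightarrow> 0 \<le> Re (cinner (P x) x)"
  by (auto simp: positive_operator_def less_eq_complex_def)

lemma positive_operator_Im: "positive_operator P \<Longrightarrow> Im (cinner (P x) x) = 0"
  by (auto simp: positive_operator_def less_eq_complex_def)

lemma positive_operatorI:
  assumes "P \<in> bounded_operators" "\<And>x. 0 \<le> Re (cinner (P x) x)" "\<And>x. Im (cinner (P x) x) = 0"
  shows "positive_operator P"
  using assms by (auto simp: positive_operator_def less_eq_complex_def)

text \<open>
  Polarisation: a sesquilinear form over the complex numbers that is real on the diagonal is Hermitian.
\<close>

lemma positive_operator_hermitian:
  assumes P: "positive_operator P"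
  shows "cinner (P x) y = cinner x (P y)"
proof -
  note L = bounded_operatorD[OF positive_operator_bounded[OF P]]
  have "Im (cinner (P (x + y)) (x + y)) = 0" "Im (cinner (P (x + \<i> *\<^sub>C y)) (x + \<i> *\<^sub>C y)) = 0"
    using positive_operator_Im[OF P] by auto
  then have "cinner (P x) y = cnj (cinner (P y) x)"
    by (simp add: L cinner_linear positive_operator_Im[OF P] complex_eq_iff)
  then show ?thesis using cinner_commute[of x "P y"] by simp
qed

lemma cadjoint_positive: "positive_operator P \<Longrightarrow> cadjoint P = P"
  by (rule cadjoint_eqI) (rule positive_operator_hermitian)

lemma self_adjoint_positiveI:
  assumes "P \<in> bounded_operators" "\<And>x y. cinner (P x) y = cinner x (P y)"
    "\<And>x. 0 \<le> Re (cinner (P x) x)"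
  shows "positive_operator P"
proof (rule positive_operatorI)
  show "Im (cinner (P x) x) = 0" for x
    using arg_cong[OF cinner_commute[of x "P x"], of Im] assms(2)[of x x] by simp
qed (use assms in auto)

lemma positive_operator_add:
  assumes "positive_operator P" "positive_operator Q"
  shows "positive_operator (\<lambda>x. P x + Q x)"
  using assms unfolding positive_operator_def
  by (auto simp: cinner_linear intro!: bounded_operators_add add_nonneg_nonneg)

lemma positive_operator_scale:
  assumes "positive_operator P" "0 \<le> r"
  shows "positive_operator (\<lambda>x. complex_of_real r *\<^sub>C P x)"
  using assms unfolding positive_operator_def
  by (auto simp: cinner_linear less_eq_complex_def intro!: bounded_operators_scaleC)

lemma positive_operator_cauchy_schwarz:
  assumes P: "positive_operator P"
  shows "(cmod (cinner (P x) y))\<^sup>2 \<le> Re (cinner (P x) x) * Re (cinner (P y) y)"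
proof (rule hermitian_cauchy_schwarz)
  show "cinner (P y) x = cnj (cinner (P x) y)" for x y
    using positive_operator_hermitian[OF P, of y x] cinner_commute[of y "P x"] by simp
qed (use positive_operator_Re[OF P] bounded_operatorD[OF positive_operator_bounded[OF P]]
     in \<open>auto simp: cinner_linear\<close>)

text \<open>
  Cauchy--Schwarz for the form of \<open>P\<close> at \<open>y\<close> and \<open>P y\<close>, with one factor \<open>\<parallel>P y\<parallel>\<^sup>2\<close> cancelled. Only the
  bound of the form at \<open>P y\<close> enters, so that \<open>S\<close> may be the supremum of the form on the unit sphere of an
  invariant subspace.
\<close>

lemma positive_operator_norm_square_le:
  assumes P: "positive_operator P" and S: "Re (cinner (P (P y)) (P y)) \<le> S * (norm (P y))\<^sup>2"
  shows "(norm (P y))\<^sup>2 \<le> S * Re (cinner (P y) y)"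
proof (cases "P y = 0")
  case False
  have "((norm (P y))\<^sup>2)\<^sup>2 = (cmod (cinner (P y) (P y)))\<^sup>2"
    by (simp add: cinner_self norm_power)
  also have "\<dots> \<le> Re (cinner (P y) y) * Re (cinner (P (P y)) (P y))"
    by (rule positive_operator_cauchy_schwarz[OF P])
  also have "\<dots> \<le> Re (cinner (P y) y) * (S * (norm (P y))\<^sup>2)"
    by (intro mult_left_mono S positive_operator_Re[OF P])
  finally have "(norm (P y))\<^sup>2 * (norm (P y))\<^sup>2 \<le> (S * Re (cinner (P y) y)) * (norm (P y))\<^sup>2"
    unfolding power2_eq_square[of "(norm (P y))\<^sup>2"] by (simp only: mult_ac)
  then show ?thesis by (rule mult_right_le_imp_le) (use False in simp)
qed simp

lemma positive_adjoint_compose: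
  assumes "A \<in> bounded_operators"
  shows "positive_operator (cadjoint A \<circ> A)"
proof (rule self_adjoint_positiveI)
  show "cadjoint A \<circ> A \<in> bounded_operators"
    by (intro bounded_operators_compose cadjoint_bounded assms)
  show "cinner ((cadjoint A \<circ> A) x) y = cinner x ((cadjoint A \<circ> A) y)" for x y
    by (simp add: cinner_cadjoint'[OF assms] cinner_cadjoint[OF assms, symmetric])
  show "0 \<le> Re (cinner ((cadjoint A \<circ> A) x) x)" for x
    by (simp add: cinner_cadjoint'[OF assms] cinner_self)
qed

section \<open>Compact operators\<close>

text \<open>
  Compactness is used through sequences only; this lemma and the next translate the definition.
\<close>

lemma compact_operatorD:
  assumes A: "compact_operator A" and bdd: "bounded (range X)"
  obtains r l where "strict_mono (r :: nat \<Rightarrow> nat)" "(\<lambda>n. A (X (r n))) \<longlonglongrightarrow> l"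
proof -
  obtain K where K: "K > 0" "\<And>n. norm (X n) \<le> K"
    using bdd unfolding bounded_pos by auto
  have bA: "A \<in> bounded_operators" using A by (simp add: compact_operator_def)
  define Y where "Y n = (1 / K) *\<^sub>R X n" for n
  have "A (Y n) \<in> closure (A ` cball 0 1)" for n
    using K closure_subset[of "A ` cball 0 1"] by (auto simp: Y_def field_simps)
  moreover have "seq_compact (closure (A ` cball 0 1))"
    using A by (simp add: compact_operator_def compact_imp_seq_compact)
  ultimately obtain l r where r: "strict_mono r" "((\<lambda>n. A (Y n)) \<circ> r) \<longlonglongrightarrow> l"
    using seq_compactE[of _ "\<lambda>n. A (Y n)"] by metis
  have "(\<lambda>n. K *\<^sub>R A (Y (r n))) \<longlonglongrightarrow> K *\<^sub>R l"
    using r(2) by (intro tendsto_intros) (simp add: comp_def)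
  moreover have "K *\<^sub>R A (Y (r n)) = A (X (r n))" for n
    using K by (simp add: Y_def bounded_operatorD[OF bA])
  ultimately show thesis using that r(1) by auto
qed

lemma compact_operatorI:
  assumes A: "A \<in> bounded_operators"
    and seq: "\<And>X. bounded (range X) \<Longrightarrow> \<exists>r l. strict_mono (r :: nat \<Rightarrow> nat) \<and> (\<lambda>n. A (X (r n))) \<longlonglongrightarrow> l"
  shows "compact_operator A"
  unfolding compact_operator_def
proof (intro conjI A)
  have "seq_compact (closure (A ` cball 0 1))"
    unfolding seq_compact_def
  proof (intro allI impI)
    fix Y :: "nat \<Rightarrow> 'a" assume Y: "\<forall>n. Y n \<in> closure (A ` cball 0 1)"
    have "\<exists>x\<in>cball 0 1. dist (A x) (Y n) < inverse (real (Suc n))" for n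
    proof -
      have "0 < inverse (real (Suc n))" by simp
      then have "\<exists>y\<in>A ` cball 0 1. dist y (Y n) < inverse (real (Suc n))"
        using Y closure_approachable[of "Y n" "A ` cball 0 1"] by blast
      then show ?thesis by blast
    qed
    then have "\<exists>X. \<forall>n. X n \<in> cball 0 1 \<and> dist (A (X n)) (Y n) < inverse (real (Suc n))"
      by (intro choice) blast
    then obtain X where X: "\<And>n. X n \<in> cball 0 1" "\<And>n. dist (A (X n)) (Y n) < inverse (real (Suc n))"
      by blast
    have "bounded (range X)"
      by (rule bounded_subset[OF bounded_cball[of 0 1]]) (use X(1) in blast)
    from seq[OF this] obtain r l where r: "strict_mono r" "(\<lambda>n. A (X (r n))) \<longlonglongrightarrow> l" by blast
    have null: "(\<lambda>n. A (X n) - Y n) \<longlonglongrightarrow> 0"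
    proof (rule Lim_null_comparison[OF _ LIMSEQ_inverse_real_of_nat])
      show "\<forall>\<^sub>F n in sequentially. norm (A (X n) - Y n) \<le> inverse (real (Suc n))"
        using X(2) by (auto simp: dist_norm less_imp_le)
    qed
    then have "(\<lambda>n. A (X (r n)) - Y (r n)) \<longlonglongrightarrow> 0"
      using LIMSEQ_subseq_LIMSEQ[OF null r(1)] by (simp add: comp_def)
    from tendsto_diff[OF r(2) this] have lim: "(Y \<circ> r) \<longlonglongrightarrow> l" by (simp add: comp_def)
    then have "l \<in> closure (A ` cball 0 1)"
      by (rule closed_sequentially[OF closed_closure, rotated]) (use Y in simp)
    then show "\<exists>l\<in>closure (A ` cball 0 1). \<exists>r. strict_mono r \<and> (Y \<circ> r) \<longlonglongrightarrow> l"
      using r(1) lim by blast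
  qed
  then show "compact (closure (A ` cball 0 1))"
    by (simp add: compact_eq_seq_compact_metric)
qed

lemma compact_operator_bounded: "compact_operator A \<Longrightarrow> A \<in> bounded_operators"
  by (simp add: compact_operator_def)

lemma compact_operator_add:
  assumes A: "compact_operator A" and B: "compact_operator B"
  shows "compact_operator (\<lambda>x. A x + B x)"
proof (rule compact_operatorI)
  fix X :: "nat \<Rightarrow> 'a" assume X: "bounded (range X)"
  obtain r l where r: "strict_mono r" "(\<lambda>n. A (X (r n))) \<longlonglongrightarrow> l" using compact_operatorD[OF A X] .
  have "bounded (range (X \<circ> r))" using X by (rule bounded_subset) auto
  then obtain r' l' where r': "strict_mono r'" "(\<lambda>n. B ((X \<circ> r) (r' n))) \<longlonglongrightarrow> l'"
    using compact_operatorD[OF B] by blast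
  have "(\<lambda>n. A (X (r (r' n)))) \<longlonglongrightarrow> l"
    using LIMSEQ_subseq_LIMSEQ[OF r(2) r'(1)] by (simp add: comp_def)
  from tendsto_add[OF this, of _ l'] r' r
  show "\<exists>r l. strict_mono r \<and> (\<lambda>n. A (X (r n)) + B (X (r n))) \<longlonglongrightarrow> l"
    by (intro exI[of _ "r \<circ> r'"] exI[of _ "l + l'"]) (simp add: strict_mono_o)
qed (use assms in \<open>auto intro: bounded_operators_add compact_operator_bounded\<close>)

lemma compact_operator_compose_left:
  assumes A: "compact_operator A" and B: "B \<in> bounded_operators"
  shows "compact_operator (B \<circ> A)"
proof (rule compact_operatorI)
  fix X :: "nat \<Rightarrow> 'a" assume X: "bounded (range X)"
  obtain r l where r: "strict_mono r" "(\<lambda>n. A (X (r n))) \<longlonglongrightarrow> l" using compact_operatorD[OF A X] .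
  have "(\<lambda>n. B (A (X (r n)))) \<longlonglongrightarrow> B l"
    by (rule bounded_linear.tendsto[OF bounded_operatorD(1)[OF B] r(2)])
  with r show "\<exists>r l. strict_mono r \<and> (\<lambda>n. (B \<circ> A) (X (r n))) \<longlonglongrightarrow> l" by auto
qed (use assms in \<open>auto intro: bounded_operators_compose compact_operator_bounded\<close>)

lemma compact_operator_compose_right:
  assumes A: "compact_operator A" and B: "B \<in> bounded_operators"
  shows "compact_operator (A \<circ> B)"
proof (rule compact_operatorI)
  fix X :: "nat \<Rightarrow> 'a" assume X: "bounded (range X)"
  have "bounded (range (\<lambda>n. B (X n)))"
    using bounded_linear_image[OF X bounded_operatorD(1)[OF B]] by (simp add: image_image)
  from compact_operatorD[OF A this] obtain r l where "strict_mono r" "(\<lambda>n. A (B (X (r n)))) \<longlonglongrightarrow> l" .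
  then show "\<exists>r l. strict_mono r \<and> (\<lambda>n. (A \<circ> B) (X (r n))) \<longlonglongrightarrow> l" by auto
qed (use assms in \<open>auto intro: bounded_operators_compose compact_operator_bounded\<close>)

lemma compact_operator_scaleC:
  assumes A: "compact_operator A"
  shows "compact_operator (\<lambda>x. c *\<^sub>C A x)"
proof -
  have "(\<lambda>x. c *\<^sub>C x) \<in> bounded_operators"
    by (rule bounded_operatorI[where K = "cmod c"])
      (auto simp: scaleC_add_right scaleC_scaleC norm_scaleC mult.commute)
  from compact_operator_compose_left[OF A this] show ?thesis by (simp add: comp_def)
qed

text \<open>
  The mixed right-hand side is the one that Cauchy--Schwarz provides for adjoints:
  \<open>\<parallel>A\<^sup>*x\<parallel>\<^sup>2 = \<langle>AA\<^sup>*x, x\<rangle> \<le> \<parallel>AA\<^sup>*x\<parallel> \<parallel>x\<parallel>\<close>.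
\<close>

lemma compact_operator_dominated:
  assumes A: "compact_operator A" and B: "B \<in> bounded_operators"
    and dom: "\<And>x. (norm (B x))\<^sup>2 \<le> C * (norm (A x) * norm x)"
  shows "compact_operator B"
proof (rule compact_operatorI[OF B])
  fix X :: "nat \<Rightarrow> 'a" assume X: "bounded (range X)"
  then obtain K where K: "K > 0" "\<And>n. norm (X n) \<le> K" unfolding bounded_pos by auto
  obtain r l where r: "strict_mono r" "(\<lambda>n. A (X (r n))) \<longlonglongrightarrow> l" using compact_operatorD[OF A X] .
  have C: "(norm (B x))\<^sup>2 \<le> \<bar>C\<bar> * (norm (A x) * norm x)" for x
    by (rule order_trans[OF dom]) (intro mult_right_mono; simp)
  have "Cauchy (\<lambda>n. B (X (r n)))"
  proof (rule CauchyI)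
    fix e :: real assume e: "e > 0"
    define d where "d = e\<^sup>2 / (2 * K * (\<bar>C\<bar> + 1))"
    have d: "d > 0" using e K by (simp add: d_def add_nonneg_pos)
    have "Cauchy (\<lambda>n. A (X (r n)))" using r(2) by (rule LIMSEQ_imp_Cauchy)
    then obtain M where M: "\<And>m n. m \<ge> M \<Longrightarrow> n \<ge> M \<Longrightarrow> norm (A (X (r m)) - A (X (r n))) < d"
      using d CauchyD by blast
    show "\<exists>M. \<forall>m\<ge>M. \<forall>n\<ge>M. norm (B (X (r m)) - B (X (r n))) < e"
    proof (intro exI allI impI)
      fix m n assume mn: "m \<ge> M" "n \<ge> M"
      let ?x = "X (r m) - X (r n)"
      have "norm ?x \<le> 2 * K" using norm_triangle_ineq4[of "X (r m)" "X (r n)"] K(2)[of "r m"] K(2)[of "r n"] by simp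
      moreover have nA: "norm (A ?x) \<le> d" using M[OF mn]
        by (simp add: bounded_operatorD[OF compact_operator_bounded[OF A]])
      ultimately have "\<bar>C\<bar> * (norm (A ?x) * norm ?x) \<le> \<bar>C\<bar> * (d * (2 * K))"
        using d by (intro mult_left_mono mult_mono) auto
      also have "\<dots> < (\<bar>C\<bar> + 1) * (d * (2 * K))" using d K by (intro mult_strict_right_mono) auto
      also have "\<dots> = e\<^sup>2" using K by (simp add: d_def field_simps add_nonneg_eq_0_iff)
      finally have "(norm (B ?x))\<^sup>2 < e\<^sup>2" using C[of ?x] by linarith
      then have "norm (B ?x) < e" using e by (simp add: power_less_imp_less_base)
      then show "norm (B (X (r m)) - B (X (r n))) < e" by (simp add: bounded_operatorD[OF B])
    qed
  qed
  then show "\<exists>r l. strict_mono r \<and> (\<lambda>n. B (X (r n))) \<longlonglongrightarrow> l"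
    using r(1) Cauchy_convergent_iff convergent_def by blast
qed

lemma compact_adjoint_compose:
  assumes "compact_operator A" shows "compact_operator (cadjoint A \<circ> A)"
  by (intro compact_operator_compose_left cadjoint_bounded compact_operator_bounded assms)

lemma compact_operator_cadjoint:
  assumes A: "compact_operator A"
  shows "compact_operator (cadjoint A)"
proof (rule compact_operator_dominated)
  have b: "A \<in> bounded_operators" using A by (rule compact_operator_bounded)
  show "compact_operator (A \<circ> cadjoint A)"
    by (intro compact_operator_compose_right A cadjoint_bounded b)
  show "cadjoint A \<in> bounded_operators" by (rule cadjoint_bounded[OF b])
  show "(norm (cadjoint A x))\<^sup>2 \<le> 1 * (norm ((A \<circ> cadjoint A) x) * norm x)" for x
    using cinner_cauchy_schwarz[of "A (cadjoint A x)" x]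
    by (simp add: cinner_cadjoint[OF b] cinner_self norm_power)
qed

section \<open>Orthonormal families\<close>

definition orthonormal_on :: "'i set \<Rightarrow> ('i \<Rightarrow> 'h::complex_hilbert) \<Rightarrow> bool" where
  "orthonormal_on I e \<longleftrightarrow> (\<forall>i\<in>I. \<forall>j\<in>I. cinner (e i) (e j) = (if i = j then 1 else 0))"

lemma orthonormal_onD:
  "orthonormal_on I e \<Longrightarrow> i \<in> I \<Longrightarrow> j \<in> I \<Longrightarrow> cinner (e i) (e j) = (if i = j then 1 else 0)"
  by (simp add: orthonormal_on_def)

lemma orthonormal_on_subset: "orthonormal_on J e \<Longrightarrow> I \<subseteq> J \<Longrightarrow> orthonormal_on I e"
  unfolding orthonormal_on_def by blast

lemma orthonormal_on_norm: "orthonormal_on I e \<Longrightarrow> i \<in> I \<Longrightarrow> norm (e i) = 1"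
  using cinner_self_Re[of "e i"] orthonormal_onD[of I e i i] norm_ge_zero[of "e i"]
  by (auto simp: power2_eq_1_iff simp del: norm_ge_zero)

lemma norm_normalize: "norm (complex_of_real (1 / norm x) *\<^sub>C x) = 1" if "x \<noteq> 0"
  for x :: "'h::complex_hilbert"
  using that by (simp add: norm_scaleC norm_divide)

lemma cinner_combination:
  assumes "finite I" "orthonormal_on I e" "j \<in> I"
  shows "cinner (\<Sum>i\<in>I. c i *\<^sub>C e i) (e j) = c j"
proof -
  have "cinner (\<Sum>i\<in>I. c i *\<^sub>C e i) (e j) = (\<Sum>i\<in>I. if i = j then c i else 0)"
    unfolding cinner_sum_left using assms(2,3)
    by (intro sum.cong) (auto simp: cinner_linear orthonormal_onD)
  then show ?thesis using assms by simp
qed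

lemma norm_combination:
  assumes "finite I" "orthonormal_on I e"
  shows "(norm (\<Sum>i\<in>I. c i *\<^sub>C e i))\<^sup>2 = (\<Sum>i\<in>I. (cmod (c i))\<^sup>2)"
proof -
  let ?s = "\<Sum>i\<in>I. c i *\<^sub>C e i"
  have "cinner ?s ?s = (\<Sum>i\<in>I. cnj (c i) * cinner ?s (e i))"
    by (subst cinner_sum_right) (simp add: cinner_linear)
  also have "\<dots> = (\<Sum>i\<in>I. complex_of_real ((cmod (c i))\<^sup>2))"
    by (intro sum.cong refl, simp only: cinner_combination[OF assms])
      (simp add: complex_norm_square[unfolded of_real_power] mult.commute)
  finally have "Re (cinner ?s ?s) = (\<Sum>i\<in>I. (cmod (c i))\<^sup>2)" by simp
  then show ?thesis by (simp add: cinner_self_Re)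
qed

definition residual :: "'i set \<Rightarrow> ('i \<Rightarrow> 'h::complex_hilbert) \<Rightarrow> 'h \<Rightarrow> 'h" where
  "residual I e x = x - (\<Sum>i\<in>I. cinner x (e i) *\<^sub>C e i)"

lemma residual_orthogonal:
  assumes "finite I" "orthonormal_on I e" "j \<in> I"
  shows "cinner (residual I e x) (e j) = 0"
  by (simp add: residual_def cinner_diff_left cinner_combination[OF assms])

lemma pythagoras_residual:
  assumes "finite I" "orthonormal_on I e"
  shows "(norm x)\<^sup>2 = (\<Sum>i\<in>I. (cmod (cinner x (e i)))\<^sup>2) + (norm (residual I e x))\<^sup>2"
proof -
  let ?p = "\<Sum>i\<in>I. cinner x (e i) *\<^sub>C e i"
  have "cinner (residual I e x) ?p = 0"
    unfolding cinner_sum_right by (simp add: cinner_linear residual_orthogonal[OF assms])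
  then have "(norm (residual I e x + ?p))\<^sup>2 = (norm (residual I e x))\<^sup>2 + (norm ?p)\<^sup>2"
    by (simp add: norm_add_square)
  then show ?thesis by (simp add: residual_def norm_combination[OF assms])
qed

lemma bessel:
  assumes "finite I" "orthonormal_on I e"
  shows "(\<Sum>i\<in>I. (cmod (cinner x (e i)))\<^sup>2) \<le> (norm x)\<^sup>2"
  using pythagoras_residual[OF assms, of x] by simp

lemma norm_residual_le:
  assumes "finite I" "orthonormal_on I e"
  shows "norm (residual I e x) \<le> norm x"
proof -
  have "(norm (residual I e x))\<^sup>2 \<le> (norm x)\<^sup>2"
    using pythagoras_residual[OF assms, of x] by (simp add: sum_nonneg)
  then show ?thesis by (simp add: power2_le_iff_abs_le abs_le_square_iff)
qed

text \<open>
  That \<open>S\<close> lies in the span of \<open>G\<close> is expressed by vanishing residuals, which is the form that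
  Parseval's identity (\<open>pythagoras_residual\<close>) takes up.
\<close>

lemma gram_schmidt:
  fixes S :: "'h::complex_hilbert set"
  assumes "finite S"
  shows "\<exists>G. finite G \<and> card G \<le> card S \<and> orthonormal_on G (\<lambda>g. g) \<and>
    (\<forall>x\<in>S. residual G (\<lambda>g. g) x = 0)"
  using assms
proof (induction S)
  case empty
  then show ?case by (intro exI[of _ "{}"]) (simp add: orthonormal_on_def)
next
  case (insert x S)
  then obtain G where G: "finite G" "card G \<le> card S" "orthonormal_on G (\<lambda>g. g)"
    "\<And>x. x \<in> S \<Longrightarrow> residual G (\<lambda>g. g) x = 0" by blast
  define r where "r = residual G (\<lambda>g. g) x"
  show ?case
  proof (cases "r = 0")
    case True
    then show ?thesis using G insert.hyps r_def by (intro exI[of _ G]) auto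
  next
    case False
    define g where "g = complex_of_real (1 / norm r) *\<^sub>C r"
    have gg: "cinner g g = 1" unfolding g_def cinner_self norm_normalize[OF False] by simp
    have gG: "cinner g h = 0" if "h \<in> G" for h
      using residual_orthogonal[OF G(1,3) that] by (simp add: g_def r_def cinner_linear)
    have Gg: "cinner h g = 0" if "h \<in> G" for h
      using gG[OF that] by (subst cinner_commute) simp
    have notin: "g \<notin> G" using gg gG by force
    have ins: "residual (insert g G) (\<lambda>g. g) y = residual G (\<lambda>g. g) y - cinner y g *\<^sub>C g" for y
      using notin G(1) by (simp add: residual_def)
    show ?thesis
    proof (intro exI[of _ "insert g G"] conjI ballI)
      show "card (insert g G) \<le> card (insert x S)" using G notin insert.hyps by simp
      show "orthonormal_on (insert g G) (\<lambda>g. g)"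
        using G(3) gg gG Gg notin by (auto simp: orthonormal_on_def)
      fix y assume "y \<in> insert x S"
      then show "residual (insert g G) (\<lambda>g. g) y = 0"
      proof
        assume "y = x"
        have x: "x = r + (\<Sum>h\<in>G. cinner x h *\<^sub>C h)" by (simp add: r_def residual_def)
        have "cinner x g = cinner r g"
          by (subst x) (simp add: cinner_add_left cinner_sum_left cinner_scaleC_left Gg)
        also have "\<dots> = norm r" using False by (simp add: g_def cinner_linear cinner_self power2_eq_square)
        finally have "cinner x g *\<^sub>C g = r" using False by (simp add: g_def scaleC_scaleC)
        then show ?thesis using \<open>y = x\<close> ins r_def by simp
      next
        assume "y \<in> S"
        then have y: "residual G (\<lambda>g. g) y = 0" using G by simp
        then have "y = (\<Sum>h\<in>G. cinner y h *\<^sub>C h)" by (simp add: residual_def)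
        then have "cinner y g = cinner (\<Sum>h\<in>G. cinner y h *\<^sub>C h) g" by simp
        then have "cinner y g = 0" by (simp add: cinner_sum_left cinner_scaleC_left Gg)
        then show ?thesis using ins y by simp
      qed
    qed (use G in simp)
  qed
qed

lemma infinite_dimensional_unit_vector:
  fixes e :: "'i \<Rightarrow> 'h::complex_hilbert"
  assumes inf: "infinite_dimensional TYPE('h)" and I: "finite I" "orthonormal_on I e"
  obtains v where "norm v = 1" "\<And>i. i \<in> I \<Longrightarrow> cinner v (e i) = 0"
proof -
  have "cspan (e ` I) \<noteq> UNIV" using inf I unfolding infinite_dimensional_def by blast
  then obtain x where x: "x \<notin> cspan (e ` I)" by blast
  define r where "r = residual I e x"
  have "(\<Sum>i\<in>I. cinner x (e i) *\<^sub>C e i) \<in> cspan (e ` I)"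
    by (intro complex_vector.span_sum complex_vector.span_scale complex_vector.span_base) auto
  then have r: "r \<noteq> 0" using x by (auto simp: r_def residual_def)
  show thesis
  proof
    show "norm (complex_of_real (1 / norm r) *\<^sub>C r) = 1" by (rule norm_normalize[OF r])
    show "cinner (complex_of_real (1 / norm r) *\<^sub>C r) (e i) = 0" if "i \<in> I" for i
      using residual_orthogonal[OF I that] by (simp add: r_def cinner_linear)
  qed
qed

section \<open>The spectral theorem for positive compact operators\<close>

text \<open>
  A diagonalisation that avoids infinite series. The family \<open>e\<close> need not be complete: the last clause
  bounds the form on the complement of the first \<open>n\<close> eigenvectors, so as \<open>s\<close> tends to 0 it forces \<open>P\<close> to
  vanish on vectors orthogonal to all \<open>e k\<close>.
\<close>

definition eigensystem ::
    "('h::complex_hilbert \<Rightarrow> 'h) \<Rightarrow> (nat \<Rightarrow> real) \<Rightarrow> (nat \<Rightarrow> 'h) \<Rightarrow> bool" where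
  "eigensystem P s e \<longleftrightarrow> positive_operator P \<and> orthonormal_on UNIV e \<and> antimono s \<and>
     (\<forall>k. 0 \<le> s k) \<and> s \<longlonglongrightarrow> 0 \<and> (\<forall>k. P (e k) = complex_of_real (s k) *\<^sub>C e k) \<and>
     (\<forall>n y. (\<forall>k<n. cinner y (e k) = 0) \<longrightarrow> Re (cinner (P y) y) \<le> s n * (norm y)\<^sup>2)"

lemma eigensystemD:
  assumes "eigensystem P s e"
  shows "positive_operator P" "orthonormal_on I e" "antimono s" "0 \<le> s k" "s \<longlonglongrightarrow> 0"
    "P (e k) = complex_of_real (s k) *\<^sub>C e k"
    "(\<And>k. k < n \<Longrightarrow> cinner y (e k) = 0) \<Longrightarrow> Re (cinner (P y) y) \<le> s n * (norm y)\<^sup>2"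
  using assms orthonormal_on_subset[of UNIV e I] unfolding eigensystem_def by auto

text \<open>
  Let \<open>S\<close> be the supremum of the form on unit vectors of \<open>V\<close>. Since \<open>\<parallel>P y\<parallel>\<^sup>2 \<le> S \<langle>P y, y\<rangle>\<close> on \<open>V\<close>, the
  vectors \<open>P y - S y\<close> tend to 0 along a maximising sequence. Compactness makes \<open>P y\<close>, hence \<open>S y\<close>,
  converge along a subsequence, and for \<open>S > 0\<close> the limit gives the eigenvector. If \<open>S = 0\<close>, then \<open>P\<close>
  vanishes on \<open>V\<close>, and the given unit vector \<open>u\<close> serves.
\<close>

lemma rayleigh_maximum_attained:
  assumes P: "positive_operator P" "compact_operator P"
    and V: "closed V" "\<And>y. y \<in> V \<Longrightarrow> P y \<in> V" "\<And>y c. y \<in> V \<Longrightarrow> c *\<^sub>C y \<in> V"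
    and u: "u \<in> V" "norm u = 1"
  obtains v where "v \<in> V" "norm v = 1" "P v = complex_of_real (Re (cinner (P v) v)) *\<^sub>C v"
    "\<And>y. y \<in> V \<Longrightarrow> Re (cinner (P y) y) \<le> Re (cinner (P v) v) * (norm y)\<^sup>2"
proof -
  note L = bounded_operatorD[OF positive_operator_bounded[OF P(1)]]
  define q where "q y = Re (cinner (P y) y)" for y
  define S where "S = Sup (q ` {y \<in> V. norm y = 1})"
  obtain K where K: "K > 0" "\<And>x. norm (P x) \<le> K * norm x"
    by (rule bounded_operator_bound[OF positive_operator_bounded[OF P(1)]]) blast
  have qK: "q y \<le> K" if "norm y = 1" for y
    using cinner_cauchy_schwarz[of "P y" y] complex_Re_le_cmod[of "cinner (P y) y"] K(2)[of y] that
    by (simp add: q_def)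
  have bdd: "bdd_above (q ` {y \<in> V. norm y = 1})" using qK by (auto simp: bdd_above_def)
  have unit: "q y \<le> S" if "y \<in> V" "norm y = 1" for y
    unfolding S_def using that bdd by (intro cSup_upper) auto
  have S0: "0 \<le> S" using unit[OF u] positive_operator_Re[OF P(1), of u] by (simp add: q_def)
  have quad: "q y \<le> S * (norm y)\<^sup>2" if y: "y \<in> V" for y
  proof (cases "y = 0")
    case True then show ?thesis by (simp add: q_def)
  next
    case False
    let ?z = "complex_of_real (1 / norm y) *\<^sub>C y"
    have "q ?z \<le> S" using V(3)[OF y] norm_normalize[OF False] by (intro unit) auto
    moreover have "q ?z = q y / (norm y)\<^sup>2"
      unfolding q_def L cinner_linear by (simp add: power2_eq_square)
    ultimately show ?thesis using False by (simp add: divide_le_eq)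
  qed
  have "\<exists>y. y \<in> V \<and> norm y = 1 \<and> S - inverse (real (Suc n)) < q y" for n
    using less_cSupD[of "q ` {y \<in> V. norm y = 1}" "S - inverse (real (Suc n))"] u
    by (auto simp: S_def[symmetric])
  then have "\<exists>Y. \<forall>n. Y n \<in> V \<and> norm (Y n) = 1 \<and> S - inverse (real (Suc n)) < q (Y n)"
    by (intro choice) blast
  then obtain Y where Y: "\<And>n. Y n \<in> V" "\<And>n. norm (Y n) = 1" "\<And>n. S - inverse (real (Suc n)) < q (Y n)"
    by blast
  have "bounded (range Y)" by (rule bounded_subset[OF bounded_cball[of 0 1]]) (use Y(2) in auto)
  from compact_operatorD[OF P(2) this] obtain r z
    where r: "strict_mono r" "(\<lambda>n. P (Y (r n))) \<longlonglongrightarrow> z" .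
  have near: "norm (P y - S *\<^sub>R y) \<le> sqrt (S * (S - q y))" if y: "y \<in> V" "norm y = 1" for y
  proof -
    have "(norm (P y))\<^sup>2 \<le> S * q y"
      unfolding q_def using quad[OF V(2)[OF y(1)]]
      by (intro positive_operator_norm_square_le[OF P(1)]) (simp add: q_def)
    moreover have "(norm (P y - S *\<^sub>R y))\<^sup>2 = (norm (P y))\<^sup>2 - 2 * (S * q y) + S\<^sup>2"
      using y by (simp add: norm_diff_square scaleR_scaleC cinner_linear q_def norm_scaleC)
    ultimately have "(norm (P y - S *\<^sub>R y))\<^sup>2 \<le> S * (S - q y)"
      by (simp add: algebra_simps power2_eq_square)
    then show ?thesis by (rule real_le_rsqrt)
  qed
  have "(\<lambda>n. P (Y n) - S *\<^sub>R Y n) \<longlonglongrightarrow> 0"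
  proof (rule Lim_null_comparison)
    show "\<forall>\<^sub>F n in sequentially. norm (P (Y n) - S *\<^sub>R Y n) \<le> sqrt (S * inverse (real (Suc n)))"
    proof (intro always_eventually allI)
      fix n
      have "S * (S - q (Y n)) \<le> S * inverse (real (Suc n))"
        using Y(3)[of n] S0 by (intro mult_left_mono) auto
      then show "norm (P (Y n) - S *\<^sub>R Y n) \<le> sqrt (S * inverse (real (Suc n)))"
        using near[OF Y(1,2)[of n]] real_sqrt_le_mono order_trans by blast
    qed
    have "(\<lambda>n. sqrt (S * inverse (real (Suc n)))) \<longlonglongrightarrow> sqrt (S * 0)"
      by (intro tendsto_intros LIMSEQ_inverse_real_of_nat)
    then show "(\<lambda>n. sqrt (S * inverse (real (Suc n)))) \<longlonglongrightarrow> 0" by simp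
  qed
  from LIMSEQ_subseq_LIMSEQ[OF this r(1)]
  have "(\<lambda>n. P (Y (r n)) - S *\<^sub>R Y (r n)) \<longlonglongrightarrow> 0" by (simp add: comp_def)
  from tendsto_diff[OF r(2) this] have lim: "(\<lambda>n. S *\<^sub>R Y (r n)) \<longlonglongrightarrow> z" by simp
  have "\<exists>v. v \<in> V \<and> norm v = 1 \<and> P v = complex_of_real S *\<^sub>C v"
  proof (cases "S = 0")
    case True
    have "(norm (P u))\<^sup>2 \<le> S * q u" unfolding q_def using quad[OF V(2)[OF u(1)]]
      by (intro positive_operator_norm_square_le[OF P(1)]) (simp add: q_def)
    then show ?thesis using True u by (intro exI[of _ u]) simp
  next
    case False
    have lim': "(\<lambda>n. Y (r n)) \<longlonglongrightarrow> (1 / S) *\<^sub>R z"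
      using tendsto_scaleR[OF tendsto_const lim, of "1 / S"] False by simp
    define v where "v = (1 / S) *\<^sub>R z"
    have "v \<in> V" unfolding v_def
      by (rule closed_sequentially[OF V(1) _ lim']) (use Y in simp)
    moreover have "norm v = 1"
      using tendsto_norm[OF lim'] Y(2) LIMSEQ_unique[OF tendsto_const] unfolding v_def by fastforce
    moreover have "(\<lambda>n. P (Y (r n))) \<longlonglongrightarrow> P v"
      unfolding v_def by (rule bounded_linear.tendsto[OF L(1) lim'])
    then have "P v = z" using r(2) LIMSEQ_unique by blast
    then have "P v = complex_of_real S *\<^sub>C v" using False
      by (simp add: v_def scaleR_scaleC scaleC_scaleC)
    ultimately show ?thesis by blast
  qed
  then obtain v where v: "v \<in> V" "norm v = 1" "P v = complex_of_real S *\<^sub>C v" by blast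
  then have "Re (cinner (P v) v) = S" by (simp add: cinner_linear cinner_self)
  then show thesis using that v quad unfolding q_def by simp
qed

text \<open>
  The eigenvectors are chosen one after another as maximisers of the form on the complement of the
  previous ones; infinite dimension keeps these complements nonzero. The eigenvalues tend to 0 because
  otherwise \<open>P\<close> would map an orthonormal sequence to a sequence with uniformly separated terms.
\<close>

theorem spectral_theorem:
  fixes P :: "'h::complex_hilbert \<Rightarrow> 'h"
  assumes inf: "infinite_dimensional TYPE('h)"
    and P: "positive_operator P" "compact_operator P"
  obtains s e where "eigensystem P s e"
proof -
  note L = bounded_operatorD[OF positive_operator_bounded[OF P(1)]]
  define q where "q v = Re (cinner (P v) v)" for v
  define perp where "perp E = {y. \<forall>u\<in>E. cinner y u = 0}" for E :: "'h set"
  define good where "good E v \<longleftrightarrow> v \<in> perp E \<and> norm v = 1 \<and> P v = complex_of_real (q v) *\<^sub>C v \<and>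
    (\<forall>y\<in>perp E. q y \<le> q v * (norm y)\<^sup>2)" for E v
  have ex: "\<exists>v. good (set xs) v"
    if xs: "orthonormal_on (set xs) (\<lambda>u. u)" "\<And>u. u \<in> set xs \<Longrightarrow> P u = complex_of_real (q u) *\<^sub>C u" for xs
  proof -
    obtain u where u: "norm u = 1" "\<And>x. x \<in> set xs \<Longrightarrow> cinner u x = 0"
      using infinite_dimensional_unit_vector[OF inf finite_set xs(1)] by blast
    have "perp (set xs) = (\<Inter>x\<in>set xs. (\<lambda>y. cinner y x) -` {0})" by (auto simp: perp_def)
    then have closed: "closed (perp (set xs))"
      by (auto intro!: closed_INT closed_vimage linear_continuous_on bounded_linear_cinner_left)
    have inv: "P y \<in> perp (set xs)" if "y \<in> perp (set xs)" for y
      using that xs(2) by (auto simp: perp_def positive_operator_hermitian[OF P(1)] cinner_linear)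
    show ?thesis
    proof (rule rayleigh_maximum_attained[OF P closed inv])
      show "u \<in> perp (set xs)" "norm u = 1" using u by (auto simp: perp_def)
      show "c *\<^sub>C y \<in> perp (set xs)" if "y \<in> perp (set xs)" for c y
        using that by (auto simp: perp_def cinner_linear)
    qed (auto simp: good_def q_def)
  qed
  \<comment> \<open>F n lists the first n eigenvectors, so the recursion can refer to all earlier choices.\<close>
  define pick where "pick xs = (SOME v. good (set xs) v)" for xs
  define F where "F = rec_nat [] (\<lambda>_ xs. pick xs # xs)"
  have F: "F 0 = []" "F (Suc n) = pick (F n) # F n" for n by (simp_all add: F_def)
  define e where "e n = pick (F n)" for n
  have setF: "set (F n) = e ` {..<n}" for n
    by (induction n) (auto simp: F e_def lessThan_Suc)
  have inv: "orthonormal_on (set (F n)) (\<lambda>u. u) \<and>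
      (\<forall>u\<in>set (F n). P u = complex_of_real (q u) *\<^sub>C u)" for n
  proof (induction n)
    case 0 then show ?case by (simp add: F orthonormal_on_def)
  next
    case (Suc n)
    then have "\<exists>v. good (set (F n)) v" by (intro ex) auto
    then have "good (set (F n)) (pick (F n))" unfolding pick_def by (rule someI_ex)
    then have g: "pick (F n) \<in> perp (set (F n))" "norm (pick (F n)) = 1"
      "P (pick (F n)) = complex_of_real (q (pick (F n))) *\<^sub>C pick (F n)" by (auto simp: good_def)
    have 0: "cinner (pick (F n)) u = 0" "cinner u (pick (F n)) = 0" if "u \<in> set (F n)" for u
      using g(1) that cinner_commute[of u "pick (F n)"] by (auto simp: perp_def)
    have "pick (F n) \<notin> set (F n)" using 0(1)[of "pick (F n)"] g(2) by auto
    then show ?case using Suc g 0 by (auto simp: F orthonormal_on_def cinner_self)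
  qed
  have good: "good (set (F n)) (e n)" for n
  proof -
    have "\<exists>v. good (set (F n)) v" using inv[of n] by (intro ex) auto
    then show ?thesis unfolding e_def pick_def by (rule someI_ex)
  qed
  define s where "s n = q (e n)" for n
  have less: "cinner (e n) (e k) = 0" if "k < n" for k n
    using good[of n] that by (auto simp: good_def perp_def setF)
  have unit: "norm (e n) = 1" for n using good[of n] by (simp add: good_def)
  have on: "orthonormal_on I e" for I unfolding orthonormal_on_def
  proof (intro ballI)
    fix i j :: nat
    consider "i < j" | "j < i" | "i = j" by linarith
    then show "cinner (e i) (e j) = (if i = j then 1 else 0)"
    proof cases
      case 1 then show ?thesis using less[of i j] cinner_commute[of "e i" "e j"] by simp
    qed (use less[of j i] unit in \<open>auto simp: cinner_self\<close>)
  qed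
  have max: "q y \<le> s n * (norm y)\<^sup>2" if "\<And>k. k < n \<Longrightarrow> cinner y (e k) = 0" for n y
    using good[of n] that by (auto simp: good_def perp_def setF s_def)
  have anti: "antimono s"
  proof (rule decseq_SucI)
    show "s (Suc n) \<le> s n" for n using max[of n "e (Suc n)"] less unit[of "Suc n"] by (simp add: s_def)
  qed
  have nonneg: "0 \<le> s k" for k using positive_operator_Re[OF P(1)] by (simp add: s_def q_def)
  have eig: "P (e k) = complex_of_real (s k) *\<^sub>C e k" for k using good[of k] by (simp add: good_def s_def)
  have lim: "s \<longlonglongrightarrow> 0"
  proof -
    have "\<exists>c. s \<longlonglongrightarrow> c" using anti nonneg decseq_convergent[of s 0] by blast
    then obtain c where c: "s \<longlonglongrightarrow> c" by blast
    have cs: "c \<le> s n" for n using decseq_ge[OF anti c] .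
    have c0: "0 \<le> c" using LIMSEQ_le_const[OF c] nonneg by blast
    have "bounded (range e)" by (rule bounded_subset[OF bounded_cball[of 0 1]]) (use unit in auto)
    from compact_operatorD[OF P(2) this] obtain r l
      where r: "strict_mono r" "(\<lambda>n. P (e (r n))) \<longlonglongrightarrow> l" .
    have "Cauchy (\<lambda>n. P (e (r n)))" using r(2) by (rule LIMSEQ_imp_Cauchy)
    have "c = 0"
    proof (rule ccontr)
      assume "c \<noteq> 0" with c0 have "c > 0" by simp
      then obtain M where M: "\<And>m n. m \<ge> M \<Longrightarrow> n \<ge> M \<Longrightarrow> norm (P (e (r m)) - P (e (r n))) < c"
        using CauchyD[OF \<open>Cauchy _\<close>] by blast
      have ne: "r M \<noteq> r (Suc M)" using r(1) by (simp add: strict_mono_eq)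
      have "(norm (P (e (r M)) - P (e (r (Suc M)))))\<^sup>2 = (s (r M))\<^sup>2 + (s (r (Suc M)))\<^sup>2"
        unfolding norm_diff_square eig using ne
        by (simp add: cinner_linear orthonormal_onD[OF on[of UNIV]] norm_scaleC unit)
      moreover have "c\<^sup>2 \<le> (s (r M))\<^sup>2" using c0 cs by (intro power_mono) auto
      ultimately have "c\<^sup>2 \<le> (norm (P (e (r M)) - P (e (r (Suc M)))))\<^sup>2"
        using zero_le_power2[of "s (r (Suc M))"] by linarith
      then have "c \<le> norm (P (e (r M)) - P (e (r (Suc M))))" by (rule power2_le_imp_le) simp
      then show False using M[of M "Suc M"] by simp
    qed
    then show ?thesis using c by simp
  qed
  have "eigensystem P s e" unfolding eigensystem_def
    using P(1) on anti nonneg lim eig max by (auto simp: q_def)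
  then show thesis by (rule that)
qed

text \<open>
  The complement of a family of eigenvectors is invariant, so the form splits without cross terms.
\<close>

lemma quadratic_form_eigenvectors:
  assumes P: "positive_operator P" and I: "finite I" "orthonormal_on I e"
    and eig: "\<And>i. i \<in> I \<Longrightarrow> P (e i) = complex_of_real (s i) *\<^sub>C e i"
  shows "Re (cinner (P x) x) =
    (\<Sum>i\<in>I. s i * (cmod (cinner x (e i)))\<^sup>2) + Re (cinner (P (residual I e x)) (residual I e x))"
proof -
  note L = bounded_operatorD[OF positive_operator_bounded[OF P]]
  let ?y = "residual I e x"
  define p where "p = (\<Sum>i\<in>I. cinner x (e i) *\<^sub>C e i)"
  have x: "x = p + ?y" by (simp add: p_def residual_def)
  have Pp: "P p = (\<Sum>i\<in>I. (cinner x (e i) * complex_of_real (s i)) *\<^sub>C e i)"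
    unfolding p_def L by (intro sum.cong refl) (simp add: eig scaleC_scaleC)
  have orth: "cinner ?y (e i) = 0" if "i \<in> I" for i using residual_orthogonal[OF I that] .
  have "cinner (e i) ?y = 0" if "i \<in> I" for i using orth[OF that] by (subst cinner_commute) simp
  then have c1: "cinner (P p) ?y = 0" unfolding Pp by (simp add: cinner_sum_left cinner_linear)
  have c2: "cinner (P ?y) p = 0"
    unfolding positive_operator_hermitian[OF P] Pp by (simp add: cinner_sum_right cinner_linear orth)
  have "cinner (P p) p = (\<Sum>i\<in>I. cnj (cinner x (e i)) * cinner (P p) (e i))"
    by (subst (2) p_def, subst cinner_sum_right) (simp add: cinner_linear)
  also have "\<dots> = (\<Sum>i\<in>I. complex_of_real (s i * (cmod (cinner x (e i)))\<^sup>2))"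
    unfolding Pp by (intro sum.cong refl, simp only: cinner_combination[OF I])
      (simp add: complex_norm_square[unfolded of_real_power] mult_ac)
  finally have c3: "cinner (P p) p = complex_of_real (\<Sum>i\<in>I. s i * (cmod (cinner x (e i)))\<^sup>2)" by simp
  have "cinner (P x) x = cinner (P (p + ?y)) (p + ?y)" using x by simp
  also have "\<dots> = cinner (P p) p + cinner (P ?y) ?y"
    by (simp add: L cinner_linear c1 c2)
  finally show ?thesis by (simp add: c3)
qed

lemma quadratic_form_ge_eigenvectors:
  assumes P: "positive_operator P" and I: "finite I" "orthonormal_on I e"
    and eig: "\<And>i. i \<in> I \<Longrightarrow> P (e i) = complex_of_real (s i) *\<^sub>C e i"
  shows "(\<Sum>i\<in>I. s i * (cmod (cinner x (e i)))\<^sup>2) \<le> Re (cinner (P x) x)"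
  using quadratic_form_eigenvectors[OF assms, where x = x] positive_operator_Re[OF P, of "residual I e x"]
  by simp

text \<open>
  The complement of the first \<open>n\<close> eigenvectors is invariant, which lifts the bound of the form there to a
  bound of the norm.
\<close>

lemma eigensystem_tail_norm:
  assumes E: "eigensystem P s e" and y: "\<And>k. k < n \<Longrightarrow> cinner y (e k) = 0"
  shows "norm (P y) \<le> s n * norm y"
proof -
  note D = eigensystemD[OF E]
  have Py: "cinner (P y) (e k) = 0" if "k < n" for k
    using y[OF that] by (simp add: positive_operator_hermitian[OF D(1)] D(6) cinner_linear)
  have "(norm (P y))\<^sup>2 \<le> s n * Re (cinner (P y) y)"
    using D(7)[of n "P y", OF Py] by (rule positive_operator_norm_square_le[OF D(1)])
  also have "\<dots> \<le> s n * (s n * (norm y)\<^sup>2)" using D(7)[of n y, OF y] D(4)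
    by (rule mult_left_mono)
  also have "\<dots> = (s n * norm y)\<^sup>2" by (simp add: power2_eq_square)
  finally show ?thesis by (rule power2_le_imp_le) (simp add: D(4))
qed

text \<open>
  Split \<open>x\<close> into its projection onto \<open>e 0, \<dots>, e (n - 1)\<close> and the residual: the operators agree on
  the former, and on the latter they differ by at most \<open>c n \<parallel>x\<parallel>\<close>.
\<close>

lemma operator_eqI:
  assumes A: "A \<in> bounded_operators" and B: "B \<in> bounded_operators"
    and e: "orthonormal_on UNIV (e :: nat \<Rightarrow> _)" "\<And>k. A (e k) = B (e k)"
    and c: "c \<longlonglongrightarrow> 0"
    and tail: "\<And>n y. (\<And>k. k < n \<Longrightarrow> cinner y (e k) = 0) \<Longrightarrow> norm (A y - B y) \<le> c n * norm y"
  shows "A = B"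
proof
  fix x
  have *: "norm (A x - B x) \<le> \<bar>c n\<bar> * norm x" for n
  proof -
    note on = orthonormal_on_subset[OF e(1) subset_UNIV, of "{..<n}"]
    let ?y = "residual {..<n} e x"
    have "A x - B x = A ?y - B ?y"
      by (simp add: residual_def bounded_operatorD[OF A] bounded_operatorD[OF B] e(2))
    also have "norm \<dots> \<le> c n * norm ?y" by (rule tail) (simp add: residual_orthogonal[OF _ on])
    also have "\<dots> \<le> \<bar>c n\<bar> * norm x" by (intro mult_mono norm_residual_le on) auto
    finally show ?thesis .
  qed
  have "(\<lambda>n. \<bar>c n\<bar> * norm x) \<longlonglongrightarrow> \<bar>0\<bar> * norm x" by (intro tendsto_intros c)
  then have "norm (A x - B x) \<le> 0" by (intro LIMSEQ_le_const[of _ 0]) (use * in auto)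
  then show "A x = B x" by simp
qed

text \<open>
  The vector \<open>y = Q x - r x\<close> satisfies \<open>Q y = - r y\<close>, and a positive operator has no negative
  eigenvalues.
\<close>

lemma positive_root_eigenvector:
  assumes Q: "positive_operator Q" and r: "0 \<le> r" and QQ: "Q (Q x) = complex_of_real (r * r) *\<^sub>C x"
  shows "Q x = complex_of_real r *\<^sub>C x"
proof -
  note L = bounded_operatorD[OF positive_operator_bounded[OF Q]]
  define y where "y = Q x - complex_of_real r *\<^sub>C x"
  have "Q y = complex_of_real (- r) *\<^sub>C y"
    by (simp add: y_def L QQ complex_vector.scale_right_diff_distrib scaleC_scaleC
        complex_vector.scale_minus_left)
  then have "cinner (Q y) y = complex_of_real (- r * (norm y)\<^sup>2)" by (simp add: cinner_linear cinner_self)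
  then have "0 \<le> - r * (norm y)\<^sup>2" using positive_operator_Re[OF Q, of y] by simp
  moreover have "0 \<le> r * (norm y)\<^sup>2" using r by simp
  ultimately have "r * (norm y)\<^sup>2 = 0" by linarith
  then have "r = 0 \<or> y = 0" by simp
  then show ?thesis
  proof
    assume "r = 0"
    then have "cinner (Q x) (Q x) = 0" by (simp add: positive_operator_hermitian[OF Q, symmetric] QQ)
    then show ?thesis using \<open>r = 0\<close> by simp
  qed (simp add: y_def)
qed

text \<open>
  Every positive root multiplies \<open>e k\<close> by \<open>sqrt (s k)\<close>, and its norm on the complement of the first \<open>n\<close>
  eigenvectors is at most \<open>sqrt (s n)\<close>.
\<close>

lemma square_root_unique:
  assumes E: "eigensystem T s e" and R: "positive_operator R" "R \<circ> R = T" and S: "positive_operator S" "S \<circ> S = T"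
  shows "R = S"
proof -
  note D = eigensystemD[OF E]
  have root: "Q (e k) = complex_of_real (sqrt (s k)) *\<^sub>C e k" if Q: "positive_operator Q" "Q \<circ> Q = T" for Q k
  proof -
    have "Q (Q (e k)) = complex_of_real (sqrt (s k) * sqrt (s k)) *\<^sub>C e k"
      using fun_cong[OF Q(2), of "e k"] by (simp add: D(6) D(4) del: of_real_mult)
    then show ?thesis using D(4) by (intro positive_root_eigenvector[OF Q(1)]) auto
  qed
  have tail: "norm (Q y) \<le> sqrt (s n) * norm y"
    if Q: "positive_operator Q" "Q \<circ> Q = T" and y: "\<And>k. k < n \<Longrightarrow> cinner y (e k) = 0" for Q n y
  proof -
    have "(norm (Q y))\<^sup>2 = Re (cinner (T y) y)" using Q(2)
      by (auto simp: cinner_self_Re[symmetric] positive_operator_hermitian[OF Q(1), symmetric])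
    also have "\<dots> \<le> s n * (norm y)\<^sup>2" by (rule D(7)) (rule y)
    also have "\<dots> = (sqrt (s n) * norm y)\<^sup>2" by (simp add: power_mult_distrib D(4))
    finally show ?thesis by (rule power2_le_imp_le) (simp add: D(4))
  qed
  show ?thesis
  proof (rule operator_eqI)
    show "R (e k) = S (e k)" for k using root[OF R] root[OF S] by simp
    show "norm (R y - S y) \<le> 2 * sqrt (s n) * norm y" if "\<And>k. k < n \<Longrightarrow> cinner y (e k) = 0" for n y
      using norm_triangle_ineq4[of "R y" "S y"] tail[OF R, where n = n and y = y]
        tail[OF S, where n = n and y = y] that by simp
    have "(\<lambda>n. 2 * sqrt (s n)) \<longlonglongrightarrow> 2 * sqrt 0" by (intro tendsto_intros D(5))
    then show "(\<lambda>n. 2 * sqrt (s n)) \<longlonglongrightarrow> 0" by simp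
  qed (use R S D(2) positive_operator_bounded in auto)
qed

section \<open>Diagonal operators\<close>

lemma compact_operator_rank_one:
  fixes u v :: "'h::complex_hilbert"
  shows "compact_operator (\<lambda>x. cinner x u *\<^sub>C v)"
proof (rule compact_operatorI)
  have "norm (cinner x u *\<^sub>C v) \<le> (norm u * norm v) * norm x" for x
    using mult_right_mono[OF cinner_cauchy_schwarz[of x u] norm_ge_zero[of v]] by (simp add: norm_scaleC mult_ac)
  then show "(\<lambda>x. cinner x u *\<^sub>C v) \<in> bounded_operators"
    by (intro bounded_operatorI) (auto simp: cinner_linear scaleC_add_left scaleC_scaleC)
  fix X :: "nat \<Rightarrow> 'h" assume "bounded (range X)"
  then have "bounded (range (\<lambda>n. cinner (X n) u))"
    using bounded_linear_image[OF _ bounded_linear_cinner_left[of u], of "range X"] by (simp add: image_image)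
  then obtain l r where r: "strict_mono r" "((\<lambda>n. cinner (X n) u) \<circ> r) \<longlonglongrightarrow> l"
    using bounded_imp_convergent_subsequence by blast
  have "bounded_linear (\<lambda>c. c *\<^sub>C v)"
    by (rule bounded_linear_intro[where K = "norm v"])
      (auto simp: scaleC_add_left norm_scaleC scaleR_scaleC scaleC_scaleC scaleR_conv_of_real)
  from bounded_linear.tendsto[OF this r(2)]
  show "\<exists>r l. strict_mono r \<and> (\<lambda>n. cinner (X (r n)) u *\<^sub>C v) \<longlonglongrightarrow> l"
    using r(1) by (auto simp: comp_def)
qed

lemma compact_operator_zero: "compact_operator (\<lambda>x. 0 :: 'h::complex_hilbert)"
  using compact_operator_rank_one[of _ "0 :: 'h"] by (simp add: complex_vector.scale_zero_right)

lemma compact_operator_sum: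
  assumes "\<And>i. i \<in> I \<Longrightarrow> compact_operator (A i)"
  shows "compact_operator (\<lambda>x. \<Sum>i\<in>I. A i x)"
  using assms
  by (induction I rule: infinite_finite_induct) (auto simp: compact_operator_zero intro: compact_operator_add)

text \<open>
  Total boundedness of the image of the unit ball survives uniform limits.
\<close>

lemma compact_operator_approx:
  fixes A :: "'h::complex_hilbert \<Rightarrow> 'h"
  assumes A: "A \<in> bounded_operators"
    and approx: "\<And>\<epsilon>. \<epsilon> > 0 \<Longrightarrow> \<exists>B. compact_operator B \<and> (\<forall>x. norm (A x - B x) \<le> \<epsilon> * norm x)"
  shows "compact_operator A"
  unfolding compact_operator_def compact_eq_totally_bounded
proof (intro conjI A allI impI)
  show "complete (closure (A ` cball 0 1))" by (simp add: complete_eq_closed)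
  fix d :: real assume d: "d > 0"
  obtain B where B: "compact_operator B" "\<And>x. norm (A x - B x) \<le> d / 4 * norm x"
    using approx[of "d/4"] d by auto
  have "compact (closure (B ` cball 0 1))" using B(1) by (simp add: compact_operator_def)
  then obtain K where K: "finite K" "closure (B ` cball 0 1) \<subseteq> (\<Union>x\<in>K. ball x (d / 4))"
    using d unfolding compact_eq_totally_bounded by (metis zero_less_divide_iff zero_less_numeral)
  have "A ` cball 0 1 \<subseteq> (\<Union>x\<in>K. cball x (d / 2))"
  proof
    fix a assume "a \<in> A ` cball 0 1"
    then obtain x where x: "norm x \<le> 1" "a = A x" by auto
    have "B x \<in> closure (B ` cball 0 1)" using x closure_subset[of "B ` cball 0 1"] by auto
    then obtain k where k: "k \<in> K" "dist k (B x) < d / 4" using K by auto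
    have "dist a (B x) \<le> d / 4"
      using order_trans[OF B(2)[of x] mult_left_mono[OF x(1), of "d/4"]] d by (simp add: x(2) dist_norm)
    then have "dist k a \<le> d / 2" using dist_triangle[of k a "B x"] k(2) by (simp add: dist_commute)
    then show "a \<in> (\<Union>x\<in>K. cball x (d / 2))" using k(1) by auto
  qed
  then have "closure (A ` cball 0 1) \<subseteq> (\<Union>x\<in>K. cball x (d / 2))"
    by (rule closure_minimal) (use K(1) in auto)
  also have "\<dots> \<subseteq> (\<Union>x\<in>K. ball x d)" using d by (intro UN_mono) (auto)
  finally show "\<exists>k. finite k \<and> closure (A ` cball 0 1) \<subseteq> (\<Union>x\<in>k. ball x d)" using K(1) by blast
qed

text \<open>
  The operator is \<open>x \<mapsto> \<Sum>k. s k \<langle>x, e k\<rangle> e k\<close>. By Bessel's inequality the part of the series from \<open>m\<close> on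
  has norm at most \<open>s m \<parallel>x\<parallel>\<close>; this gives convergence and makes the operator a norm limit of operators of
  finite rank.
\<close>

theorem diagonal_operator_exists:
  fixes e :: "nat \<Rightarrow> 'h::complex_hilbert"
  assumes e: "orthonormal_on UNIV e" and s: "antimono s" "\<And>k. 0 \<le> s k" "s \<longlonglongrightarrow> 0"
  obtains D where "eigensystem D s e" "compact_operator D"
proof -
  note on = orthonormal_on_subset[OF e subset_UNIV]
  define t where "t x k = (complex_of_real (s k) * cinner x (e k)) *\<^sub>C e k" for x k
  have block: "norm (\<Sum>k\<in>I. t x k) \<le> s m * norm x" if I: "finite I" "\<And>k. k \<in> I \<Longrightarrow> m \<le> k" for I m x
  proof -
    have "(norm (\<Sum>k\<in>I. t x k))\<^sup>2 = (\<Sum>k\<in>I. (s k)\<^sup>2 * (cmod (cinner x (e k)))\<^sup>2)"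
      unfolding t_def norm_combination[OF I(1) on] by (simp add: norm_mult power_mult_distrib)
    also have "\<dots> \<le> (\<Sum>k\<in>I. (s m)\<^sup>2 * (cmod (cinner x (e k)))\<^sup>2)"
      using I(2) s by (intro sum_mono mult_right_mono power_mono) (auto simp: antimono_def)
    also have "\<dots> \<le> (s m)\<^sup>2 * (norm x)\<^sup>2"
      unfolding sum_distrib_left[symmetric] by (intro mult_left_mono bessel I(1) on) simp
    finally have "(norm (\<Sum>k\<in>I. t x k))\<^sup>2 \<le> (s m * norm x)\<^sup>2" by (simp add: power_mult_distrib)
    then show ?thesis by (rule power2_le_imp_le) (simp add: s)
  qed
  have summ: "summable (t x)" for x
    unfolding summable_Cauchy
  proof (intro allI impI)
    fix d :: real assume d: "d > 0"
    have "(\<lambda>n. s n * norm x) \<longlonglongrightarrow> 0 * norm x" by (intro tendsto_intros s)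
    then have "\<forall>\<^sub>F n in sequentially. s n * norm x < d" using d by (intro order_tendstoD(2)) auto
    then obtain N where N: "\<And>n. n \<ge> N \<Longrightarrow> s n * norm x < d" by (auto simp: eventually_sequentially)
    show "\<exists>N. \<forall>m\<ge>N. \<forall>n. norm (sum (t x) {m..<n}) < d"
    proof (intro exI allI impI)
      fix m n assume "m \<ge> N"
      then show "norm (sum (t x) {m..<n}) < d" using block[of "{m..<n}" m x] N[of m] by auto
    qed
  qed
  define D where "D x = (\<Sum>k. t x k)" for x
  have lim: "(\<lambda>n. \<Sum>k<n. t x k) \<longlonglongrightarrow> D x" for x
    unfolding D_def using summ by (rule summable_LIMSEQ)
  have tail: "norm (D x - (\<Sum>k<m. t x k)) \<le> s m * norm x" for x m
  proof (rule Lim_norm_ubound[OF trivial_limit_sequentially])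
    show "(\<lambda>n. (\<Sum>k<n. t x k) - (\<Sum>k<m. t x k)) \<longlonglongrightarrow> D x - (\<Sum>k<m. t x k)"
      by (intro tendsto_diff lim tendsto_const)
    show "\<forall>\<^sub>F n in sequentially. norm ((\<Sum>k<n. t x k) - (\<Sum>k<m. t x k)) \<le> s m * norm x"
    proof (rule eventually_sequentiallyI)
      fix n assume "m \<le> n"
      then have "(\<Sum>k<n. t x k) - (\<Sum>k<m. t x k) = (\<Sum>k\<in>{m..<n}. t x k)"
        by (simp add: sum_diff_nat_ivl lessThan_atLeast0)
      then show "norm ((\<Sum>k<n. t x k) - (\<Sum>k<m. t x k)) \<le> s m * norm x"
        using block[of "{m..<n}" m x] by simp
    qed
  qed
  have Db: "D \<in> bounded_operators"
  proof (rule bounded_operatorI)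
    show "norm (D x) \<le> s 0 * norm x" for x using tail[of x 0] by simp
    show "D (x + y) = D x + D y" for x y
    proof -
      have "t (x + y) = (\<lambda>k. t x k + t y k)"
        by (simp add: fun_eq_iff t_def cinner_linear scaleC_add_left distrib_left)
      then show ?thesis using suminf_add[OF summ summ, of x y] by (simp add: D_def)
    qed
    show "D (c *\<^sub>C x) = c *\<^sub>C D x" for c x
    proof -
      have "t (c *\<^sub>C x) = (\<lambda>k. c *\<^sub>C t x k)"
        by (simp add: fun_eq_iff t_def cinner_linear scaleC_scaleC mult_ac)
      then show ?thesis
        using bounded_linear.suminf[OF bounded_linear_scaleC summ, of c x] by (simp add: D_def)
    qed
  qed
  have form: "(\<lambda>n. \<Sum>k<n. complex_of_real (s k) * cinner x (e k) * cinner (e k) y) \<longlonglongrightarrow> cinner (D x) y" for x y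
    using tendsto_cinner_left[OF lim[of x], of y] by (simp add: cinner_sum_left t_def cinner_linear)
  have quad: "(\<lambda>n. \<Sum>k<n. s k * (cmod (cinner x (e k)))\<^sup>2) \<longlonglongrightarrow> Re (cinner (D x) x)" for x
  proof -
    have "Re (complex_of_real (s k) * cinner x (e k) * cinner (e k) x) = s k * (cmod (cinner x (e k)))\<^sup>2" for k
    proof -
      have "cinner x (e k) * cinner (e k) x = complex_of_real ((cmod (cinner x (e k)))\<^sup>2)"
        using cinner_commute[of "e k" x] complex_norm_square[of "cinner x (e k)"] by simp
      then show ?thesis by (simp only: mult.assoc of_real_mult[symmetric] Re_complex_of_real)
    qed
    then show ?thesis using tendsto_Re[OF form[of x x]] by simp
  qed
  have pos: "positive_operator D"
  proof (rule self_adjoint_positiveI[OF Db])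
    show "0 \<le> Re (cinner (D x) x)" for x
      using quad[of x] by (rule LIMSEQ_le_const) (auto intro!: exI[of _ 0] sum_nonneg mult_nonneg_nonneg s)
    show "cinner (D x) y = cinner x (D y)" for x y
    proof -
      have "cnj (complex_of_real (s k) * cinner y (e k) * cinner (e k) x) =
          complex_of_real (s k) * cinner x (e k) * cinner (e k) y" for k
        using cinner_commute[of y "e k"] cinner_commute[of x "e k"] by simp
      then have "(\<lambda>n. \<Sum>k<n. complex_of_real (s k) * cinner x (e k) * cinner (e k) y) \<longlonglongrightarrow> cnj (cinner (D y) x)"
        using tendsto_cnj[OF form[of y x]] by (simp only: cnj_sum)
      from LIMSEQ_unique[OF form[of x y] this] have "cinner (D x) y = cnj (cinner (D y) x)" .
      then show ?thesis using cinner_commute[of x "D y"] by simp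
    qed
  qed
  have eig: "D (e k) = complex_of_real (s k) *\<^sub>C e k" for k
  proof -
    have "t (e k) j = (if j = k then complex_of_real (s k) *\<^sub>C e k else 0)" for j
      by (simp add: t_def orthonormal_onD[OF e])
    then show ?thesis unfolding D_def using suminf_finite[of "{k}" "t (e k)"] by simp
  qed
  have max: "Re (cinner (D y) y) \<le> s n * (norm y)\<^sup>2" if y: "\<And>k. k < n \<Longrightarrow> cinner y (e k) = 0" for n y
  proof -
    have "(\<Sum>k<m. s k * (cmod (cinner y (e k)))\<^sup>2) \<le> s n * (norm y)\<^sup>2" for m
    proof -
      have "(\<Sum>k<m. s k * (cmod (cinner y (e k)))\<^sup>2) \<le> (\<Sum>k<m. s n * (cmod (cinner y (e k)))\<^sup>2)"
      proof (rule sum_mono)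
        fix k show "s k * (cmod (cinner y (e k)))\<^sup>2 \<le> s n * (cmod (cinner y (e k)))\<^sup>2"
        proof (cases "k < n")
          case False
          then show ?thesis using s(1) by (intro mult_right_mono) (auto simp: antimono_def)
        qed (simp add: y)
      qed
      also have "\<dots> \<le> s n * (norm y)\<^sup>2"
        unfolding sum_distrib_left[symmetric] by (rule mult_left_mono[OF bessel[OF _ on] s(2)]) simp
      finally show ?thesis .
    qed
    then show ?thesis by (intro LIMSEQ_le_const2[OF quad[of y]]) auto
  qed
  have cpt: "compact_operator D"
  proof (rule compact_operator_approx[OF Db])
    fix d :: real assume "d > 0"
    then have "\<forall>\<^sub>F n in sequentially. s n < d" by (intro order_tendstoD(2)[OF s(3)])
    then obtain N where N: "s N < d" by (auto simp: eventually_sequentially)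
    have "(\<lambda>x. t x k) = (\<lambda>x. cinner x (e k) *\<^sub>C (complex_of_real (s k) *\<^sub>C e k))" for k
      by (simp add: fun_eq_iff t_def scaleC_scaleC mult.commute)
    then have "compact_operator (\<lambda>x. t x k)" for k by (simp only: compact_operator_rank_one)
    then have "compact_operator (\<lambda>x. \<Sum>k<N. t x k)" by (rule compact_operator_sum)
    moreover have "norm (D x - (\<Sum>k<N. t x k)) \<le> d * norm x" for x
      using tail[of x N] N mult_right_mono[of "s N" d "norm x"] by simp
    ultimately show "\<exists>B. compact_operator B \<and> (\<forall>x. norm (D x - B x) \<le> d * norm x)" by blast
  qed
  have "eigensystem D s e" unfolding eigensystem_def
  proof (intro conjI allI impI)
    fix n y assume "\<forall>k<n. cinner y (e k) = 0"
    then show "Re (cinner (D y) y) \<le> s n * (norm y)\<^sup>2" by (intro max) simp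
  qed (rule pos e s eig)+
  then show thesis using cpt by (rule that)
qed

section \<open>Singular values\<close>

lemma orthonormal_on_inj:
  assumes "orthonormal_on I e" shows "inj_on e I"
proof (rule inj_onI, rule ccontr)
  fix i j assume "i \<in> I" "j \<in> I" "e i = e j" "i \<noteq> j"
  then show False using orthonormal_onD[OF assms, of i j] orthonormal_onD[OF assms, of j j] by simp
qed

lemma orthonormal_independent:
  assumes "finite I" "orthonormal_on I e"
  shows "complex_vector.independent (e ` I)"
proof (rule ccontr)
  assume "\<not> ?thesis"
  then obtain u i where i: "i \<in> I" "u (e i) \<noteq> 0" and sum: "(\<Sum>v\<in>e ` I. u v *\<^sub>C v) = 0"
    using assms(1) by (auto simp: complex_vector.dependent_finite)
  have "(\<Sum>i\<in>I. u (e i) *\<^sub>C e i) = 0"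
    using sum by (simp add: sum.reindex[OF orthonormal_on_inj[OF assms(2)]])
  then have "u (e i) = 0" using cinner_combination[OF assms i(1), of "\<lambda>i. u (e i)"] by simp
  then show False using i by simp
qed

lemma eigensystem_level_finite:
  assumes E: "eigensystem P s e" and r: "r > 0"
  shows "finite {k. s k = r}"
proof -
  have "\<forall>\<^sub>F k in sequentially. s k < r" using eigensystemD(5)[OF E] r by (rule order_tendstoD(2))
  then obtain N where "\<And>k. k \<ge> N \<Longrightarrow> s k < r" by (auto simp: eventually_sequentially)
  then have "{k. s k = r} \<subseteq> {..<N}" by (metis (mono_tags) less_irrefl lessThan_iff linorder_not_le mem_Collect_eq subsetI)
  then show ?thesis by (rule finite_subset) simp
qed

text \<open>
  The \<open>e k\<close> with \<open>s k = r\<close> form a basis of the eigenspace: the residual of an eigenvector is orthogonal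
  to every \<open>e k\<close>, and \<open>P\<close> vanishes on such vectors, whereas it acts on the residual as \<open>r > 0\<close>.
\<close>

lemma eigenspace_dimension:
  assumes E: "eigensystem P s e" and r: "r > 0"
  shows "eigenvalue_multiplicity P r = card {k. s k = r}"
proof -
  note D = eigensystemD[OF E]
  note L = bounded_operatorD[OF positive_operator_bounded[OF D(1)]]
  define K where "K = {k. s k = r}"
  have K: "finite K" unfolding K_def by (rule eigensystem_level_finite[OF E r])
  define V where "V = {x. P x = complex_of_real r *\<^sub>C x}"
  have sub: "e ` K \<subseteq> V" by (auto simp: V_def K_def D(6))
  have "V \<subseteq> cspan (e ` K)"
  proof
    fix x assume "x \<in> V"
    then have x: "P x = complex_of_real r *\<^sub>C x" by (simp add: V_def)
    define y where "y = residual K e x"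
    have y: "P y = complex_of_real r *\<^sub>C y"
      by (simp add: y_def residual_def L x complex_vector.scale_right_diff_distrib
          complex_vector.scale_sum_right D(6) scaleC_scaleC K_def mult.commute)
    have orth: "cinner y (e k) = 0" for k
    proof (cases "k \<in> K")
      case True then show ?thesis unfolding y_def by (rule residual_orthogonal[OF K D(2)])
    next
      case False
      have "complex_of_real r * cinner y (e k) = complex_of_real (s k) * cinner y (e k)"
        using positive_operator_hermitian[OF D(1), of y "e k"] by (simp add: y D(6) cinner_linear)
      then show ?thesis using False by (simp add: K_def)
    qed
    have "norm (P y) \<le> s n * norm y" for n by (rule eigensystem_tail_norm[OF E]) (rule orth)
    moreover have "(\<lambda>n. s n * norm y) \<longlonglongrightarrow> 0 * norm y" by (intro tendsto_intros D(5))
    ultimately have "norm (P y) \<le> 0" by (intro LIMSEQ_le_const[of _ 0]) auto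
    then have "y = 0" using y r by simp
    then have "x = (\<Sum>k\<in>K. cinner x (e k) *\<^sub>C e k)" by (simp add: y_def residual_def)
    also have "\<dots> \<in> cspan (e ` K)"
      by (intro complex_vector.span_sum complex_vector.span_scale complex_vector.span_base) auto
    finally show "x \<in> cspan (e ` K)" .
  qed
  then have "cspan (e ` K) = cspan V"
    using sub by (metis complex_vector.span_mono complex_vector.span_span subset_antisym)
  then have "cdim V = card (e ` K)"
    using orthonormal_independent[OF K D(2)] by (rule complex_vector.dim_eq_card)
  also have "\<dots> = card K" by (rule card_image[OF orthonormal_on_inj[OF D(2)]])
  finally show ?thesis by (simp add: eigenvalue_multiplicity_def V_def K_def)
qed

text \<open>
  At the first index where the sequences differ, the larger of the two values is positive, and the
  sequence that attains it there attains it strictly more often than the other one.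
\<close>

lemma decreasing_sequence_determined:
  fixes s s' :: "nat \<Rightarrow> real"
  assumes "antimono s" "antimono s'" "\<And>k. 0 \<le> s k" "\<And>k. 0 \<le> s' k"
    and "\<And>r. r > 0 \<Longrightarrow> finite {k. s k = r} \<and> finite {k. s' k = r} \<and> card {k. s k = r} = card {k. s' k = r}"
  shows "s = s'"
proof -
  have no: False
    if a: "antimono b" "\<And>k. 0 \<le> b k"
      and c: "\<And>r. r > 0 \<Longrightarrow> finite {k. a k = r} \<and> card {k. a k = r} = card {k. b k = r}"
      and eq: "\<And>i. i < k \<Longrightarrow> a i = b i" and less: "b k < a k" for a b :: "nat \<Rightarrow> real" and k
  proof -
    have r: "a k > 0" using less a(2)[of k] by simp
    have "{i. b i = a k} \<subseteq> {i. a i = a k} - {k}"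
    proof
      fix i assume i: "i \<in> {i. b i = a k}"
      have "i < k"
      proof (rule ccontr)
        assume "\<not> i < k"
        then show False using antimonoD[OF a(1), of k i] less i by simp
      qed
      then show "i \<in> {i. a i = a k} - {k}" using eq i by simp
    qed
    also have "\<dots> \<subset> {i. a i = a k}" by auto
    finally have "card {i. b i = a k} < card {i. a i = a k}" using c[OF r] by (intro psubset_card_mono) auto
    then show False using c[OF r] by simp
  qed
  have "s k = s' k" for k
  proof (induction k rule: less_induct)
    case (less k)
    show ?case
    proof (rule antisym)
      show "s k \<le> s' k"
      proof (rule ccontr)
        assume "\<not> s k \<le> s' k"
        then show False using assms(5) less by (intro no[OF assms(2,4), of s k]) auto
      qed
      show "s' k \<le> s k"
      proof (rule ccontr)
        assume "\<not> s' k \<le> s k"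
        then show False using assms(5) less by (intro no[OF assms(1,3), of s' k]) auto
      qed
    qed
  qed
  then show ?thesis by blast
qed

lemma singular_values_eqI:
  assumes E: "eigensystem (operator_abs A) s e"
  shows "singular_values A = s"
  unfolding singular_values_def
proof (rule the_equality)
  note D = eigensystemD[OF E]
  show P: "antimono s \<and> (\<forall>k. 0 \<le> s k) \<and> (\<forall>r>0. finite {k. s k = r} \<and>
      card {k. s k = r} = eigenvalue_multiplicity (operator_abs A) r)"
    using D eigensystem_level_finite[OF E] eigenspace_dimension[OF E] by auto
  fix s' :: "nat \<Rightarrow> real"
  assume s': "antimono s' \<and> (\<forall>k. 0 \<le> s' k) \<and> (\<forall>r>0. finite {k. s' k = r} \<and>
      card {k. s' k = r} = eigenvalue_multiplicity (operator_abs A) r)"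
  show "s' = s" by (rule decreasing_sequence_determined) (use P s' in auto)
qed

text \<open>
  The diagonal operator whose entries are the square roots of the eigenvalues of \<open>A\<^sup>*A\<close> is a positive
  root of \<open>A\<^sup>*A\<close>, and by uniqueness it is the one described by \<open>operator_abs A\<close>.
\<close>

theorem operator_abs_eigensystem:
  fixes A :: "'h::complex_hilbert \<Rightarrow> 'h"
  assumes inf: "infinite_dimensional TYPE('h)" and A: "compact_operator A"
  obtains e where "eigensystem (operator_abs A) (singular_values A) e"
    "operator_abs A \<circ> operator_abs A = cadjoint A \<circ> A" "compact_operator (operator_abs A)"
proof -
  let ?T = "cadjoint A \<circ> A"
  have bA: "A \<in> bounded_operators" by (rule compact_operator_bounded[OF A])
  obtain s e where E: "eigensystem ?T s e"
    using spectral_theorem[OF inf positive_adjoint_compose[OF bA] compact_adjoint_compose[OF A]] .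
  note D = eigensystemD[OF E]
  have "antimono (\<lambda>k. sqrt (s k))" using D(3) by (simp add: antimono_def)
  moreover have "(\<lambda>k. sqrt (s k)) \<longlonglongrightarrow> 0" using tendsto_real_sqrt[OF D(5)] by simp
  ultimately obtain R where R: "eigensystem R (\<lambda>k. sqrt (s k)) e" "compact_operator R"
    using diagonal_operator_exists[OF D(2)] D(4) by (metis real_sqrt_ge_zero)
  note DR = eigensystemD[OF R(1)]
  have RR: "R \<circ> R = ?T"
  proof (rule operator_eqI[OF _ _ D(2)])
    show "R \<circ> R \<in> bounded_operators" "?T \<in> bounded_operators"
      by (intro bounded_operators_compose positive_operator_bounded DR(1) D(1))+
    have "complex_of_real (sqrt (s k)) * complex_of_real (sqrt (s k)) = complex_of_real (s k)" for k
      unfolding of_real_mult[symmetric] using D(4)[of k] by simp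
    then show "(R \<circ> R) (e k) = ?T (e k)" for k
      using D(6)[of k] bounded_operatorD(6)[OF positive_operator_bounded[OF DR(1)]]
      by (simp add: DR(6) scaleC_scaleC)
    have "(\<lambda>n. 2 * s n) \<longlonglongrightarrow> 2 * 0" by (intro tendsto_intros D(5))
    then show "(\<lambda>n. 2 * s n) \<longlonglongrightarrow> 0" by simp
    show "norm ((R \<circ> R) y - ?T y) \<le> 2 * s n * norm y" if y: "\<And>k. k < n \<Longrightarrow> cinner y (e k) = 0" for n y
    proof -
      have "cinner (R y) (e k) = 0" if "k < n" for k
        using y[OF that] by (simp add: positive_operator_hermitian[OF DR(1)] DR(6) cinner_linear)
      then have "norm (R (R y)) \<le> sqrt (s n) * norm (R y)" by (rule eigensystem_tail_norm[OF R(1)])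
      also have "\<dots> \<le> sqrt (s n) * (sqrt (s n) * norm y)"
        using eigensystem_tail_norm[OF R(1) y] D(4)[of n] by (intro mult_left_mono) auto
      also have "\<dots> = s n * norm y" using D(4)[of n] by (simp add: mult.assoc[symmetric])
      finally have "norm (R (R y)) \<le> s n * norm y" .
      moreover have "norm (?T y) \<le> s n * norm y" by (rule eigensystem_tail_norm[OF E y])
      ultimately show ?thesis using norm_triangle_ineq4[of "R (R y)" "?T y"] by simp
    qed
  qed
  have abs: "operator_abs A = R" unfolding operator_abs_def
  proof (rule the_equality)
    show "positive_operator R \<and> R \<circ> R = ?T" using DR(1) RR by simp
    show "S = R" if "positive_operator S \<and> S \<circ> S = ?T" for S
      using square_root_unique[OF E, of S R] that DR(1) RR by simp
  qed
  have "singular_values A = (\<lambda>k. sqrt (s k))" by (rule singular_values_eqI) (use abs R in simp)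
  then show thesis using that R RR abs by simp
qed

lemma operator_abs_positive:
  fixes P :: "'h::complex_hilbert \<Rightarrow> 'h"
  assumes inf: "infinite_dimensional TYPE('h)" and P: "positive_operator P" "compact_operator P"
  shows "operator_abs P = P"
proof -
  obtain e where e: "eigensystem (operator_abs P) (singular_values P) e"
    "operator_abs P \<circ> operator_abs P = cadjoint P \<circ> P"
    using operator_abs_eigensystem[OF inf P(2)] by blast
  obtain s' e' where "eigensystem (cadjoint P \<circ> P) s' e'"
    using spectral_theorem[OF inf positive_adjoint_compose[OF positive_operator_bounded[OF P(1)]]
        compact_adjoint_compose[OF P(2)]] .
  from square_root_unique[OF this eigensystemD(1)[OF e(1)] e(2) P(1)]
  show ?thesis by (simp add: cadjoint_positive[OF P(1)])
qed

lemma positive_eigensystem: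
  fixes P :: "'h::complex_hilbert \<Rightarrow> 'h"
  assumes inf: "infinite_dimensional TYPE('h)" and P: "positive_operator P" "compact_operator P"
  obtains e where "eigensystem P (singular_values P) e"
  using operator_abs_eigensystem[OF inf P(2)] operator_abs_positive[OF assms] by metis

lemma singular_values_eigensystem:
  fixes P :: "'h::complex_hilbert \<Rightarrow> 'h"
  assumes "infinite_dimensional TYPE('h)" "compact_operator P" "eigensystem P s e"
  shows "singular_values P = s"
  using singular_values_eqI[of P s e] operator_abs_positive[OF assms(1) eigensystemD(1)[OF assms(3)] assms(2)]
    assms(3) by simp

section \<open>Sums of singular values\<close>

definition singular_sum :: "('h::complex_hilbert \<Rightarrow> 'h) \<Rightarrow> nat \<Rightarrow> real" where
  "singular_sum A n = (\<Sum>k<n. singular_values A k)"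

lemma singular_sum_abs:
  fixes A :: "'h::complex_hilbert \<Rightarrow> 'h"
  assumes "infinite_dimensional TYPE('h)" "compact_operator A"
  shows "singular_sum (operator_abs A) = singular_sum A"
proof -
  obtain e where "eigensystem (operator_abs A) (singular_values A) e" "compact_operator (operator_abs A)"
    using operator_abs_eigensystem[OF assms] by blast
  then show ?thesis using singular_values_eigensystem[OF assms(1)] by (simp add: singular_sum_def fun_eq_iff)
qed

lemma singular_values_nonneg:
  fixes A :: "'h::complex_hilbert \<Rightarrow> 'h"
  assumes "infinite_dimensional TYPE('h)" "compact_operator A"
  shows "0 \<le> singular_values A k"
  using operator_abs_eigensystem[OF assms] eigensystemD(4) by metis

lemma singular_sum_mono_index:
  fixes A :: "'h::complex_hilbert \<Rightarrow> 'h"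
  assumes "infinite_dimensional TYPE('h)" "compact_operator A" "m \<le> n"
  shows "singular_sum A m \<le> singular_sum A n"
  unfolding singular_sum_def using assms by (intro sum_mono2) (auto intro: singular_values_nonneg)

lemma singular_sum_nonneg:
  fixes A :: "'h::complex_hilbert \<Rightarrow> 'h"
  assumes "infinite_dimensional TYPE('h)" "compact_operator A"
  shows "0 \<le> singular_sum A n"
  unfolding singular_sum_def using assms by (intro sum_nonneg singular_values_nonneg)

text \<open>
  Splitting off the first \<open>n\<close> eigenvectors bounds the form at a unit vector \<open>g\<close> by
  \<open>s n + (\<Sum>k<n. (s k - s n) |\<langle>g, e k\<rangle>|\<^sup>2)\<close>. In the sum over the family, Bessel's inequality for the family
  bounds the total weight of each \<open>e k\<close> by 1, and the terms with \<open>s n\<close> cancel.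
\<close>

theorem ky_fan_upper:
  fixes P :: "'h::complex_hilbert \<Rightarrow> 'h"
  assumes inf: "infinite_dimensional TYPE('h)" and P: "positive_operator P" "compact_operator P"
    and I: "finite I" "orthonormal_on I g" "card I \<le> n"
  shows "(\<Sum>i\<in>I. Re (cinner (P (g i)) (g i))) \<le> singular_sum P n"
proof -
  obtain e where E: "eigensystem P (singular_values P) e" using positive_eigensystem[OF inf P] .
  define s where "s = singular_values P"
  note D = eigensystemD[OF E[folded s_def]]
  define c where "c i k = (cmod (cinner (g i) (e k)))\<^sup>2" for i k
  have one: "Re (cinner (P (g i)) (g i)) \<le> s n + (\<Sum>k<n. (s k - s n) * c i k)" if i: "i \<in> I" for i
  proof -
    have fin: "finite {..<n}" by simp
    let ?y = "residual {..<n} e (g i)"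
    have "Re (cinner (P ?y) ?y) \<le> s n * (norm ?y)\<^sup>2"
      by (rule D(7)) (simp add: residual_orthogonal[OF fin D(2)])
    also have "(norm ?y)\<^sup>2 = 1 - (\<Sum>k<n. c i k)"
      using pythagoras_residual[OF fin D(2), of "g i"] orthonormal_on_norm[OF I(2) i] by (simp add: c_def)
    finally have "Re (cinner (P ?y) ?y) \<le> s n * (1 - (\<Sum>k<n. c i k))" .
    moreover have "Re (cinner (P (g i)) (g i)) = (\<Sum>k<n. s k * c i k) + Re (cinner (P ?y) ?y)"
      unfolding c_def by (rule quadratic_form_eigenvectors[OF D(1) fin D(2)]) (rule D(6))
    ultimately show ?thesis
      by (simp add: left_diff_distrib sum_subtractf sum_distrib_left right_diff_distrib)
  qed
  have "(\<Sum>i\<in>I. Re (cinner (P (g i)) (g i))) \<le> (\<Sum>i\<in>I. s n + (\<Sum>k<n. (s k - s n) * c i k))"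
    by (intro sum_mono one)
  also have "\<dots> = card I * s n + (\<Sum>k<n. (s k - s n) * (\<Sum>i\<in>I. c i k))"
    by (simp add: sum.distrib sum_distrib_left sum.swap[of _ I])
  also have "\<dots> \<le> n * s n + (\<Sum>k<n. (s k - s n) * 1)"
  proof (intro add_mono sum_mono mult_left_mono)
    fix k assume "k \<in> {..<n}"
    then show "0 \<le> s k - s n" using antimonoD[OF D(3), of k n] by simp
    have "(\<Sum>i\<in>I. c i k) = (\<Sum>i\<in>I. (cmod (cinner (e k) (g i)))\<^sup>2)"
      by (simp add: c_def cmod_cinner_commute)
    also have "\<dots> \<le> (norm (e k))\<^sup>2" by (rule bessel[OF I(1,2)])
    finally show "(\<Sum>i\<in>I. c i k) \<le> 1" using orthonormal_on_norm[OF D(2), of k UNIV] by simp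
  qed (use I(3) D(4) in \<open>auto intro: mult_right_mono\<close>)
  also have "\<dots> = singular_sum P n" by (simp add: sum_subtractf singular_sum_def s_def)
  finally show ?thesis .
qed

lemma singular_sum_attained:
  fixes P :: "'h::complex_hilbert \<Rightarrow> 'h"
  assumes E: "eigensystem P (singular_values P) e"
  shows "(\<Sum>k<n. Re (cinner (P (e k)) (e k))) = singular_sum P n"
  by (simp add: singular_sum_def eigensystemD(6)[OF E] cinner_linear orthonormal_onD[OF eigensystemD(2)[OF E, of UNIV]])

lemma singular_sum_le_of_form_le:
  fixes P Q :: "'h::complex_hilbert \<Rightarrow> 'h"
  assumes inf: "infinite_dimensional TYPE('h)" and P: "positive_operator P" "compact_operator P"
    and Q: "positive_operator Q" "compact_operator Q"
    and le: "\<And>x. Re (cinner (P x) x) \<le> Re (cinner (Q x) x)"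
  shows "singular_sum P n \<le> singular_sum Q n"
proof -
  obtain e where E: "eigensystem P (singular_values P) e" using positive_eigensystem[OF inf P] .
  have "singular_sum P n \<le> (\<Sum>k<n. Re (cinner (Q (e k)) (e k)))"
    unfolding singular_sum_attained[OF E, symmetric] by (intro sum_mono le)
  also have "\<dots> \<le> singular_sum Q n"
    by (rule ky_fan_upper[OF inf Q]) (use eigensystemD(2)[OF E] in auto)
  finally show ?thesis .
qed

lemma singular_sum_add_le:
  fixes P Q :: "'h::complex_hilbert \<Rightarrow> 'h"
  assumes inf: "infinite_dimensional TYPE('h)" and P: "positive_operator P" "compact_operator P"
    and Q: "positive_operator Q" "compact_operator Q"
  shows "singular_sum (\<lambda>x. P x + Q x) n \<le> singular_sum P n + singular_sum Q n"
proof -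
  obtain e where E: "eigensystem (\<lambda>x. P x + Q x) (singular_values (\<lambda>x. P x + Q x)) e"
    using positive_eigensystem[OF inf positive_operator_add[OF P(1) Q(1)] compact_operator_add[OF P(2) Q(2)]] .
  have on: "orthonormal_on {..<n} e" using eigensystemD(2)[OF E] .
  have "singular_sum (\<lambda>x. P x + Q x) n = (\<Sum>k<n. Re (cinner (P (e k)) (e k))) + (\<Sum>k<n. Re (cinner (Q (e k)) (e k)))"
    unfolding singular_sum_attained[OF E, symmetric] by (simp add: cinner_linear sum.distrib)
  also have "\<dots> \<le> singular_sum P n + singular_sum Q n"
    by (intro add_mono ky_fan_upper inf P Q on) auto
  finally show ?thesis .
qed

text \<open>
  The trace of \<open>P + Q\<close> is tested on an orthonormal basis of the span of the first \<open>n\<close> eigenvectors of \<open>P\<close>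
  and of \<open>Q\<close>. This basis has at most \<open>2n\<close> elements, and by Parseval's identity the contribution of each
  of the two operators is at least the sum of its own first \<open>n\<close> eigenvalues.
\<close>

lemma singular_sum_add_ge:
  fixes P Q :: "'h::complex_hilbert \<Rightarrow> 'h"
  assumes inf: "infinite_dimensional TYPE('h)" and P: "positive_operator P" "compact_operator P"
    and Q: "positive_operator Q" "compact_operator Q"
  shows "singular_sum P n + singular_sum Q n \<le> singular_sum (\<lambda>x. P x + Q x) (2 * n)"
proof -
  obtain e where E: "eigensystem P (singular_values P) e" using positive_eigensystem[OF inf P] .
  obtain f where F: "eigensystem Q (singular_values Q) f" using positive_eigensystem[OF inf Q] .
  define S where "S = e ` {..<n} \<union> f ` {..<n}"
  have "card S \<le> card (e ` {..<n}) + card (f ` {..<n})" unfolding S_def by (rule card_Un_le)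
  also have "\<dots> \<le> n + n" by (intro add_mono card_image_le[THEN order_trans]) auto
  finally have cS: "card S \<le> 2 * n" by simp
  obtain G where G: "finite G" "card G \<le> card S" "orthonormal_on G (\<lambda>g. g)"
    "\<And>x. x \<in> S \<Longrightarrow> residual G (\<lambda>g. g) x = 0"
    using gram_schmidt[of S] by (auto simp: S_def)
  have tr: "singular_sum T n \<le> (\<Sum>g\<in>G. Re (cinner (T g) g))"
    if T: "eigensystem T (singular_values T) h" and h: "h ` {..<n} \<subseteq> S" for T h
  proof -
    note D = eigensystemD[OF T]
    have full: "(\<Sum>g\<in>G. (cmod (cinner g (h k)))\<^sup>2) = 1" if "k < n" for k
    proof -
      have "residual G (\<lambda>g. g) (h k) = 0" using that h by (intro G(4)) auto
      then have "(\<Sum>g\<in>G. (cmod (cinner (h k) g))\<^sup>2) = (norm (h k))\<^sup>2"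
        using pythagoras_residual[OF G(1,3), of "h k"] by simp
      then show ?thesis using orthonormal_on_norm[OF D(2), of k UNIV] by (simp add: cmod_cinner_commute)
    qed
    have "singular_sum T n = (\<Sum>k<n. singular_values T k * (\<Sum>g\<in>G. (cmod (cinner g (h k)))\<^sup>2))"
      by (simp add: singular_sum_def full)
    also have "\<dots> = (\<Sum>g\<in>G. \<Sum>k<n. singular_values T k * (cmod (cinner g (h k)))\<^sup>2)"
      by (simp add: sum_distrib_left sum.swap[of _ G])
    also have "\<dots> \<le> (\<Sum>g\<in>G. Re (cinner (T g) g))"
      by (intro sum_mono quadratic_form_ge_eigenvectors D) simp
    finally show ?thesis .
  qed
  have "singular_sum P n + singular_sum Q n \<le> (\<Sum>g\<in>G. Re (cinner (P g + Q g) g))"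
    using add_mono[OF tr[OF E] tr[OF F]] by (simp add: S_def cinner_linear sum.distrib)
  also have "\<dots> \<le> singular_sum (\<lambda>x. P x + Q x) (2 * n)"
    using ky_fan_upper[OF inf positive_operator_add[OF P(1) Q(1)] compact_operator_add[OF P(2) Q(2)] G(1,3)] G(2) cS
    by simp
  finally show ?thesis .
qed

lemma singular_sum_scale:
  fixes P :: "'h::complex_hilbert \<Rightarrow> 'h"
  assumes inf: "infinite_dimensional TYPE('h)" and P: "positive_operator P" "compact_operator P"
    and r: "0 \<le> r"
  shows "singular_sum (\<lambda>x. complex_of_real r *\<^sub>C P x) n = r * singular_sum P n"
proof -
  obtain e where E: "eigensystem P (singular_values P) e" using positive_eigensystem[OF inf P] .
  define s where "s = singular_values P"
  note D = eigensystemD[OF E[folded s_def]]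
  have "eigensystem (\<lambda>x. complex_of_real r *\<^sub>C P x) (\<lambda>k. r * s k) e"
    unfolding eigensystem_def
  proof (intro conjI allI impI positive_operator_scale P r)
    show "(\<lambda>k. r * s k) \<longlonglongrightarrow> 0" using tendsto_mult_left[OF D(5), of r] by simp
    fix n y assume "\<forall>k<n. cinner y (e k) = 0"
    then have "Re (cinner (P y) y) \<le> s n * (norm y)\<^sup>2" by (intro D(7)) simp
    then show "Re (cinner (complex_of_real r *\<^sub>C P y) y) \<le> r * s n * (norm y)\<^sup>2"
      using mult_left_mono[OF _ r] by (simp add: cinner_linear mult.assoc)
  qed (use D r in \<open>auto simp: scaleC_scaleC antimono_def intro: mult_left_mono\<close>)
  from singular_values_eigensystem[OF inf compact_operator_scaleC[OF P(2)] this]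
  show ?thesis by (simp add: singular_sum_def s_def sum_distrib_left)
qed

lemma unitary_operatorD:
  assumes "unitary_operator U"
  shows "U \<in> bounded_operators" "cadjoint U (U x) = x" "U (cadjoint U x) = x"
    "cinner (U x) (U y) = cinner x y"
proof -
  show U: "U \<in> bounded_operators" "U (cadjoint U x) = x" and U': "cadjoint U (U x) = x" for x
    using assms unfolding unitary_operator_def by (auto simp: fun_eq_iff)
  show "cinner (U x) (U y) = cinner x y" by (simp add: cinner_cadjoint[OF U(1)] U')
qed

lemma conjugation_positive:
  assumes U: "U \<in> bounded_operators" and P: "positive_operator P"
  shows "positive_operator (U \<circ> P \<circ> cadjoint U)"
  unfolding positive_operator_def
proof (intro conjI allI)
  show "U \<circ> P \<circ> cadjoint U \<in> bounded_operators"
    by (intro bounded_operators_compose cadjoint_bounded U positive_operator_bounded P)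
  show "0 \<le> cinner ((U \<circ> P \<circ> cadjoint U) x) x" for x
    using P by (simp add: positive_operator_def cinner_cadjoint[OF U])
qed

lemma conjugation_compact:
  assumes U: "U \<in> bounded_operators" and P: "compact_operator P"
  shows "compact_operator (U \<circ> P \<circ> cadjoint U)"
  by (intro compact_operator_compose_right compact_operator_compose_left cadjoint_bounded U P)

lemma singular_sum_unitary:
  fixes P :: "'h::complex_hilbert \<Rightarrow> 'h"
  assumes inf: "infinite_dimensional TYPE('h)" and P: "positive_operator P" "compact_operator P"
    and U: "unitary_operator U"
  shows "singular_sum (U \<circ> P \<circ> cadjoint U) n = singular_sum P n"
proof -
  obtain e where E: "eigensystem P (singular_values P) e" using positive_eigensystem[OF inf P] .
  define s where "s = singular_values P"
  note D = eigensystemD[OF E[folded s_def]]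
  note UD = unitary_operatorD[OF U]
  have "eigensystem (U \<circ> P \<circ> cadjoint U) s (U \<circ> e)"
    unfolding eigensystem_def
  proof (intro conjI allI impI conjugation_positive P UD(1))
    show "orthonormal_on UNIV (U \<circ> e)" using D(2)[of UNIV] by (simp add: orthonormal_on_def UD)
    show "(U \<circ> P \<circ> cadjoint U) ((U \<circ> e) k) = complex_of_real (s k) *\<^sub>C (U \<circ> e) k" for k
      by (simp add: UD D(6) bounded_operatorD(6)[OF UD(1)])
    fix n y assume "\<forall>k<n. cinner y ((U \<circ> e) k) = 0"
    then have "Re (cinner (P (cadjoint U y)) (cadjoint U y)) \<le> s n * (norm (cadjoint U y))\<^sup>2"
      by (intro D(7)) (simp add: cinner_cadjoint'[OF UD(1)])
    also have "(norm (cadjoint U y))\<^sup>2 = (norm y)\<^sup>2"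
      unfolding cinner_self_Re[symmetric] by (simp add: cinner_cadjoint'[OF UD(1)] UD)
    finally show "Re (cinner ((U \<circ> P \<circ> cadjoint U) y) y) \<le> s n * (norm y)\<^sup>2"
      by (simp add: cinner_cadjoint[OF UD(1)])
  qed (use D in auto)
  from singular_values_eigensystem[OF inf conjugation_compact[OF UD(1) P(2)] this]
  show ?thesis by (simp add: singular_sum_def s_def)
qed

section \<open>Adjoints and decomposition into positive operators\<close>

text \<open>
  From \<open>A\<^sup>*A e = s\<^sup>2 e\<close> follows \<open>AA\<^sup>*(A e) = s\<^sup>2 A e\<close>: the operator \<open>A\<close> transports eigenvectors of \<open>|A|\<close> to
  eigenvectors of \<open>|A\<^sup>*|\<close> with the same eigenvalue.
\<close>

lemma adjoint_eigenvectors: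
  fixes A :: "'h::complex_hilbert \<Rightarrow> 'h"
  assumes inf: "infinite_dimensional TYPE('h)" and A: "compact_operator A"
    and E: "eigensystem (operator_abs A) s e"
    and I: "\<And>k. k \<in> I \<Longrightarrow> 0 < s k"
  defines "f \<equiv> \<lambda>k. complex_of_real (1 / s k) *\<^sub>C A (e k)"
  shows "orthonormal_on I f"
    and "\<And>k. k \<in> I \<Longrightarrow> operator_abs (cadjoint A) (f k) = complex_of_real (s k) *\<^sub>C f k"
proof -
  note D = eigensystemD[OF E]
  have bA: "A \<in> bounded_operators" by (rule compact_operator_bounded[OF A])
  note L = bounded_operatorD[OF bA]
  note L' = bounded_operatorD[OF cadjoint_bounded[OF bA]]
  obtain e1 where "operator_abs A \<circ> operator_abs A = cadjoint A \<circ> A"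
    using operator_abs_eigensystem[OF inf A] by blast
  then have "(operator_abs A \<circ> operator_abs A) (e k) = (cadjoint A \<circ> A) (e k)" for k by (rule fun_cong)
  then have AA: "cadjoint A (A (e k)) = complex_of_real (s k * s k) *\<^sub>C e k" for k
    by (simp add: D(6) scaleC_scaleC bounded_operatorD(6)[OF positive_operator_bounded[OF D(1)]])
  show "orthonormal_on I f"
    unfolding orthonormal_on_def
  proof (intro ballI)
    fix i j assume ij: "i \<in> I" "j \<in> I"
    have "cinner (A (e i)) (A (e j)) = complex_of_real (s j * s j) * cinner (e i) (e j)"
      unfolding cinner_cadjoint[OF bA, of "e i"] AA by (simp add: cinner_linear)
    then show "cinner (f i) (f j) = (if i = j then 1 else 0)"
      using I[OF ij(1)] I[OF ij(2)] by (simp add: f_def cinner_linear orthonormal_onD[OF D(2)[of UNIV]])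
  qed
  fix k assume k: "k \<in> I"
  obtain e2 where B: "eigensystem (operator_abs (cadjoint A)) (singular_values (cadjoint A)) e2"
    "operator_abs (cadjoint A) \<circ> operator_abs (cadjoint A) = cadjoint (cadjoint A) \<circ> cadjoint A"
    using operator_abs_eigensystem[OF inf compact_operator_cadjoint[OF A]] by blast
  have "operator_abs (cadjoint A) (operator_abs (cadjoint A) (f k)) = A (cadjoint A (f k))"
    using fun_cong[OF B(2), of "f k"] by (simp add: cadjoint_cadjoint[OF bA])
  also have "\<dots> = complex_of_real (s k * s k) *\<^sub>C f k"
    by (simp add: f_def L L' AA scaleC_scaleC mult_ac)
  finally show "operator_abs (cadjoint A) (f k) = complex_of_real (s k) *\<^sub>C f k"
    using I[OF k] by (intro positive_root_eigenvector[OF eigensystemD(1)[OF B(1)]]) auto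
qed

lemma operator_abs_norm:
  fixes A :: "'h::complex_hilbert \<Rightarrow> 'h"
  assumes inf: "infinite_dimensional TYPE('h)" and A: "compact_operator A"
  shows "norm (operator_abs A x) = norm (A x)"
proof -
  obtain e where E: "eigensystem (operator_abs A) (singular_values A) e"
    and sq: "operator_abs A \<circ> operator_abs A = cadjoint A \<circ> A"
    using operator_abs_eigensystem[OF inf A] by blast
  have "cinner (operator_abs A x) (operator_abs A x) = cinner (cadjoint A (A x)) x"
    using fun_cong[OF sq, of x] by (simp add: positive_operator_hermitian[OF eigensystemD(1)[OF E], symmetric])
  then have "cinner (operator_abs A x) (operator_abs A x) = cinner (A x) (A x)"
    by (simp add: cinner_cadjoint'[OF compact_operator_bounded[OF A]])
  then have "(norm (operator_abs A x))\<^sup>2 = (norm (A x))\<^sup>2" by (metis cinner_self_Re)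
  then show ?thesis by (simp add: power2_eq_iff_nonneg)
qed

text \<open>
  \<open>A\<^sup>*\<close> transports the eigenvectors of \<open>|A\<^sup>*|\<close> with positive eigenvalues to an orthonormal family on which
  \<open>|A|\<close> can be tested.
\<close>

lemma singular_sum_cadjoint_le:
  fixes A :: "'h::complex_hilbert \<Rightarrow> 'h"
  assumes inf: "infinite_dimensional TYPE('h)" and A: "compact_operator A"
  shows "singular_sum (cadjoint A) n \<le> singular_sum A n"
proof -
  let ?B = "cadjoint A"
  have B: "compact_operator ?B" by (rule compact_operator_cadjoint[OF A])
  obtain e where E: "eigensystem (operator_abs ?B) (singular_values ?B) e"
    using operator_abs_eigensystem[OF inf B] by blast
  obtain e' where E': "eigensystem (operator_abs A) (singular_values A) e'" "compact_operator (operator_abs A)"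
    using operator_abs_eigensystem[OF inf A] by blast
  define s where "s = singular_values ?B"
  define I where "I = {k. k < n \<and> 0 < s k}"
  define f where "f k = complex_of_real (1 / s k) *\<^sub>C ?B (e k)" for k
  have f: "orthonormal_on I f" "\<And>k. k \<in> I \<Longrightarrow> operator_abs A (f k) = complex_of_real (s k) *\<^sub>C f k"
    using adjoint_eigenvectors[OF inf B E[folded s_def], of I]
    unfolding f_def cadjoint_cadjoint[OF compact_operator_bounded[OF A]] by (auto simp: I_def)
  have I: "finite I" by (simp add: I_def)
  have "card I \<le> card {..<n}" by (rule card_mono) (auto simp: I_def)
  then have cI: "card I \<le> n" by simp
  have "singular_sum ?B n = (\<Sum>k\<in>I. s k)"
    unfolding singular_sum_def s_def[symmetric]
    using eigensystemD(4)[OF E[folded s_def]]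
    by (intro sum.mono_neutral_right) (auto simp: I_def not_less intro: antisym)
  also have "\<dots> = (\<Sum>k\<in>I. Re (cinner (operator_abs A (f k)) (f k)))"
    by (intro sum.cong refl) (simp add: f(2) cinner_linear orthonormal_onD[OF f(1)])
  also have "\<dots> \<le> singular_sum (operator_abs A) n"
    by (rule ky_fan_upper[OF inf eigensystemD(1)[OF E'(1)] E'(2) I f(1) cI])
  finally show ?thesis by (simp add: singular_sum_abs[OF inf A])
qed

text \<open>
  In the expansion \<open>\<langle>A x, x\<rangle> = (\<Sum>k. s k \<langle>x, e k\<rangle> \<langle>f k, x\<rangle>)\<close>, where \<open>e k\<close> and \<open>f k\<close> are eigenvectors of \<open>|A|\<close>
  and \<open>|A\<^sup>*|\<close> for \<open>s k\<close>, each term is at most \<open>s k (|\<langle>x, e k\<rangle>|\<^sup>2 + |\<langle>x, f k\<rangle>|\<^sup>2) / 2\<close> in absolute value.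
  The expansion is truncated at \<open>n\<close>, at the cost of an error of at most \<open>s n \<parallel>x\<parallel>\<^sup>2\<close>.
\<close>

theorem mixed_schwarz:
  fixes A :: "'h::complex_hilbert \<Rightarrow> 'h"
  assumes inf: "infinite_dimensional TYPE('h)" and A: "compact_operator A"
  shows "2 * cmod (cinner (A x) x) \<le>
    Re (cinner (operator_abs A x) x) + Re (cinner (operator_abs (cadjoint A) x) x)" (is "_ \<le> ?a + ?b")
proof -
  have bA: "A \<in> bounded_operators" by (rule compact_operator_bounded[OF A])
  note L = bounded_operatorD[OF bA]
  obtain e where E: "eigensystem (operator_abs A) (singular_values A) e"
    using operator_abs_eigensystem[OF inf A] by blast
  obtain e' where E': "eigensystem (operator_abs (cadjoint A)) (singular_values (cadjoint A)) e'"
    using operator_abs_eigensystem[OF inf compact_operator_cadjoint[OF A]] by blast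
  define s where "s = singular_values A"
  note D = eigensystemD[OF E[folded s_def]]
  have approx: "2 * cmod (cinner (A x) x) \<le> ?a + ?b + 2 * (s n * (norm x)\<^sup>2)" for n
  proof -
    define I where "I = {k. k < n \<and> 0 < s k}"
    define f where "f k = complex_of_real (1 / s k) *\<^sub>C A (e k)" for k
    have f: "orthonormal_on I f" "\<And>k. k \<in> I \<Longrightarrow> operator_abs (cadjoint A) (f k) = complex_of_real (s k) *\<^sub>C f k"
      using adjoint_eigenvectors[OF inf A E[folded s_def], of I] unfolding f_def by (auto simp: I_def)
    have I: "finite I" by (simp add: I_def)
    let ?y = "residual {..<n} e x"
    have fin: "finite {..<n}" by simp
    have Ae: "A (e k) = complex_of_real (s k) *\<^sub>C f k" if "k \<in> I" for k
      using that by (simp add: f_def I_def scaleC_scaleC)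
    have Ae0: "A (e k) = 0" if "k < n" "k \<notin> I" for k
    proof -
      have "s k = 0" using that D(4)[of k] by (simp add: I_def)
      then show ?thesis using operator_abs_norm[OF inf A, of "e k"] by (simp add: D(6))
    qed
    have "A x = (\<Sum>k<n. cinner x (e k) *\<^sub>C A (e k)) + A ?y"
      by (simp add: residual_def L)
    also have "(\<Sum>k<n. cinner x (e k) *\<^sub>C A (e k)) = (\<Sum>k\<in>I. cinner x (e k) *\<^sub>C A (e k))"
      by (intro sum.mono_neutral_right) (auto simp: Ae0 I_def intro!: Ae0)
    finally have "cinner (A x) x = (\<Sum>k\<in>I. cinner x (e k) * (complex_of_real (s k) * cinner (f k) x)) + cinner (A ?y) x"
      by (simp add: cinner_linear cinner_sum_left Ae mult.assoc)
    then have "cmod (cinner (A x) x) \<le>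
        (\<Sum>k\<in>I. cmod (cinner x (e k) * (complex_of_real (s k) * cinner (f k) x))) + cmod (cinner (A ?y) x)"
      using norm_triangle_le[OF add_right_mono[OF norm_sum]] by simp
    moreover have "cmod (cinner (A ?y) x) \<le> s n * (norm x)\<^sup>2"
    proof -
      have "norm (A ?y) \<le> s n * norm ?y"
        unfolding operator_abs_norm[OF inf A, symmetric]
        by (rule eigensystem_tail_norm[OF E[folded s_def]]) (simp add: residual_orthogonal[OF fin D(2)])
      also have "\<dots> \<le> s n * norm x" by (intro mult_left_mono norm_residual_le D) auto
      finally have "norm (A ?y) * norm x \<le> s n * norm x * norm x" by (rule mult_right_mono) simp
      then show ?thesis using cinner_cauchy_schwarz[of "A ?y" x] by (simp add: power2_eq_square)
    qed
    moreover have "2 * (\<Sum>k\<in>I. cmod (cinner x (e k) * (complex_of_real (s k) * cinner (f k) x))) \<le> ?a + ?b"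
    proof -
      have "2 * cmod (cinner x (e k) * (complex_of_real (s k) * cinner (f k) x)) \<le>
          s k * (cmod (cinner x (e k)))\<^sup>2 + s k * (cmod (cinner x (f k)))\<^sup>2" for k
      proof -
        have "2 * cmod (cinner x (e k)) * cmod (cinner x (f k)) \<le>
            (cmod (cinner x (e k)))\<^sup>2 + (cmod (cinner x (f k)))\<^sup>2" by (rule sum_squares_bound)
        from mult_left_mono[OF this D(4)[of k]] show ?thesis
          by (simp add: norm_mult D(4) cmod_cinner_commute[of "f k"] algebra_simps)
      qed
      then have "2 * (\<Sum>k\<in>I. cmod (cinner x (e k) * (complex_of_real (s k) * cinner (f k) x))) \<le>
          (\<Sum>k\<in>I. s k * (cmod (cinner x (e k)))\<^sup>2) + (\<Sum>k\<in>I. s k * (cmod (cinner x (f k)))\<^sup>2)"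
        unfolding sum_distrib_left sum.distrib[symmetric] by (intro sum_mono)
      moreover have "(\<Sum>k\<in>I. s k * (cmod (cinner x (e k)))\<^sup>2) \<le> ?a"
        by (rule quadratic_form_ge_eigenvectors[OF D(1) I D(2)]) (rule D(6))
      moreover have "(\<Sum>k\<in>I. s k * (cmod (cinner x (f k)))\<^sup>2) \<le> ?b"
        by (rule quadratic_form_ge_eigenvectors[OF eigensystemD(1)[OF E'] I f])
      ultimately show ?thesis by linarith
    qed
    ultimately show ?thesis by linarith
  qed
  have "(\<lambda>n. ?a + ?b + 2 * (s n * (norm x)\<^sup>2)) \<longlonglongrightarrow> ?a + ?b + 2 * (0 * (norm x)\<^sup>2)"
    by (intro tendsto_intros D(5))
  then show ?thesis by (intro LIMSEQ_le_const[of _ "?a + ?b"]) (use approx in auto)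
qed

text \<open>
  Polarisation with \<open>Q c = (|A| + |A\<^sup>*| + cnj c A + c A\<^sup>*) / 4\<close>. By the mixed Schwarz inequality \<open>Q c\<close> lies
  between 0 and \<open>(|A| + |A\<^sup>*|) / 2\<close> in the operator order, and this controls its singular values.
\<close>

theorem positive_decomposition:
  fixes A :: "'h::complex_hilbert \<Rightarrow> 'h"
  assumes inf: "infinite_dimensional TYPE('h)" and A: "compact_operator A"
  obtains Q :: "complex \<Rightarrow> 'h \<Rightarrow> 'h"
  where "\<And>c. cmod c = 1 \<Longrightarrow> positive_operator (Q c)" "\<And>c. compact_operator (Q c)"
    "\<And>c n. cmod c = 1 \<Longrightarrow> singular_sum (Q c) n \<le> singular_sum A n"
    "\<And>x. A x = Q 1 x - Q (-1) x + \<i> *\<^sub>C (Q \<i> x - Q (-\<i>) x)"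
proof -
  have bA: "A \<in> bounded_operators" by (rule compact_operator_bounded[OF A])
  let ?R = "operator_abs A" and ?S = "operator_abs (cadjoint A)"
  obtain e where R: "eigensystem ?R (singular_values A) e" "compact_operator ?R"
    using operator_abs_eigensystem[OF inf A] by blast
  obtain e' where S: "eigensystem ?S (singular_values (cadjoint A)) e'" "compact_operator ?S"
    using operator_abs_eigensystem[OF inf compact_operator_cadjoint[OF A]] by blast
  note pR = eigensystemD(1)[OF R(1)] and pS = eigensystemD(1)[OF S(1)]
  define Q where "Q c x = complex_of_real (1/4) *\<^sub>C
    ((?R x + ?S x) + (cnj c *\<^sub>C A x + c *\<^sub>C cadjoint A x))" for c x
  have cpt: "compact_operator (Q c)" for c
    unfolding Q_def by (intro compact_operator_scaleC compact_operator_add R S A compact_operator_cadjoint)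
  have form: "cinner (Q c x) x = complex_of_real (1/4 *
      (Re (cinner (?R x) x) + Re (cinner (?S x) x) + 2 * Re (cnj c * cinner (A x) x)))" for c x
  proof -
    have "cinner (cadjoint A x) x = cnj (cinner (A x) x)"
      using cinner_commute[of x "A x"] by (simp add: cinner_cadjoint'[OF bA])
    then show ?thesis
      using positive_operator_Im[OF pR, of x] positive_operator_Im[OF pS, of x]
      by (simp add: Q_def cinner_linear complex_eq_iff field_simps)
  qed
  have bound: "\<bar>2 * Re (cnj c * cinner (A x) x)\<bar> \<le> Re (cinner (?R x) x) + Re (cinner (?S x) x)"
    if "cmod c = 1" for c x
    using mixed_schwarz[OF inf A, of x] abs_Re_le_cmod[of "cnj c * cinner (A x) x"] that
    by (simp add: norm_mult)
  have quarter: "0 \<le> 1/4 * (a + b + 2 * t)" "1/4 * (a + b + 2 * t) \<le> 1/2 * (a + b)"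
    if "\<bar>2 * t\<bar> \<le> a + b" for a b t :: real
    using that by (auto simp: abs_le_iff)
  have pos: "positive_operator (Q c)" if "cmod c = 1" for c
  proof (rule positive_operatorI[OF compact_operator_bounded[OF cpt]])
    show "0 \<le> Re (cinner (Q c x) x)" for x
      unfolding form Re_complex_of_real by (rule quarter(1)[OF bound[OF that]])
    show "Im (cinner (Q c x) x) = 0" for x unfolding form by simp
  qed
  have le: "singular_sum (Q c) n \<le> singular_sum A n" if "cmod c = 1" for c n
  proof -
    let ?T = "\<lambda>x. complex_of_real (1/2) *\<^sub>C (?R x + ?S x)"
    have "singular_sum (Q c) n \<le> singular_sum ?T n"
    proof (rule singular_sum_le_of_form_le[OF inf pos[OF that] cpt])
      show "positive_operator ?T" by (intro positive_operator_scale positive_operator_add pR pS) simp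
      show "compact_operator ?T" by (intro compact_operator_scaleC compact_operator_add R S)
      show "Re (cinner (Q c x) x) \<le> Re (cinner (?T x) x)" for x
      proof -
        have "Re (cinner (?T x) x) = 1/2 * (Re (cinner (?R x) x) + Re (cinner (?S x) x))"
          by (simp add: cinner_linear field_simps)
        with quarter(2)[OF bound[OF that, of x]] show ?thesis unfolding form Re_complex_of_real by (simp only:)
      qed
    qed
    also have "\<dots> = 1/2 * singular_sum (\<lambda>x. ?R x + ?S x) n"
      by (intro singular_sum_scale inf positive_operator_add compact_operator_add pR pS R S) simp
    also have "\<dots> \<le> 1/2 * (singular_sum ?R n + singular_sum ?S n)"
      by (intro mult_left_mono singular_sum_add_le inf pR pS R S) simp
    also have "\<dots> \<le> singular_sum A n"
      using singular_sum_cadjoint_le[OF inf A, of n]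
      by (simp add: singular_sum_abs[OF inf A] singular_sum_abs[OF inf compact_operator_cadjoint[OF A]])
    finally show ?thesis .
  qed
  have "A x = Q 1 x - Q (-1) x + \<i> *\<^sub>C (Q \<i> x - Q (-\<i>) x)" for x
  proof (rule cinner_eqI)
    show "cinner (A x) z = cinner (Q 1 x - Q (-1) x + \<i> *\<^sub>C (Q \<i> x - Q (-\<i>) x)) z" for z
      by (simp add: Q_def cinner_linear complex_eq_iff field_simps)
  qed
  with pos cpt le show thesis by (rule that)
qed

section \<open>Extending additive functionals from the positive cone\<close>

text \<open>
  The difference of the two forms vanishes on the diagonal; hence it is semidefinite, and the
  Cauchy--Schwarz inequality makes it vanish everywhere.
\<close>

lemma positive_operator_eqI:
  assumes P: "positive_operator P" and Q: "positive_operator Q"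
    and eq: "\<And>x. Re (cinner (P x) x) = Re (cinner (Q x) x)"
  shows "P = Q"
proof
  fix x
  note LP = bounded_operatorD[OF positive_operator_bounded[OF P]]
  note LQ = bounded_operatorD[OF positive_operator_bounded[OF Q]]
  define B where "B x y = cinner (P x) y - cinner (Q x) y" for x y
  have herm: "B y x = cnj (B x y)" for x y
    unfolding B_def positive_operator_hermitian[OF P, of y] positive_operator_hermitian[OF Q, of y]
    using cinner_commute[of y "P x"] cinner_commute[of y "Q x"] by simp
  have "(cmod (B x y))\<^sup>2 \<le> Re (B x x) * Re (B y y)" for y
    by (rule hermitian_cauchy_schwarz[of B, OF _ _ herm])
      (auto simp: B_def LP LQ cinner_linear algebra_simps eq)
  then have "B x y = 0" for y by (simp add: B_def eq)
  then show "P x = Q x" by (intro cinner_eqI) (simp add: B_def)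
qed

text \<open>
  Linearity forces the value at \<open>P0 - P2 + \<i>(P1 - P3)\<close>. If two such combinations represent the same
  operator, their real and imaginary parts agree, and sorting the terms of equal sign into identities
  between positive operators shows that additivity on the cone gives them the same value. Linearity,
  positivity and invariance can then be read off from suitable representations.
\<close>

theorem trace_extension:
  fixes M :: "('h::complex_hilbert \<Rightarrow> 'h) set" and f :: "('h \<Rightarrow> 'h) \<Rightarrow> real"
  defines "C \<equiv> {P \<in> M. positive_operator P}"
  assumes add: "\<And>P Q. P \<in> C \<Longrightarrow> Q \<in> C \<Longrightarrow> (\<lambda>x. P x + Q x) \<in> C \<and> f (\<lambda>x. P x + Q x) = f P + f Q"
    and scale: "\<And>r P. 0 \<le> r \<Longrightarrow> P \<in> C \<Longrightarrow>
      (\<lambda>x. complex_of_real r *\<^sub>C P x) \<in> C \<and> f (\<lambda>x. complex_of_real r *\<^sub>C P x) = r * f P"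
    and nonneg: "\<And>P. P \<in> C \<Longrightarrow> 0 \<le> f P"
    and unitary: "\<And>U P. unitary_operator U \<Longrightarrow> P \<in> C \<Longrightarrow>
      U \<circ> P \<circ> cadjoint U \<in> C \<and> f (U \<circ> P \<circ> cadjoint U) = f P"
    and span: "\<And>A. A \<in> M \<Longrightarrow> \<exists>P0\<in>C. \<exists>P1\<in>C. \<exists>P2\<in>C. \<exists>P3\<in>C.
      \<forall>x. A x = P0 x - P2 x + \<i> *\<^sub>C (P1 x - P3 x)"
  shows "\<exists>\<phi>. trace_on M \<phi> \<and> (\<forall>P\<in>C. \<phi> P = complex_of_real (f P))"
proof -
  define rep where "rep A z \<longleftrightarrow> (\<exists>P0\<in>C. \<exists>P1\<in>C. \<exists>P2\<in>C. \<exists>P3\<in>C.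
    (\<forall>x. A x = P0 x - P2 x + \<i> *\<^sub>C (P1 x - P3 x)) \<and>
    z = complex_of_real (f P0 - f P2) + \<i> * complex_of_real (f P1 - f P3))" for A z
  have C: "positive_operator P" if "P \<in> C" for P using that by (simp add: C_def)
  have ex: "\<exists>z. rep A z" if "A \<in> M" for A using span[OF that] unfolding rep_def by blast
  have swap: "f P + f Q' = f Q + f P'"
    if in_C: "P \<in> C" "Q \<in> C" "P' \<in> C" "Q' \<in> C"
      and eq: "\<And>x. Re (cinner (P x) x) - Re (cinner (Q x) x) = Re (cinner (P' x) x) - Re (cinner (Q' x) x)"
    for P Q P' Q'
  proof -
    have "(\<lambda>x. P x + Q' x) = (\<lambda>x. Q x + P' x)"
    proof (rule positive_operator_eqI)
      show "Re (cinner (P x + Q' x) x) = Re (cinner (Q x + P' x) x)" for x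
        using eq[of x] by (simp add: cinner_linear)
    qed (intro positive_operator_add C in_C)+
    then show ?thesis using add[OF in_C(1,4)] add[OF in_C(2,3)] by simp
  qed
  have unique: "z = w" if z: "rep A z" and w: "rep A w" for A z w
  proof -
    obtain P0 P1 P2 P3 where P: "P0 \<in> C" "P1 \<in> C" "P2 \<in> C" "P3 \<in> C"
      "\<And>x. A x = P0 x - P2 x + \<i> *\<^sub>C (P1 x - P3 x)"
      "z = complex_of_real (f P0 - f P2) + \<i> * complex_of_real (f P1 - f P3)"
      using z unfolding rep_def by blast
    obtain Q0 Q1 Q2 Q3 where Q: "Q0 \<in> C" "Q1 \<in> C" "Q2 \<in> C" "Q3 \<in> C"
      "\<And>x. A x = Q0 x - Q2 x + \<i> *\<^sub>C (Q1 x - Q3 x)"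
      "w = complex_of_real (f Q0 - f Q2) + \<i> * complex_of_real (f Q1 - f Q3)"
      using w unfolding rep_def by blast
    note im = positive_operator_Im[OF C[OF P(1)]] positive_operator_Im[OF C[OF P(2)]]
      positive_operator_Im[OF C[OF P(3)]] positive_operator_Im[OF C[OF P(4)]]
      positive_operator_Im[OF C[OF Q(1)]] positive_operator_Im[OF C[OF Q(2)]]
      positive_operator_Im[OF C[OF Q(3)]] positive_operator_Im[OF C[OF Q(4)]]
    have same: "cinner (P0 x - P2 x + \<i> *\<^sub>C (P1 x - P3 x)) x = cinner (Q0 x - Q2 x + \<i> *\<^sub>C (Q1 x - Q3 x)) x" for x
      using P(5) Q(5) by simp
    have "f P0 + f Q2 = f P2 + f Q0"
      by (rule swap[OF P(1,3) Q(1,3)]) (use arg_cong[OF same, of Re] in \<open>simp add: cinner_linear im\<close>)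
    moreover have "f P1 + f Q3 = f P3 + f Q1"
      by (rule swap[OF P(2,4) Q(2,4)]) (use arg_cong[OF same, of Im] in \<open>simp add: cinner_linear im\<close>)
    ultimately show ?thesis by (simp add: P(6) Q(6) complex_eq_iff)
  qed
  define \<phi> where "\<phi> A = (THE z. rep A z)" for A
  have \<phi>I: "\<phi> A = z" if "rep A z" for A z
    unfolding \<phi>_def using that unique by blast
  have rep\<phi>: "rep A (\<phi> A)" if "A \<in> M" for A using ex[OF that] \<phi>I by blast
  have rep_add: "rep (\<lambda>x. A x + B x) (z + w)" if z: "rep A z" and w: "rep B w" for A B z w
  proof -
    obtain P0 P1 P2 P3 where P: "P0 \<in> C" "P1 \<in> C" "P2 \<in> C" "P3 \<in> C"
      "\<And>x. A x = P0 x - P2 x + \<i> *\<^sub>C (P1 x - P3 x)"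
      "z = complex_of_real (f P0 - f P2) + \<i> * complex_of_real (f P1 - f P3)"
      using z unfolding rep_def by blast
    obtain Q0 Q1 Q2 Q3 where Q: "Q0 \<in> C" "Q1 \<in> C" "Q2 \<in> C" "Q3 \<in> C"
      "\<And>x. B x = Q0 x - Q2 x + \<i> *\<^sub>C (Q1 x - Q3 x)"
      "w = complex_of_real (f Q0 - f Q2) + \<i> * complex_of_real (f Q1 - f Q3)"
      using w unfolding rep_def by blast
    note s = add[OF P(1) Q(1)] add[OF P(2) Q(2)] add[OF P(3) Q(3)] add[OF P(4) Q(4)]
    show ?thesis unfolding rep_def
      by (intro bexI[of _ "\<lambda>x. P0 x + Q0 x"] bexI[of _ "\<lambda>x. P1 x + Q1 x"]
          bexI[of _ "\<lambda>x. P2 x + Q2 x"] bexI[of _ "\<lambda>x. P3 x + Q3 x"] conjI allI)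
        (simp_all add: s P(5,6) Q(5,6) algebra_simps scaleC_add_right complex_vector.scale_right_diff_distrib)
  qed
  have rep_scale: "rep (\<lambda>x. complex_of_real r *\<^sub>C A x) (complex_of_real r * z)"
    if r: "0 \<le> r" and z: "rep A z" for r A z
  proof -
    obtain P0 P1 P2 P3 where P: "P0 \<in> C" "P1 \<in> C" "P2 \<in> C" "P3 \<in> C"
      "\<And>x. A x = P0 x - P2 x + \<i> *\<^sub>C (P1 x - P3 x)"
      "z = complex_of_real (f P0 - f P2) + \<i> * complex_of_real (f P1 - f P3)"
      using z unfolding rep_def by blast
    note s = scale[OF r P(1)] scale[OF r P(2)] scale[OF r P(3)] scale[OF r P(4)]
    show ?thesis unfolding rep_def
      by (intro bexI[of _ "\<lambda>x. complex_of_real r *\<^sub>C P0 x"] bexI[of _ "\<lambda>x. complex_of_real r *\<^sub>C P1 x"]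
          bexI[of _ "\<lambda>x. complex_of_real r *\<^sub>C P2 x"] bexI[of _ "\<lambda>x. complex_of_real r *\<^sub>C P3 x"] conjI allI)
        (simp_all add: s P(5,6) scaleC_add_right complex_vector.scale_right_diff_distrib
          scaleC_scaleC algebra_simps)
  qed
  have rep_i: "rep (\<lambda>x. \<i> *\<^sub>C A x) (\<i> * z)" if z: "rep A z" for A z
  proof -
    obtain P0 P1 P2 P3 where P: "P0 \<in> C" "P1 \<in> C" "P2 \<in> C" "P3 \<in> C"
      "\<And>x. A x = P0 x - P2 x + \<i> *\<^sub>C (P1 x - P3 x)"
      "z = complex_of_real (f P0 - f P2) + \<i> * complex_of_real (f P1 - f P3)"
      using z unfolding rep_def by blast
    show ?thesis unfolding rep_def
      by (intro bexI[of _ P3] bexI[of _ P0] bexI[of _ P1] bexI[of _ P2] conjI allI P(1-4))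
        (simp_all add: P(5,6) scaleC_add_right scaleC_scaleC scaleC_minus1 complex_eq_iff)
  qed
  have rep_scaleC: "rep (\<lambda>x. c *\<^sub>C A x) (c * z)" if z: "rep A z" for c A z
  proof -
    have real: "rep (\<lambda>x. complex_of_real r *\<^sub>C A x) (complex_of_real r * z)" if z: "rep A z" for r A z
    proof (cases "0 \<le> r")
      case True then show ?thesis using rep_scale z by blast
    next
      case False
      then have "0 \<le> - r" by simp
      from rep_i[OF rep_i[OF rep_scale[OF this z]]] show ?thesis
        by (simp add: scaleC_scaleC mult.assoc[symmetric])
    qed
    have "c *\<^sub>C x = complex_of_real (Re c) *\<^sub>C x + complex_of_real (Im c) *\<^sub>C \<i> *\<^sub>C x" for x :: 'h
      by (metis complex_eq mult.commute scaleC_add_left scaleC_scaleC)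
    moreover have "c * z = complex_of_real (Re c) * z + complex_of_real (Im c) * (\<i> * z)"
      by (simp add: complex_eq_iff)
    ultimately show ?thesis using rep_add[OF real[OF z, of "Re c"] real[OF rep_i[OF z], of "Im c"]] by simp
  qed
  have rep_unitary: "rep (U \<circ> A \<circ> cadjoint U) z" if U: "unitary_operator U" and z: "rep A z" for U A z
  proof -
    obtain P0 P1 P2 P3 where P: "P0 \<in> C" "P1 \<in> C" "P2 \<in> C" "P3 \<in> C"
      "\<And>x. A x = P0 x - P2 x + \<i> *\<^sub>C (P1 x - P3 x)"
      "z = complex_of_real (f P0 - f P2) + \<i> * complex_of_real (f P1 - f P3)"
      using z unfolding rep_def by blast
    note s = unitary[OF U P(1)] unitary[OF U P(2)] unitary[OF U P(3)] unitary[OF U P(4)]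
    show ?thesis unfolding rep_def
      by (intro bexI[of _ "U \<circ> P0 \<circ> cadjoint U"] bexI[of _ "U \<circ> P1 \<circ> cadjoint U"]
          bexI[of _ "U \<circ> P2 \<circ> cadjoint U"] bexI[of _ "U \<circ> P3 \<circ> cadjoint U"] conjI allI)
        (simp_all add: s P(5,6) bounded_operatorD[OF unitary_operatorD(1)[OF U]])
  qed
  have rep_pos: "rep P (complex_of_real (f P))" if P: "P \<in> C" for P
  proof -
    have z: "(\<lambda>x. 0) \<in> C" "f (\<lambda>x. 0) = 0" using scale[of 0, OF _ P] by (simp_all add: complex_vector.scale_zero_left)
    show ?thesis unfolding rep_def
      by (intro bexI[of _ P] bexI[of _ "\<lambda>x. 0"] conjI allI P z) (simp_all add: z complex_vector.scale_zero_right)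
  qed
  have "trace_on M \<phi>" unfolding trace_on_def
  proof (intro conjI ballI allI impI)
    show "\<phi> (\<lambda>x. A x + B x) = \<phi> A + \<phi> B" if "A \<in> M" "B \<in> M" for A B
      using that by (intro \<phi>I rep_add rep\<phi>)
    show "\<phi> (\<lambda>x. c *\<^sub>C A x) = c * \<phi> A" if "A \<in> M" for c A
      using that by (intro \<phi>I rep_scaleC rep\<phi>)
    show "\<phi> (U \<circ> A \<circ> cadjoint U) = \<phi> A" if "A \<in> M" "unitary_operator U" for U A
      using that by (intro \<phi>I rep_unitary rep\<phi>)
    show "0 \<le> \<phi> A" if "A \<in> M" "positive_operator A" for A
    proof -
      have "A \<in> C" using that by (simp add: C_def)
      then show ?thesis using \<phi>I[OF rep_pos] nonneg by (simp add: less_eq_complex_def)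
    qed
  qed
  then show ?thesis using \<phi>I[OF rep_pos] by blast
qed

section \<open>Simultaneous cluster points\<close>

text \<open>
  By Tychonoff's theorem the functions bounded by \<open>B\<close> form a compact set, so \<open>F\<close> has a cluster point \<open>f\<close>.
  A subsequence converging at all arguments need not exist; \<open>U\<close> is the filter on the indices generated by
  the preimages of the neighbourhoods of \<open>f\<close>.
\<close>

lemma bounded_functionals_cluster:
  fixes F :: "nat \<Rightarrow> 'a \<Rightarrow> real"
  assumes bound: "\<And>n a. \<bar>F n a\<bar> \<le> B a"
  obtains f U where "U \<noteq> bot" "U \<le> sequentially" "\<And>a. ((\<lambda>n. F n a) \<longlongrightarrow> f a) U"
proof -
  define S where "S = Pi\<^sub>E UNIV (\<lambda>a. {- B a..B a})"
  have "compactin (product_topology (\<lambda>a. euclidean) UNIV) S"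
    unfolding S_def by (intro compactin_PiE[THEN iffD2] disjI2) (simp add: compactin_euclidean_iff)
  then have "compact S" by (simp add: euclidean_product_topology)
  moreover have "filtermap F sequentially \<noteq> bot" by (simp add: filtermap_bot_iff)
  moreover have "eventually (\<lambda>g. g \<in> S) (filtermap F sequentially)"
    using bound by (auto simp: eventually_filtermap S_def abs_le_iff minus_le_iff PiE_iff intro!: always_eventually)
  ultimately obtain f where f: "inf (nhds f) (filtermap F sequentially) \<noteq> bot"
    unfolding compact_filter by blast
  define U where "U = inf sequentially (filtercomap F (nhds f))"
  show thesis
  proof
    show "U \<noteq> bot"
    proof
      assume "U = bot"
      then have "eventually (\<lambda>_. False) U" by simp
      then obtain P Q where P: "eventually P sequentially" and Q: "eventually Q (filtercomap F (nhds f))"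
        and no: "\<And>n. P n \<Longrightarrow> Q n \<Longrightarrow> False" unfolding U_def eventually_inf by blast
      obtain R where R: "eventually R (nhds f)" "\<And>n. R (F n) \<Longrightarrow> Q n"
        using Q unfolding eventually_filtercomap by blast
      have "eventually (\<lambda>g. \<not> R g) (filtermap F sequentially)"
        unfolding eventually_filtermap using P by (rule eventually_mono) (use no R(2) in blast)
      then have "eventually (\<lambda>_. False) (inf (nhds f) (filtermap F sequentially))"
        unfolding eventually_inf using R(1) by blast
      then show False using f by (simp add: eventually_False)
    qed
    show "U \<le> sequentially" by (simp add: U_def)
    show "((\<lambda>n. F n a) \<longlongrightarrow> f a) U" for a
    proof -
      have "filterlim F (nhds f) U" unfolding U_def
        by (rule filterlim_mono[OF filterlim_filtercomap order_refl]) simp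
      moreover have "((\<lambda>g. g a) \<longlongrightarrow> f a) (nhds f)"
      proof -
        have "((\<lambda>g :: 'a \<Rightarrow> real. g a) \<longlongrightarrow> f a) (at f)"
          using continuous_on_product_coordinates[of a] by (auto simp: continuous_on_def)
        then show ?thesis by (simp add: tendsto_at_iff_tendsto_nhds[of "\<lambda>g. g a"])
      qed
      ultimately show ?thesis by (rule filterlim_compose[rotated])
    qed
  qed
qed

section \<open>The weight function\<close>

locale marcinkiewicz_function =
  fixes \<psi> :: "real \<Rightarrow> real"
  assumes nonneg: "\<And>t. 0 \<le> t \<Longrightarrow> 0 \<le> \<psi> t"
    and concave: "concave_on {0..} \<psi>"
    and mono: "mono_on {0..} \<psi>"
    and unbounded: "filterlim \<psi> at_top at_top"
    and doubling: "Liminf at_top (\<lambda>t. ereal (\<psi> (2 * t) / \<psi> t)) = 1"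
begin

lemma le: "0 \<le> x \<Longrightarrow> x \<le> y \<Longrightarrow> \<psi> x \<le> \<psi> y"
  using mono by (auto simp: mono_on_def)

lemma chord:
  assumes "0 \<le> a" "a \<le> x" "x \<le> c"
  shows "(c - x) * \<psi> a + (x - a) * \<psi> c \<le> (c - a) * \<psi> x"
proof (cases "a = c")
  case False
  define t where "t = (x - a) / (c - a)"
  have t: "0 \<le> t" "t \<le> 1" "(c - a) * t = x - a" using False assms by (auto simp: t_def)
  then have x: "(1 - t) *\<^sub>R a + t *\<^sub>R c = x" by (simp add: algebra_simps)
  have "(1 - t) * \<psi> a + t * \<psi> c \<le> \<psi> x"
    using concave_onD[OF concave t(1,2), of a c] assms x by simp
  then have "(c - a) * ((1 - t) * \<psi> a + t * \<psi> c) \<le> (c - a) * \<psi> x"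
    using assms by (intro mult_left_mono) auto
  moreover have "(c - a) * ((1 - t) * \<psi> a + t * \<psi> c) = ((c - a) - (c - a) * t) * \<psi> a + ((c - a) * t) * \<psi> c"
    by (simp add: algebra_simps)
  ultimately show ?thesis by (simp add: t(3))
qed (use assms in simp)

text \<open>
  A zero at \<open>t > 0\<close> would, by concavity and \<open>\<psi> 0 \<ge> 0\<close>, keep \<open>\<psi>\<close> nonpositive on all of \<open>{t..}\<close>.
\<close>

lemma pos:
  assumes t: "0 < t" shows "0 < \<psi> t"
proof (rule ccontr)
  assume "\<not> 0 < \<psi> t"
  then have 0: "\<psi> t = 0" using nonneg[of t] t by simp
  have "\<psi> y \<le> 0" if "y \<ge> t" for y
  proof -
    have "t * \<psi> y \<le> 0"
      using chord[of 0 t y] that t 0 mult_nonneg_nonneg[OF _ nonneg[of 0], of "y - t"] by simp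
    then show ?thesis using t by (simp add: mult_le_0_iff)
  qed
  moreover obtain y where "y \<ge> t" "\<psi> y \<ge> 1"
    using eventually_conj[OF eventually_ge_at_top[of t] filterlim_at_top[THEN iffD1, OF unbounded, rule_format, of 1]]
    by (auto simp: eventually_at_top_linorder)
  ultimately show False by fastforce
qed

lemma ratio_decreasing:
  assumes "0 < x" "x \<le> y" shows "\<psi> y / y \<le> \<psi> x / x"
proof -
  have "x * \<psi> y \<le> y * \<psi> x"
    using chord[of 0 x y] assms mult_nonneg_nonneg[OF _ nonneg[of 0], of "y - x"] by simp
  then show ?thesis using assms by (simp add: field_simps)
qed

text \<open>
  By concavity the growth of \<open>\<psi>\<close> over any number of doublings is at most proportional to its growth over the
  first one, so flatness over a single doubling propagates to \<open>M + 1\<close> doublings. One of these is spent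
  on rounding the real scale \<open>x\<close> up to an integer \<open>t \<le> 2x\<close>.
\<close>

lemma flat_scale:
  fixes M :: nat and T :: real
  assumes \<epsilon>: "\<epsilon> > 0"
  obtains t :: nat where "T \<le> t" "1 \<le> t" "\<psi> (2 ^ M * t) \<le> (1 + \<epsilon>) * \<psi> t"
proof -
  define d where "d = \<epsilon> / 2 ^ Suc M"
  have d: "d > 0" using \<epsilon> by (simp add: d_def)
  have "\<exists>x. x \<ge> 1 \<and> x \<ge> T \<and> \<psi> (2 * x) < (1 + d) * \<psi> x"
  proof (rule ccontr)
    assume "\<not> ?thesis"
    then have no: "(1 + d) * \<psi> x \<le> \<psi> (2 * x)" if "x \<ge> 1" "x \<ge> T" for x
      using that by (auto simp: not_less)
    have "eventually (\<lambda>x. ereal (1 + d) \<le> ereal (\<psi> (2 * x) / \<psi> x)) at_top"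
      unfolding eventually_at_top_linorder
    proof (intro exI allI impI)
      fix x assume "x \<ge> max 1 T"
      then show "ereal (1 + d) \<le> ereal (\<psi> (2 * x) / \<psi> x)"
        using no[of x] pos[of x] by (simp add: pos_le_divide_eq)
    qed
    from Liminf_bounded[OF this] have "ereal (1 + d) \<le> 1" unfolding doubling .
    then show False using d by (simp add: one_ereal_def)
  qed
  then obtain x where x: "x \<ge> 1" "x \<ge> T" "\<psi> (2 * x) < (1 + d) * \<psi> x" by blast
  define t where "t = nat \<lceil>x\<rceil>"
  have tx: "x \<le> real t" "real t \<le> 2 * x" using x(1) unfolding t_def by linarith+
  have "\<psi> (2 ^ M * t) \<le> \<psi> (2 ^ Suc M * x)"
    using tx by (intro le) auto
  also have "\<dots> \<le> (1 + \<epsilon>) * \<psi> x"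
  proof -
    define q where "q = (2::real) ^ Suc M"
    have q: "q \<ge> 2" unfolding q_def by simp
    have "(q * x - 2 * x) * \<psi> x + (2 * x - x) * \<psi> (q * x) \<le> (q * x - x) * \<psi> (2 * x)"
      using x(1) q by (intro chord) auto
    then have "x * ((q - 2) * \<psi> x + \<psi> (q * x)) \<le> x * ((q - 1) * \<psi> (2 * x))"
      by (simp add: algebra_simps)
    then have "(q - 2) * \<psi> x + \<psi> (q * x) \<le> (q - 1) * \<psi> (2 * x)" using x(1) by simp
    also have "\<dots> \<le> (q - 1) * ((1 + d) * \<psi> x)" using q x(3) by (intro mult_left_mono) auto
    finally have "\<psi> (q * x) \<le> \<psi> x + (q * d - d) * \<psi> x" by (simp add: algebra_simps)
    also have "\<dots> \<le> \<psi> x + \<epsilon> * \<psi> x"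
    proof -
      have "q * d = \<epsilon>" by (simp add: q_def d_def)
      then show ?thesis using d nonneg[of x] x(1) by (intro add_left_mono mult_right_mono) auto
    qed
    finally show ?thesis by (simp add: q_def algebra_simps)
  qed
  also have "\<dots> \<le> (1 + \<epsilon>) * \<psi> t" using tx x(1) \<epsilon> by (intro mult_left_mono le) auto
  finally show thesis using that[of t] tx x by simp
qed

text \<open>
  The quotient is decreasing, and over a flat window of \<open>M\<close> doublings it drops by a factor of at least
  \<open>2\<^sup>M / 2\<close>.
\<close>

lemma ratio_tendsto_zero: "(\<lambda>n. \<psi> (real (Suc n)) / real (Suc n)) \<longlonglongrightarrow> 0"
proof (rule LIMSEQ_I)
  fix r :: real assume r: "r > 0"
  obtain M :: nat where M: "2 * \<psi> 1 / r < 2 ^ M" using real_arch_pow[of 2] by auto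
  obtain t :: nat where t: "1 \<le> t" "\<psi> (2 ^ M * t) \<le> (1 + 1) * \<psi> t"
    using flat_scale[of 1 0 M] by auto
  have "\<psi> (2 ^ M * t) / (2 ^ M * t) \<le> 2 / 2 ^ M * (\<psi> t / t)"
    using t by (simp add: field_simps)
  also have "\<dots> \<le> 2 / 2 ^ M * (\<psi> 1 / 1)" using t by (intro mult_left_mono ratio_decreasing) auto
  also have "\<dots> < r" using M r by (simp add: field_simps)
  finally have small: "\<psi> (2 ^ M * t) / (2 ^ M * t) < r" .
  show "\<exists>no. \<forall>n\<ge>no. norm (\<psi> (real (Suc n)) / real (Suc n) - 0) < r"
  proof (intro exI allI impI)
    fix n assume n: "n \<ge> 2 ^ M * t"
    then have "real (2 ^ M * t) \<le> real (Suc n)" by linarith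
    then have "\<psi> (real (Suc n)) / real (Suc n) \<le> \<psi> (2 ^ M * t) / (2 ^ M * t)"
      using t by (intro ratio_decreasing) auto
    then show "norm (\<psi> (real (Suc n)) / real (Suc n) - 0) < r"
      using small nonneg[of "real (Suc n)"] by simp
  qed
qed

text \<open>
  The \<open>n\<close>-th window is \<open>[t n, 2\<^sup>3\<^sup>m t n]\<close> with \<open>m = n + 1\<close>, and \<open>p (n + 1)\<close> is the beginning of its upper
  third on the logarithmic scale. A window starts only when \<open>\<psi>\<close> has outgrown its value at the point \<open>p n\<close>
  of the preceding one by the factor \<open>m\<close>.
\<close>

lemma scales_exist:
  obtains t :: "nat \<Rightarrow> nat" and p :: "nat \<Rightarrow> nat"
  where "\<And>n. 1 \<le> t n" "\<And>n. \<psi> (2 ^ (3 * Suc n) * t n) \<le> (1 + 1 / Suc n) * \<psi> (t n)"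
    "p 0 = 0" "\<And>n. p (Suc n) = 2 ^ (2 * Suc n) * t n"
    "\<And>n. p n \<le> t n" "\<And>n. Suc n * \<psi> (p n) \<le> \<psi> (t n)"
proof -
  define P where "P n t \<longleftrightarrow> 1 \<le> t \<and> \<psi> (2 ^ (3 * Suc n) * real t) \<le> (1 + 1 / Suc n) * \<psi> (real t)" for n t :: nat
  define N where "N n t = 2 ^ (2 * Suc n) * t" for n t :: nat
  define Q where "Q n t u \<longleftrightarrow> N n t \<le> u \<and> Suc (Suc n) * \<psi> (real (N n t)) \<le> \<psi> (real u)" for n t u :: nat
  have "\<exists>t. P 0 t" unfolding P_def using flat_scale[of 1 0 3] by auto
  moreover have "\<exists>u. P (Suc n) u \<and> Q n t u" for n t
  proof -
    obtain Y where Y: "\<And>y. y \<ge> Y \<Longrightarrow> \<psi> y \<ge> Suc (Suc n) * \<psi> (real (N n t))"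
      using filterlim_at_top[THEN iffD1, OF unbounded, rule_format] by (auto simp: eventually_at_top_linorder)
    obtain u :: nat where "max Y (N n t) \<le> real u" "1 \<le> u"
      "\<psi> (2 ^ (3 * Suc (Suc n)) * u) \<le> (1 + 1 / Suc (Suc n)) * \<psi> u"
      using flat_scale[of "1 / real (Suc (Suc n))" "max Y (real (N n t))" "3 * Suc (Suc n)"] by auto
    then show ?thesis using Y[of u] unfolding P_def Q_def by (intro exI[of _ u]) auto
  qed
  ultimately obtain t where t: "\<And>n. P n (t n)" "\<And>n. Q n (t n) (t (Suc n))"
    using dependent_nat_choice[of P Q] by metis
  define p where "p n = (case n of 0 \<Rightarrow> 0 | Suc k \<Rightarrow> N k (t k))" for n
  show thesis
  proof
    show "1 \<le> t n" "\<psi> (2 ^ (3 * Suc n) * t n) \<le> (1 + 1 / Suc n) * \<psi> (t n)" for n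
      using t(1)[of n] by (simp_all add: P_def)
    show "p 0 = 0" "p (Suc n) = 2 ^ (2 * Suc n) * t n" for n by (simp_all add: p_def N_def)
    show "p n \<le> t n" "Suc n * \<psi> (p n) \<le> \<psi> (t n)" for n
      using t(2)[of "n - 1"] le[of 0 "t 0"] by (cases n; simp add: p_def Q_def)+
  qed
qed

end

section \<open>The averaged gap functionals\<close>

locale gap_scales = marcinkiewicz_function \<psi> for \<psi> :: "real \<Rightarrow> real" +
  fixes t p :: "nat \<Rightarrow> nat"
  assumes t1: "\<And>n. 1 \<le> t n"
    and flat: "\<And>n. \<psi> (2 ^ (3 * Suc n) * t n) \<le> (1 + 1 / Suc n) * \<psi> (t n)"
    and p0: "p 0 = 0" and pSuc: "\<And>n. p (Suc n) = 2 ^ (2 * Suc n) * t n"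
    and pt: "\<And>n. p n \<le> t n" and psmall: "\<And>n. Suc n * \<psi> (p n) \<le> \<psi> (t n)"
begin

text \<open>
  With \<open>m = n + 1\<close>: the average over \<open>j < m\<close> of the growth of \<open>a\<close> from the point \<open>2\<^sup>j t n\<close> in the lower
  third of the \<open>n\<close>-th window to the corresponding point of the upper third.
\<close>

definition gap :: "nat \<Rightarrow> (nat \<Rightarrow> real) \<Rightarrow> real" where
  "gap n a = (\<Sum>j<Suc n. a (2 ^ (2 * Suc n + j) * t n) - a (2 ^ j * t n)) / (Suc n * \<psi> (t n))"

lemma scale_weight_pos: "\<psi> (t n) > 0" using pos t1[of n] by simp

lemma flat2: "\<psi> (2 ^ (3 * Suc n) * t n) \<le> 2 * \<psi> (t n)"
proof -
  have "(1 + 1 / Suc n) * \<psi> (t n) \<le> 2 * \<psi> (t n)" using scale_weight_pos[of n] by (intro mult_right_mono) auto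
  then show ?thesis using flat[of n] by linarith
qed

lemma gap_diff: "gap n (\<lambda>k. a k - b k) = gap n a - gap n b"
  unfolding gap_def diff_divide_distrib[symmetric] sum_subtractf[symmetric]
  by (intro arg_cong2[where f = "(/)"] sum.cong refl) simp

lemma gap_add: "gap n (\<lambda>k. a k + b k) = gap n a + gap n b"
  unfolding gap_def add_divide_distrib[symmetric] sum.distrib[symmetric]
  by (intro arg_cong2[where f = "(/)"] sum.cong refl) simp

lemma gap_scale: "gap n (\<lambda>k. r * a k) = r * gap n a"
  unfolding gap_def right_diff_distrib[symmetric] sum_distrib_left[symmetric] by simp

lemma gap_nonneg:
  assumes "mono a" shows "0 \<le> gap n a"
proof -
  have "a (2 ^ j * t n) \<le> a (2 ^ (2 * Suc n + j) * t n)" for j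
    by (intro monoD[OF assms] mult_le_mono power_increasing) auto
  then show ?thesis unfolding gap_def using scale_weight_pos[of n]
    by (intro divide_nonneg_pos sum_nonneg) (auto simp del: power_Suc mult_Suc_right)
qed

lemma gap_le:
  assumes "\<And>j. j < Suc n \<Longrightarrow> a (2 ^ (2 * Suc n + j) * t n) - a (2 ^ j * t n) \<le> c * \<psi> (t n)"
  shows "gap n a \<le> c"
proof -
  have "(\<Sum>j<Suc n. a (2 ^ (2 * Suc n + j) * t n) - a (2 ^ j * t n)) \<le> (\<Sum>j<Suc n. c * \<psi> (t n))"
    by (intro sum_mono assms) simp
  then show ?thesis unfolding gap_def using scale_weight_pos[of n] by (simp add: divide_le_eq mult_ac del: sum.lessThan_Suc)
qed

lemma gap_ge:
  assumes "\<And>j. j < Suc n \<Longrightarrow> c * \<psi> (t n) \<le> a (2 ^ (2 * Suc n + j) * t n) - a (2 ^ j * t n)"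
  shows "c \<le> gap n a"
proof -
  have "(\<Sum>j<Suc n. c * \<psi> (t n)) \<le> (\<Sum>j<Suc n. a (2 ^ (2 * Suc n + j) * t n) - a (2 ^ j * t n))"
    by (intro sum_mono assms) simp
  then show ?thesis unfolding gap_def using scale_weight_pos[of n] by (simp add: le_divide_eq mult_ac del: sum.lessThan_Suc)
qed

lemma scale_bound:
  assumes C: "0 \<le> C" "\<And>k. 1 \<le> k \<Longrightarrow> a k \<le> C * \<psi> (real k)" and j: "j \<le> 3 * Suc n"
  shows "a (2 ^ j * t n) \<le> 2 * C * \<psi> (t n)"
proof -
  have "a (2 ^ j * t n) \<le> C * \<psi> (real (2 ^ j * t n))" using t1[of n] by (intro C(2)) simp
  also have "\<dots> \<le> C * \<psi> (2 ^ (3 * Suc n) * t n)"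
    using C(1) j by (intro mult_left_mono le) (auto intro!: mult_right_mono power_increasing)
  also have "\<dots> \<le> C * (2 * \<psi> (t n))" by (intro mult_left_mono flat2 C)
  finally show ?thesis by simp
qed

lemma gap_bounded:
  assumes a: "\<And>k. 0 \<le> a k" and C: "0 \<le> C" "\<And>k. 1 \<le> k \<Longrightarrow> a k \<le> C * \<psi> (real k)"
  shows "gap n a \<le> 2 * C"
proof (rule gap_le)
  fix j assume "j < Suc n"
  then have "a (2 ^ (2 * Suc n + j) * t n) \<le> 2 * C * \<psi> (t n)" by (intro scale_bound C) auto
  then show "a (2 ^ (2 * Suc n + j) * t n) - a (2 ^ j * t n) \<le> 2 * C * \<psi> (t n)"
    using a[of "2 ^ j * t n"] by linarith
qed

text \<open>
  At each point \<open>k\<close> the defect \<open>a k + b k - c k\<close> is at most the growth of \<open>c\<close> from \<open>k\<close> to \<open>2k\<close>. Over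
  consecutive doublings these growths telescope to a bounded quantity, which is divided by the number of
  doublings.
\<close>

lemma gap_almost_additive:
  assumes c: "\<And>k. 0 \<le> c k" and C: "0 \<le> C" "\<And>k. 1 \<le> k \<Longrightarrow> c k \<le> C * \<psi> (real k)"
    and sub: "\<And>k. c k \<le> a k + b k" and sup: "\<And>k. a k + b k \<le> c (2 * k)"
  shows "\<bar>gap n c - (gap n a + gap n b)\<bar> \<le> 2 * C / Suc n"
proof -
  let ?m = "Suc n"
  define d where "d k = a k + b k - c k" for k
  have d0: "0 \<le> d k" for k using sub by (simp add: d_def)
  have tele: "(\<Sum>j<?m. d (2 ^ (i + j) * t n)) \<le> 2 * C * \<psi> (t n)" if i: "i + ?m \<le> 3 * ?m" for i
  proof -
    have "(\<Sum>j<?m. d (2 ^ (i + j) * t n)) \<le> (\<Sum>j<?m. c (2 ^ (i + Suc j) * t n) - c (2 ^ (i + j) * t n))"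
    proof (rule sum_mono)
      fix j show "d (2 ^ (i + j) * t n) \<le> c (2 ^ (i + Suc j) * t n) - c (2 ^ (i + j) * t n)"
        using sup[of "2 ^ (i + j) * t n"] by (simp add: d_def mult_ac)
    qed
    also have "\<dots> = c (2 ^ (i + ?m) * t n) - c (2 ^ (i + 0) * t n)" by (rule sum_lessThan_telescope)
    also have "\<dots> \<le> 2 * C * \<psi> (t n)" using scale_bound[of C c "i + ?m" n, OF C i] c[of "2 ^ (i + 0) * t n"] by linarith
    finally show ?thesis .
  qed
  let ?U = "\<Sum>j<?m. d (2 ^ (2 * ?m + j) * t n)" and ?L = "\<Sum>j<?m. d (2 ^ j * t n)"
  have "?U \<le> 2 * C * \<psi> (t n)" by (rule tele) simp
  moreover have "?L \<le> 2 * C * \<psi> (t n)" using tele[of 0] by (simp del: sum.lessThan_Suc)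
  moreover have "0 \<le> ?U" "0 \<le> ?L" by (intro sum_nonneg d0)+
  ultimately have "\<bar>?U - ?L\<bar> \<le> 2 * C * \<psi> (t n)" by linarith
  then have "\<bar>?U - ?L\<bar> / \<bar>?m * \<psi> (t n)\<bar> \<le> 2 * C * \<psi> (t n) / (?m * \<psi> (t n))"
    by (simp only: abs_mult abs_of_nat abs_of_pos[OF scale_weight_pos]) (intro divide_right_mono mult_nonneg_nonneg order.strict_implies_order[OF scale_weight_pos]; simp)
  then have "\<bar>gap n d\<bar> \<le> 2 * C * \<psi> (t n) / (?m * \<psi> (t n))"
    unfolding gap_def sum_subtractf abs_divide .
  also have "\<dots> = 2 * C / ?m" using scale_weight_pos[of n] by simp
  finally show ?thesis unfolding d_def[abs_def] gap_diff gap_add by linarith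
qed

section \<open>Averaging the weight over blocks\<close>

lemma gap_weight_small: "gap n (\<lambda>k. \<psi> (real k) - \<psi> 0) \<le> 1 / Suc n"
proof (rule gap_le)
  fix j assume j: "j < Suc n"
  have "\<psi> (real (2 ^ (2 * Suc n + j) * t n)) \<le> \<psi> (2 ^ (3 * Suc n) * t n)"
    using j by (intro le) (auto intro!: mult_right_mono power_increasing simp del: power_Suc)
  moreover have "\<psi> (t n) \<le> \<psi> (real (2 ^ j * t n))"
    using mult_right_mono[of 1 "2 ^ j" "real (t n)"] by (intro le) auto
  moreover have "(1 + 1 / Suc n) * \<psi> (t n) = \<psi> (t n) + 1 / Suc n * \<psi> (t n)" by (simp add: algebra_simps)
  ultimately show "\<psi> (real (2 ^ (2 * Suc n + j) * t n)) - \<psi> 0 - (\<psi> (real (2 ^ j * t n)) - \<psi> 0) \<le> 1 / Suc n * \<psi> (t n)"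
    using flat[of n] by linarith
qed

lemma p_strict: "p n < p (Suc n)"
proof -
  have "1 * t n < 2 ^ (2 * Suc n) * t n" using t1[of n] one_less_power[of "2::nat" "2 * Suc n"]
    by (intro mult_strict_right_mono) auto
  then show ?thesis using pt[of n] by (simp only: pSuc)
qed

lemma p_strict_mono: "strict_mono p" using p_strict by (simp add: strict_mono_Suc_iff)

definition slope :: "nat \<Rightarrow> real" where
  "slope j = (\<psi> (p (Suc j)) - \<psi> (p j)) / (real (p (Suc j)) - real (p j))"

definition block :: "nat \<Rightarrow> nat" where "block k = (LEAST j. k < p (Suc j))"

lemma slope_mult: "slope j * (real (p (Suc j)) - real (p j)) = \<psi> (p (Suc j)) - \<psi> (p j)"
  using p_strict[of j] by (simp add: slope_def)

lemma slope_nonneg: "0 \<le> slope j"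
  unfolding slope_def using p_strict[of j] by (intro divide_nonneg_pos) (auto intro!: le)

lemma slope_decreasing: "antimono slope"
proof (rule decseq_SucI)
  fix j
  let ?a = "real (p j)" and ?x = "real (p (Suc j))" and ?c = "real (p (Suc (Suc j)))"
  have "(?c - ?x) * \<psi> ?a + (?x - ?a) * \<psi> ?c \<le> (?c - ?a) * \<psi> ?x"
    using p_strict[of j] p_strict[of "Suc j"] by (intro chord) auto
  then have "(?x - ?a) * (\<psi> ?c - \<psi> ?x) \<le> (?c - ?x) * (\<psi> ?x - \<psi> ?a)" by (simp add: algebra_simps)
  then show "slope (Suc j) \<le> slope j"
    unfolding slope_def using p_strict[of j] p_strict[of "Suc j"] by (simp add: field_simps)
qed

lemma block_eq:
  assumes "p j \<le> k" "k < p (Suc j)" shows "block k = j"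
  unfolding block_def
proof (rule Least_equality[of "\<lambda>j. k < p (Suc j)", OF assms(2)])
  fix i assume "k < p (Suc i)"
  then have "p j < p (Suc i)" using assms(1) by linarith
  then show "j \<le> i" using p_strict_mono by (simp add: strict_mono_less)
qed

lemma block_exists: "\<exists>j. p j \<le> k \<and> k < p (Suc j)"
proof -
  have "k < p (Suc k)" using strict_mono_imp_increasing[OF p_strict_mono, of "Suc k"] by linarith
  then have 1: "k < p (Suc (block k))" unfolding block_def by (rule LeastI)
  have 2: "p (block k) \<le> k"
  proof (cases "block k")
    case 0 then show ?thesis using p0 by simp
  next
    case (Suc i)
    then show ?thesis using not_less_Least[of i "\<lambda>j. k < p (Suc j)"] unfolding block_def by simp
  qed
  show ?thesis using 1 2 by blast
qed

lemma block_mono: "mono block"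
proof (rule monoI)
  fix x y :: nat assume "x \<le> y"
  obtain j where j: "p j \<le> x" "x < p (Suc j)" using block_exists by blast
  obtain i where i: "p i \<le> y" "y < p (Suc i)" using block_exists by blast
  have "p j < p (Suc i)" using i j \<open>x \<le> y\<close> by linarith
  then have "j \<le> i" using p_strict_mono by (simp add: strict_mono_less)
  then show "block x \<le> block y" using block_eq i j by simp
qed

text \<open>
  The mean of the increments of \<open>\<psi>\<close> over the block \<open>[p j, p (j + 1))\<close> that contains \<open>k\<close>. The partial sums
  interpolate \<open>\<psi> - \<psi> 0\<close> linearly between the points \<open>p j\<close>.
\<close>

definition averaged :: "nat \<Rightarrow> real" where "averaged k = slope (block k)"

lemma averaged_sum:
  "p j \<le> k \<Longrightarrow> k \<le> p (Suc j) \<Longrightarrow> (\<Sum>i<k. averaged i) = \<psi> (p j) - \<psi> 0 + slope j * (real k - real (p j))"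
proof (induction j arbitrary: k)
  have step: "(\<Sum>i<k. averaged i) = (\<Sum>i<p j. averaged i) + slope j * (real k - real (p j))"
    if "p j \<le> k" "k \<le> p (Suc j)" for j k
  proof -
    have "(\<Sum>i<k. averaged i) = (\<Sum>i<p j. averaged i) + (\<Sum>i\<in>{p j..<k}. averaged i)"
      using that by (metis lessThan_atLeast0 sum.atLeastLessThan_concat zero_le)
    also have "(\<Sum>i\<in>{p j..<k}. averaged i) = (\<Sum>i\<in>{p j..<k}. slope j)"
    proof (rule sum.cong[OF refl])
      fix i assume "i \<in> {p j..<k}"
      then show "averaged i = slope j" using that block_eq[of j i] by (simp add: averaged_def)
    qed
    finally show ?thesis using that by (simp add: of_nat_diff mult.commute)
  qed
  { case 0 then show ?case using step[of 0 k] p0 by simp }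
  { case (Suc j)
    have "(\<Sum>i<p (Suc j). averaged i) = \<psi> (p (Suc j)) - \<psi> 0"
      using Suc.IH[of "p (Suc j)"] p_strict[of j] slope_mult[of j] by simp
    then show ?case using step[OF Suc.prems] by simp }
qed

lemma averaged_sum_le: "(\<Sum>i<k. averaged i) \<le> \<psi> (real k) - \<psi> 0"
proof -
  obtain j where j: "p j \<le> k" "k < p (Suc j)" using block_exists by blast
  let ?a = "real (p j)" and ?c = "real (p (Suc j))"
  have "(?c - k) * \<psi> ?a + (k - ?a) * \<psi> ?c \<le> (?c - ?a) * \<psi> k" using j by (intro chord) auto
  moreover have "(?c - ?a) * (\<psi> ?a + slope j * (k - ?a)) = (?c - ?a) * \<psi> ?a + (slope j * (?c - ?a)) * (k - ?a)"
    by (simp add: algebra_simps)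
  moreover have "\<dots> = (?c - k) * \<psi> ?a + (k - ?a) * \<psi> ?c"
    unfolding slope_mult by (simp add: algebra_simps)
  ultimately have "(?c - ?a) * (\<psi> ?a + slope j * (k - ?a)) \<le> (?c - ?a) * \<psi> k" by simp
  then have "\<psi> ?a + slope j * (k - ?a) \<le> \<psi> k" using p_strict[of j] by simp
  then show ?thesis using averaged_sum[of j k] j by simp
qed

text \<open>
  The upper third begins at \<open>p (n + 1)\<close>, where the interpolation agrees with \<open>\<psi> - \<psi> 0\<close>. The points of the
  lower third are at most \<open>2\<^sup>-\<^sup>m p (n + 1)\<close>, so there the chord from \<open>p n\<close> to \<open>p (n + 1)\<close> has covered at most
  the fraction \<open>2\<^sup>-\<^sup>m\<close> of its height, and its left end is below \<open>\<psi> (t n) / m\<close> by the choice of \<open>t n\<close>.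
\<close>

lemma gap_averaged_large: "1 - 1 / Suc n - 2 * (1 / 2) ^ Suc n \<le> gap n (\<lambda>k. \<Sum>i<k. averaged i)"
proof (rule gap_ge)
  fix j assume j: "j < Suc n"
  define a where "a k = (\<Sum>i<k. averaged i)" for k
  have anonneg: "0 \<le> averaged i" for i by (simp add: averaged_def slope_nonneg)
  have amono: "a x \<le> a y" if "x \<le> y" for x y
    unfolding a_def using that anonneg by (intro sum_mono2) auto
  have "t n \<le> p (Suc n)" using pt[of n] p_strict[of n] unfolding pSuc by simp
  then have "\<psi> (t n) - \<psi> 0 \<le> \<psi> (p (Suc n)) - \<psi> 0"
    by (intro diff_right_mono le) auto
  also have "\<dots> = a (p (Suc n))"
    using averaged_sum[of n "p (Suc n)"] p_strict[of n] slope_mult[of n] by (simp add: a_def)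
  also have "\<dots> \<le> a (2 ^ (2 * Suc n + j) * t n)"
    unfolding pSuc by (intro amono mult_le_mono power_increasing) auto
  finally have up: "\<psi> (t n) - \<psi> 0 \<le> a (2 ^ (2 * Suc n + j) * t n)" .
  \<comment> \<open>x bounds the lower third from above.\<close>
  define x where "x = 2 ^ Suc n * t n"
  have x1: "p n \<le> x" using pt[of n] by (simp add: x_def) (smt (verit) le_trans mult_le_mono1 one_le_numeral one_le_power nat_mult_1)
  have x2: "p (Suc n) = 2 ^ Suc n * x" by (simp only: pSuc x_def mult.assoc[symmetric] power_add[symmetric]) (simp add: mult_2)
  have x3: "x \<le> p (Suc n)" unfolding x2 by simp
  have sl: "slope n * (real x - real (p n)) \<le> (1 / 2) ^ Suc n * \<psi> (p (Suc n))"
  proof -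
    let ?P = "real (p n)" and ?q = "real (p (Suc n))"
    have q: "?q = 2 ^ Suc n * real x" unfolding x2 by simp
    have dq: "?q - ?P > 0" using p_strict[of n] by simp
    have "(real x - ?P) / (?q - ?P) \<le> (1 / 2) ^ Suc n"
    proof -
      have "real x - ?P \<le> (1 / 2) ^ Suc n * (?q - ?P)"
      proof -
        have "(1 / 2) ^ Suc n * ?q = real x" unfolding q by (simp add: power_one_over)
        moreover have "(1 / 2) ^ Suc n * ?P \<le> 1 * ?P" by (intro mult_right_mono power_le_one) auto
        ultimately show ?thesis by (simp only: right_diff_distrib)
      qed
      then show ?thesis using dq by (simp add: divide_le_eq)
    qed
    then have "(\<psi> ?q - \<psi> ?P) * ((real x - ?P) / (?q - ?P)) \<le> \<psi> ?q * (1 / 2) ^ Suc n"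
      using nonneg[of ?P] nonneg[of ?q] x1 dq by (intro mult_mono) auto
    then show ?thesis by (simp add: slope_def mult.commute)
  qed
  have "a (2 ^ j * t n) \<le> a x" unfolding x_def using j by (intro amono mult_le_mono power_increasing) auto
  also have "a x = \<psi> (p n) - \<psi> 0 + slope n * (real x - real (p n))"
    unfolding a_def by (rule averaged_sum[OF x1 x3])
  also have "\<dots> \<le> \<psi> (t n) / Suc n - \<psi> 0 + (1 / 2) ^ Suc n * (2 * \<psi> (t n))"
  proof -
    have "\<psi> (p n) \<le> \<psi> (t n) / Suc n" using psmall[of n] by (simp add: field_simps)
    moreover have "\<psi> (p (Suc n)) \<le> 2 * \<psi> (t n)"
    proof -
      have "2 ^ (2 * Suc n) * real (t n) \<le> 2 ^ (3 * Suc n) * real (t n)"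
        by (intro mult_right_mono power_increasing) auto
      then have "\<psi> (p (Suc n)) \<le> \<psi> (2 ^ (3 * Suc n) * t n)"
        by (intro le) (simp_all add: pSuc)
      then show ?thesis using flat2[of n] by linarith
    qed
    then have "(1 / 2) ^ Suc n * \<psi> (p (Suc n)) \<le> (1 / 2) ^ Suc n * (2 * \<psi> (t n))" by (intro mult_left_mono) auto
    ultimately show ?thesis using sl by linarith
  qed
  finally have low: "a (2 ^ j * t n) \<le> \<psi> (t n) / Suc n - \<psi> 0 + (1 / 2) ^ Suc n * (2 * \<psi> (t n))" .
  have "(1 - 1 / Suc n - 2 * (1 / 2) ^ Suc n) * \<psi> (t n) = \<psi> (t n) - \<psi> (t n) / Suc n - (1 / 2) ^ Suc n * (2 * \<psi> (t n))"
    by (simp add: algebra_simps)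
  then have "(1 - 1 / Suc n - 2 * (1 / 2) ^ Suc n) * \<psi> (t n) \<le> a (2 ^ (2 * Suc n + j) * t n) - a (2 ^ j * t n)"
    using up low by linarith
  then show "(1 - 1 / Suc n - 2 * (1 / 2) ^ Suc n) * \<psi> (t n) \<le>
      (\<Sum>i<2 ^ (2 * Suc n + j) * t n. averaged i) - (\<Sum>i<2 ^ j * t n. averaged i)"
    by (simp only: a_def)
qed

end

context marcinkiewicz_function begin

lemma decreasing_tendsto_zero:
  fixes s :: "nat \<Rightarrow> real"
  assumes "antimono s" "\<And>k. 0 \<le> s k" "\<And>n. (\<Sum>k<n. s k) \<le> \<psi> (real n)"
  shows "s \<longlonglongrightarrow> 0"
proof (rule Lim_null_comparison[OF _ ratio_tendsto_zero])
  show "\<forall>\<^sub>F n in sequentially. norm (s n) \<le> \<psi> (real (Suc n)) / real (Suc n)"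
  proof (intro always_eventually allI)
    fix n
    have "real (Suc n) * s n = (\<Sum>k<Suc n. s n)" by simp
    also have "\<dots> \<le> (\<Sum>k<Suc n. s k)" using assms(1) by (intro sum_mono) (auto simp: antimono_def)
    also have "\<dots> \<le> \<psi> (real (Suc n))" by (rule assms(3))
    finally show "norm (s n) \<le> \<psi> (real (Suc n)) / real (Suc n)"
      using assms(2)[of n] by (simp add: field_simps)
  qed
qed

lemma increments:
  "antimono (\<lambda>k. \<psi> (real (Suc k)) - \<psi> (real k))" "0 \<le> \<psi> (real (Suc k)) - \<psi> (real k)"
  "(\<Sum>k<n. \<psi> (real (Suc k)) - \<psi> (real k)) = \<psi> (real n) - \<psi> 0"
proof -
  show "antimono (\<lambda>k. \<psi> (real (Suc k)) - \<psi> (real k))"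
  proof (rule decseq_SucI)
    show "\<psi> (real (Suc (Suc k))) - \<psi> (real (Suc k)) \<le> \<psi> (real (Suc k)) - \<psi> (real k)" for k
      using chord[of "real k" "real (Suc k)" "real (Suc (Suc k))"] by simp
  qed
  show "0 \<le> \<psi> (real (Suc k)) - \<psi> (real k)" using le[of "real k" "real (Suc k)"] by simp
  show "(\<Sum>k<n. \<psi> (real (Suc k)) - \<psi> (real k)) = \<psi> (real n) - \<psi> 0"
    using sum_lessThan_telescope[of "\<lambda>k. \<psi> (real k)" n] by simp
qed

end

section \<open>The trace\<close>

context marcinkiewicz_function begin

lemma marcinkiewicz_ideal_iff:
  "A \<in> marcinkiewicz_ideal \<psi> \<longleftrightarrow>
    compact_operator A \<and> (\<exists>C\<ge>0. \<forall>k\<ge>1. singular_sum A k \<le> C * \<psi> (real k))"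
proof -
  have "bdd_above ((\<lambda>n::nat. 1 / \<psi> (real n) * (\<Sum>k<n. singular_values A k)) ` {1..}) \<longleftrightarrow>
      (\<exists>C\<ge>0. \<forall>k\<ge>1. singular_sum A k \<le> C * \<psi> (real k))" (is "?l \<longleftrightarrow> ?r")
  proof
    assume ?l
    then obtain C where C: "\<And>n. n \<ge> 1 \<Longrightarrow> 1 / \<psi> (real n) * singular_sum A n \<le> C"
      by (auto simp: bdd_above_def singular_sum_def)
    have "singular_sum A n \<le> \<bar>C\<bar> * \<psi> (real n)" if "n \<ge> 1" for n
    proof -
      have "1 / \<psi> (real n) * singular_sum A n \<le> \<bar>C\<bar>" using C[OF that] by linarith
      then show ?thesis using pos[of "real n"] that by (simp add: divide_le_eq)
    qed
    then show ?r by (intro exI[of _ "\<bar>C\<bar>"]) simp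
  next
    assume ?r
    then obtain C where C: "\<And>n. n \<ge> 1 \<Longrightarrow> singular_sum A n \<le> C * \<psi> (real n)" by blast
    have "1 / \<psi> (real n) * (\<Sum>k<n. singular_values A k) \<le> C" if "n \<ge> 1" for n
      using C[OF that] pos[of "real n"] that by (simp add: divide_le_eq singular_sum_def)
    then show ?l by (auto simp: bdd_above_def)
  qed
  then show ?thesis by (simp add: marcinkiewicz_ideal_def)
qed

lemma marcinkiewicz_idealI:
  assumes "compact_operator A" "0 \<le> C" "\<And>k. 1 \<le> k \<Longrightarrow> singular_sum A k \<le> C * \<psi> (real k)"
  shows "A \<in> marcinkiewicz_ideal \<psi>"
  unfolding marcinkiewicz_ideal_iff using assms by (intro conjI exI[of _ C]) auto

lemma marcinkiewicz_idealE:
  assumes "A \<in> marcinkiewicz_ideal \<psi>"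
  obtains C where "compact_operator A" "0 \<le> C" "\<And>k. 1 \<le> k \<Longrightarrow> singular_sum A k \<le> C * \<psi> (real k)"
  using assms by (auto simp: marcinkiewicz_ideal_iff)

lemma diagonal_member:
  fixes e :: "nat \<Rightarrow> 'h::complex_hilbert"
  assumes inf: "infinite_dimensional TYPE('h)" and e: "orthonormal_on UNIV e"
    and s: "antimono s" "\<And>k. 0 \<le> s k" "\<And>n. (\<Sum>k<n. s k) \<le> \<psi> (real n)"
  obtains D :: "'h \<Rightarrow> 'h" where "D \<in> marcinkiewicz_ideal \<psi>" "positive_operator D"
    "singular_sum D = (\<lambda>n. \<Sum>k<n. s k)"
proof -
  obtain D where D: "eigensystem D s e" "compact_operator D"
    using diagonal_operator_exists[OF e s(1,2) decreasing_tendsto_zero[OF s]] .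
  have sum: "singular_sum D = (\<lambda>n. \<Sum>k<n. s k)"
    by (simp add: fun_eq_iff singular_sum_def singular_values_eigensystem[OF inf D(2,1)])
  have "D \<in> marcinkiewicz_ideal \<psi>"
    using s(3) by (intro marcinkiewicz_idealI[OF D(2), of 1]) (simp_all add: sum)
  then show thesis using eigensystemD(1)[OF D(1)] sum by (rule that)
qed

end

context gap_scales begin

text \<open>
  The gaps of the positive elements of the ideal are bounded, so they converge along some filter \<open>U\<close>. The
  limit is additive because the defect of additivity at stage \<open>n\<close> is of order \<open>1 / n\<close>.
\<close>

theorem gap_trace:
  assumes inf: "infinite_dimensional TYPE('h::complex_hilbert)"
  obtains \<phi> :: "('h::complex_hilbert \<Rightarrow> 'h) \<Rightarrow> complex" and f U where
    "trace_on (marcinkiewicz_ideal \<psi>) \<phi>" "U \<noteq> bot" "U \<le> sequentially"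
    "\<And>P. P \<in> marcinkiewicz_ideal \<psi> \<Longrightarrow> positive_operator P \<Longrightarrow>
      \<phi> P = complex_of_real (f P) \<and> ((\<lambda>n. gap n (singular_sum P)) \<longlongrightarrow> f P) U"
proof -
  define M where "M = (marcinkiewicz_ideal \<psi> :: ('h \<Rightarrow> 'h) set)"
  define C where "C = {P \<in> M. positive_operator P}"
  have C: "positive_operator P" "compact_operator P" if "P \<in> C" for P
    using that by (auto simp: C_def M_def marcinkiewicz_ideal_iff)
  have "\<exists>b. P \<in> C \<longrightarrow> 0 \<le> b \<and> (\<forall>k\<ge>1. singular_sum P k \<le> b * \<psi> (real k))" for P
    unfolding C_def M_def marcinkiewicz_ideal_iff by blast
  then obtain b where b: "\<And>P. P \<in> C \<Longrightarrow> 0 \<le> b P"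
    "\<And>P k. P \<in> C \<Longrightarrow> 1 \<le> k \<Longrightarrow> singular_sum P k \<le> b P * \<psi> (real k)" by metis
  have mono: "mono (singular_sum P)" if "P \<in> C" for P
    using singular_sum_mono_index[OF inf C(2)[OF that]] by (simp add: mono_def)
  have nonneg: "0 \<le> singular_sum P k" if "P \<in> C" for P k
    by (rule singular_sum_nonneg[OF inf C(2)[OF that]])
  \<comment> \<open>The value 0 outside the cone keeps F n P bounded in n for every P.\<close>
  define F where "F n P = (if P \<in> C then gap n (singular_sum P) else 0)" for n P
  have bound: "\<bar>F n P\<bar> \<le> (if P \<in> C then 2 * b P else 0)" for n P
  proof (cases "P \<in> C")
    case P: True
    have "gap n (singular_sum P) \<le> 2 * b P" by (rule gap_bounded[OF nonneg[OF P] b[OF P]])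
    then show ?thesis using gap_nonneg[OF mono[OF P], of n] P by (simp add: F_def)
  qed (simp add: F_def)
  obtain f U where U: "U \<noteq> bot" "U \<le> sequentially" and lim: "\<And>P. ((\<lambda>n. F n P) \<longlongrightarrow> f P) U"
    using bounded_functionals_cluster[of F, OF bound] by blast
  have lim: "((\<lambda>n. gap n (singular_sum P)) \<longlongrightarrow> f P) U" if "P \<in> C" for P
    using lim[of P] that by (simp add: F_def)
  have eqI: "f P = c" if "P \<in> C" "((\<lambda>n. gap n (singular_sum P)) \<longlongrightarrow> c) U" for P c
    using tendsto_unique[OF U(1) lim[OF that(1)] that(2)] .
  have add: "(\<lambda>x. P x + Q x) \<in> C \<and> f (\<lambda>x. P x + Q x) = f P + f Q" if PQ: "P \<in> C" "Q \<in> C" for P Q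
  proof
    let ?S = "\<lambda>x. P x + Q x"
    note c = C[OF PQ(1)] C[OF PQ(2)]
    have sub: "singular_sum ?S k \<le> singular_sum P k + singular_sum Q k" for k
      by (rule singular_sum_add_le[OF inf c])
    have "positive_operator ?S" "compact_operator ?S"
      by (rule positive_operator_add[OF c(1,3)]) (rule compact_operator_add[OF c(2,4)])
    moreover have "singular_sum ?S k \<le> (b P + b Q) * \<psi> (real k)" if "1 \<le> k" for k
      using sub[of k] b(2)[OF PQ(1) that] b(2)[OF PQ(2) that] by (simp add: distrib_right)
    ultimately show S: "?S \<in> C"
      unfolding C_def M_def using b(1)[OF PQ(1)] b(1)[OF PQ(2)]
      by (auto intro: marcinkiewicz_idealI[where C = "b P + b Q"])
    have "(\<lambda>n. gap n (singular_sum ?S) - (gap n (singular_sum P) + gap n (singular_sum Q))) \<longlonglongrightarrow> 0"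
    proof (rule Lim_null_comparison)
      show "\<forall>\<^sub>F n in sequentially. norm (gap n (singular_sum ?S) - (gap n (singular_sum P) + gap n (singular_sum Q)))
          \<le> 2 * b ?S * inverse (real (Suc n))"
      proof (intro always_eventually allI)
        fix n
        have "\<bar>gap n (singular_sum ?S) - (gap n (singular_sum P) + gap n (singular_sum Q))\<bar> \<le> 2 * b ?S / Suc n"
          by (rule gap_almost_additive[OF nonneg[OF S] b(1)[OF S] b(2)[OF S] sub singular_sum_add_ge[OF inf c]])
        then show "norm (gap n (singular_sum ?S) - (gap n (singular_sum P) + gap n (singular_sum Q)))
            \<le> 2 * b ?S * inverse (real (Suc n))" by (simp add: divide_inverse)
      qed
      show "(\<lambda>n. 2 * b ?S * inverse (real (Suc n))) \<longlonglongrightarrow> 0"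
        using tendsto_mult_left[OF LIMSEQ_inverse_real_of_nat, of "2 * b ?S"] by simp
    qed
    then have "((\<lambda>n. gap n (singular_sum ?S) - (gap n (singular_sum P) + gap n (singular_sum Q))) \<longlongrightarrow> 0) U"
      using U(2) tendsto_mono by blast
    from tendsto_add[OF this tendsto_add[OF lim[OF PQ(1)] lim[OF PQ(2)]]]
    show "f ?S = f P + f Q" by (intro eqI S) simp
  qed
  have scale: "(\<lambda>x. complex_of_real r *\<^sub>C P x) \<in> C \<and> f (\<lambda>x. complex_of_real r *\<^sub>C P x) = r * f P"
    if r: "0 \<le> r" and P: "P \<in> C" for r P
  proof
    let ?S = "\<lambda>x. complex_of_real r *\<^sub>C P x"
    have s: "singular_sum ?S = (\<lambda>k. r * singular_sum P k)"
      by (rule ext) (rule singular_sum_scale[OF inf C[OF P] r])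
    have "positive_operator ?S" "compact_operator ?S"
      by (rule positive_operator_scale[OF C(1)[OF P] r]) (rule compact_operator_scaleC[OF C(2)[OF P]])
    moreover have "singular_sum ?S k \<le> r * b P * \<psi> (real k)" if "1 \<le> k" for k
      unfolding s mult.assoc by (intro mult_left_mono b P that r)
    ultimately show S: "?S \<in> C"
      unfolding C_def M_def using b(1)[OF P] r by (auto intro: marcinkiewicz_idealI[where C = "r * b P"])
    show "f ?S = r * f P"
      by (rule eqI[OF S]) (simp add: s gap_scale, intro tendsto_intros lim P)
  qed
  have unitary: "U' \<circ> P \<circ> cadjoint U' \<in> C \<and> f (U' \<circ> P \<circ> cadjoint U') = f P"
    if U': "unitary_operator U'" and P: "P \<in> C" for U' P
  proof
    let ?S = "U' \<circ> P \<circ> cadjoint U'"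
    have s: "singular_sum ?S = singular_sum P"
      by (rule ext) (rule singular_sum_unitary[OF inf C[OF P] U'])
    have "positive_operator ?S" "compact_operator ?S"
      by (rule conjugation_positive[OF unitary_operatorD(1)[OF U'] C(1)[OF P]])
        (rule conjugation_compact[OF unitary_operatorD(1)[OF U'] C(2)[OF P]])
    moreover have "singular_sum ?S k \<le> b P * \<psi> (real k)" if "1 \<le> k" for k
      unfolding s by (rule b(2)[OF P that])
    ultimately show S: "?S \<in> C"
      unfolding C_def M_def using marcinkiewicz_idealI[OF _ b(1)[OF P]] by blast
    show "f ?S = f P" by (rule eqI[OF S]) (simp only: s lim[OF P])
  qed
  have span: "\<exists>P0\<in>C. \<exists>P1\<in>C. \<exists>P2\<in>C. \<exists>P3\<in>C. \<forall>x. A x = P0 x - P2 x + \<i> *\<^sub>C (P1 x - P3 x)"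
    if A: "A \<in> M" for A
  proof -
    obtain c where c: "compact_operator A" "0 \<le> c" "\<And>k. 1 \<le> k \<Longrightarrow> singular_sum A k \<le> c * \<psi> (real k)"
      using A unfolding M_def by (rule marcinkiewicz_idealE) blast
    obtain Q where Q: "\<And>z. cmod z = 1 \<Longrightarrow> positive_operator (Q z)" "\<And>z. compact_operator (Q z)"
      "\<And>z n. cmod z = 1 \<Longrightarrow> singular_sum (Q z) n \<le> singular_sum A n"
      "\<And>x. A x = Q 1 x - Q (-1) x + \<i> *\<^sub>C (Q \<i> x - Q (-\<i>) x)"
      using positive_decomposition[OF inf c(1)] by blast
    have "Q z \<in> C" if z: "cmod z = 1" for z
      unfolding C_def M_def
    proof (intro CollectI conjI Q z marcinkiewicz_idealI[OF Q(2) c(2)])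
      show "singular_sum (Q z) k \<le> c * \<psi> (real k)" if "1 \<le> k" for k
        using Q(3)[OF z, of k] c(3)[OF that] by linarith
    qed
    then show ?thesis using Q(4) by (intro bexI[of _ "Q 1"] bexI[of _ "Q \<i>"] bexI[of _ "Q (-1)"] bexI[of _ "Q (-\<i>)"]) auto
  qed
  have fpos: "0 \<le> f P" if "P \<in> C" for P
    using lim[OF that] gap_nonneg[OF mono[OF that]] U(1)
    by (intro tendsto_lowerbound[of _ "f P" U]) auto
  have "\<exists>\<phi>. trace_on M \<phi> \<and> (\<forall>P\<in>C. \<phi> P = complex_of_real (f P))"
    unfolding C_def
    by (rule trace_extension[OF add[unfolded C_def] scale[unfolded C_def] fpos[unfolded C_def]
        unitary[unfolded C_def] span[unfolded C_def]])
  then obtain \<phi> where \<phi>: "trace_on M \<phi>" "\<And>P. P \<in> C \<Longrightarrow> \<phi> P = complex_of_real (f P)" by blast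
  show thesis
  proof (rule that[OF \<phi>(1)[unfolded M_def] U])
    fix P :: "'h \<Rightarrow> 'h" assume "P \<in> marcinkiewicz_ideal \<psi>" "positive_operator P"
    then have "P \<in> C" by (simp add: C_def M_def)
    then show "\<phi> P = complex_of_real (f P) \<and> ((\<lambda>n. gap n (singular_sum P)) \<longlongrightarrow> f P) U"
      using \<phi>(2) lim by blast
  qed
qed

text \<open>
  The singular values of \<open>A\<close> are the increments of \<open>\<psi>\<close>, those of \<open>B\<close> their block averages. The partial
  sums of \<open>B\<close> are below those of \<open>A\<close>, but the trace is at most 0 at \<open>A\<close> and at least 1 at \<open>B\<close>.
\<close>

theorem not_fully_symmetric_trace:
  assumes inf: "infinite_dimensional TYPE('h::complex_hilbert)"
  shows "\<exists>\<phi> :: ('h::complex_hilbert \<Rightarrow> 'h) \<Rightarrow> complex.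
    trace_on (marcinkiewicz_ideal \<psi>) \<phi> \<and> \<not> fully_symmetric_on (marcinkiewicz_ideal \<psi>) \<phi>"
proof -
  obtain \<phi> :: "('h \<Rightarrow> 'h) \<Rightarrow> complex" and f U where \<phi>: "trace_on (marcinkiewicz_ideal \<psi>) \<phi>"
    and U: "U \<noteq> bot" "U \<le> sequentially"
    and lim: "\<And>P. P \<in> marcinkiewicz_ideal \<psi> \<Longrightarrow> positive_operator P \<Longrightarrow>
      \<phi> P = complex_of_real (f P) \<and> ((\<lambda>n. gap n (singular_sum P)) \<longlongrightarrow> f P) U"
    by (rule gap_trace[OF inf]) (rule that, assumption+)
  have "positive_operator (\<lambda>x::'h. 0)"
    by (intro positive_operatorI compact_operator_bounded compact_operator_zero) auto
  \<comment> \<open>Diagonalising the zero operator provides an orthonormal sequence.\<close>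
  from spectral_theorem[OF inf this compact_operator_zero]
  obtain s and e :: "nat \<Rightarrow> 'h" where "eigensystem (\<lambda>x. 0) s e" .
  then have e: "orthonormal_on UNIV e" by (rule eigensystemD(2))
  have "(\<Sum>k<n. \<psi> (real (Suc k)) - \<psi> (real k)) \<le> \<psi> (real n)" for n
    using increments(3)[of n] nonneg[of 0] by simp
  then obtain A :: "'h \<Rightarrow> 'h" where A: "A \<in> marcinkiewicz_ideal \<psi>" "positive_operator A"
    "singular_sum A = (\<lambda>n. \<Sum>k<n. \<psi> (real (Suc k)) - \<psi> (real k))"
    using diagonal_member[OF inf e increments(1,2)] by blast
  have sA: "singular_sum A = (\<lambda>n. \<psi> (real n) - \<psi> 0)" unfolding A(3) by (rule ext) (rule increments(3))
  have "antimono averaged" using slope_decreasing block_mono by (auto simp: averaged_def antimono_def mono_def)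
  moreover have "0 \<le> averaged k" for k by (simp add: averaged_def slope_nonneg)
  moreover have "(\<Sum>k<n. averaged k) \<le> \<psi> (real n)" for n
    using averaged_sum_le[of n] nonneg[of 0] by simp
  ultimately obtain B :: "'h \<Rightarrow> 'h" where B: "B \<in> marcinkiewicz_ideal \<psi>" "positive_operator B"
    "singular_sum B = (\<lambda>n. \<Sum>k<n. averaged k)"
    using diagonal_member[OF inf e] by blast
  have small: "(\<lambda>n. 1 / real (Suc n)) \<longlonglongrightarrow> 0"
    using LIMSEQ_inverse_real_of_nat by (simp add: divide_inverse)
  have "f A \<le> 0"
  proof (rule tendsto_le[OF U(1) tendsto_mono[OF U(2) small]])
    show "((\<lambda>n. gap n (singular_sum A)) \<longlongrightarrow> f A) U" using lim[OF A(1,2)] by blast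
    show "\<forall>\<^sub>F n in U. gap n (singular_sum A) \<le> 1 / real (Suc n)"
      unfolding sA using gap_weight_small by (intro always_eventually) blast
  qed
  moreover have "1 \<le> f B"
  proof -
    have "(\<lambda>n. (1 / 2 :: real) ^ Suc n) \<longlonglongrightarrow> 0"
      by (rule LIMSEQ_Suc[OF LIMSEQ_power_zero]) simp
    then have "(\<lambda>n. 1 - 1 / real (Suc n) - 2 * (1 / 2) ^ Suc n) \<longlonglongrightarrow> 1 - 0 - 2 * 0"
      by (intro tendsto_intros small)
    then have "(\<lambda>n. 1 - 1 / real (Suc n) - 2 * (1 / 2) ^ Suc n) \<longlonglongrightarrow> 1" by simp
    from tendsto_mono[OF U(2) this] show ?thesis
    proof (rule tendsto_le[OF U(1), rotated])
      show "((\<lambda>n. gap n (singular_sum B)) \<longlongrightarrow> f B) U" using lim[OF B(1,2)] by blast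
      show "\<forall>\<^sub>F n in U. 1 - 1 / real (Suc n) - 2 * (1 / 2) ^ Suc n \<le> gap n (singular_sum B)"
        unfolding B(3) using gap_averaged_large by (intro always_eventually) blast
    qed
  qed
  ultimately have "\<not> \<phi> B \<le> \<phi> A"
    using lim[OF A(1,2)] lim[OF B(1,2)] by (simp add: less_eq_complex_def)
  moreover have "singular_sum B n \<le> singular_sum A n" for n
    unfolding sA B(3) by (rule averaged_sum_le)
  ultimately have "\<not> fully_symmetric_on (marcinkiewicz_ideal \<psi>) \<phi>"
    using A(1,2) B(1,2) unfolding fully_symmetric_on_def singular_sum_def by blast
  with \<phi> show ?thesis by blast
qed

end

theorem corollary6:
  fixes \<psi> :: "real \<Rightarrow> real"
  assumes "infinite_dimensional TYPE('h::complex_hilbert)"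
    and "separable TYPE('h)"
    and "\<forall>t\<ge>0. 0 \<le> \<psi> t"
    and "concave_on {0..} \<psi>"
    and "mono_on {0..} \<psi>"
    and "filterlim \<psi> at_top at_top"
    and "Liminf at_top (\<lambda>t. ereal (\<psi> (2 * t) / \<psi> t)) = 1"
  shows "\<exists>\<phi> :: ('h \<Rightarrow> 'h) \<Rightarrow> complex.
           trace_on (marcinkiewicz_ideal \<psi>) \<phi> \<and>
           \<not> fully_symmetric_on (marcinkiewicz_ideal \<psi>) \<phi>"
proof -
  interpret marcinkiewicz_function \<psi>
  proof
    show "0 \<le> \<psi> t" if "0 \<le> t" for t using assms(3) that by blast
  qed (rule assms)+
  obtain t p :: "nat \<Rightarrow> nat" where tp: "\<And>n. 1 \<le> t n" "\<And>n. \<psi> (2 ^ (3 * Suc n) * t n) \<le> (1 + 1 / Suc n) * \<psi> (t n)"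
    "p 0 = 0" "\<And>n. p (Suc n) = 2 ^ (2 * Suc n) * t n"
    "\<And>n. p n \<le> t n" "\<And>n. Suc n * \<psi> (p n) \<le> \<psi> (t n)"
    by (rule scales_exist) (rule that, assumption+)
  interpret gap_scales \<psi> t p by unfold_locales (rule tp)+
  show ?thesis by (rule not_fully_symmetric_trace[OF assms(1)])
qed

end
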